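(* Assume that $\varphi>0$ and $\psi>0$ on $\overline{D}$, that $u_\varphi>0$ and $v_\psi>0$ on $\overline{D}\times[0,T]$, and that $g_A(x,t;y,s)>0$ and $g_A^*(x,s;y,t)>0$ for all $x,y\in\overline{D}$ and all $s,t\in[0,T]$ with $t>s$, both being jointly continuous in these variables. Assume furthermore that $\mu(E\times F)=\int_{E\times F}dx\,dy\,\mu(x,y)$ with density $$\mu(x,y)=\varphi(x)g_A(y,T;x,0)\psi(y),\qquad \int_{D\times D}dx\,dy\,\varphi(x)g_A(y,T;x,0)\psi(y)=1,$$ and let $Z_{\tau\in[0,T]}$ be the corresponding Bernstein process on $(\Omega,\mathcal{F},\mathbb{P}_\mu)$. Put $\mu_0(x)=\varphi(x)v_\psi(x,0)$ and $\mu_T(y)=\psi(y)u_\varphi(y,T)$. Then: (a) We have $$\mathbb{P}_\mu(Z_0\in E_0,Z_{t_1}\in E_1,\dots,Z_{t_n}\in E_n)=\int_{E_0}dx\,\mu_0(x)\int_{E_1}dx_1\cdots\int_{E_n}dx_n\prod_{i=1}^n m^*(x_{i-1},t_{i-1};x_i,t_i)$$ where $x_0=x$, for all $E_0,E_1,\dots,E_n\in\mathcal{B}(\overline{D})$ and all $t_0,\dots,t_n\in[0,T)$ satisfying $t_0=0<t_1<\dots<t_n<T$. Thus $Z_{\tau\in[0,T]}$ is a forward Markov process with transition function (density) $m^*$ and initial distribution density $\mu_0$. (b) We have $$\mathbb{P}_\mu(Z_T\in E_T,Z_{t_n}\in E_n,\dots,Z_{t_1}\in E_1)=\int_{E_T}dy\,\mu_T(y)\int_{E_1}dx_1\cdots\int_{E_n}dx_n\prod_{i=1}^n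 m(x_{i+1},t_{i+1};x_i,t_i)$$ where $x_{n+1}=y$, for all $E_T,E_1,\dots,E_n\in\mathcal{B}(\overline{D})$ and all $t_1,\dots,t_{n+1}\in(0,T]$ satisfying $T=t_{n+1}>t_n>\dots>t_1>0$. Thus $Z_{\tau\in[0,T]}$ is also a backward Markov process with transition function (density) $m$ and final distribution density $\mu_T$. (c) We have $$\mathbb{P}_\mu(Z_t\in E)=\int_E dx\,u_\varphi(x,t)v_\psi(x,t)$$ for each $E\in\mathcal{B}(\overline{D})$ and every $t\in[0,T]$.
   Context: Setting. $T\in(0,+\infty)$; $D\subset\mathbb{R}^d$ is a bounded open convex set whose boundary $\partial D$ is of class $\mathcal{C}^{2+\alpha}$ for some $\alpha\in(0,1)$; $\overline{D}=D\cup\partial D$ with Borel $\sigma$-algebra $\mathcal{B}(\overline{D})$; $n(x)$ is the unit outer normal at $x\in\partial D$. $\mathcal{C}^{\alpha,\alpha/2}$ etc. denote the usual parabolic Hölder spaces. Standing hypotheses: (K) $k:\overline{D}\times[0,T]\to\mathbb{R}^{d^2}$ is matrix-valued with $k_{i,j}=k_{j,i}\in\mathcal{C}^{\alpha,\alpha/2}(\overline{D}\times[0,T])$ and $\partial k_{i,j}/\partial x_l\in\mathcal{C}^{\alpha,\alpha/2}(\overline{D}\times[0,T])$ for all $i,j,l$; $(k(x,t)q,q)_{\mathbb{R}^d}\ge\underline{k}|q|^2$ with a constant $\underline{k}>0$ for all $(x,t)\in\overline{D}\times[0,T]$, $q\in\mathbb{R}^d$; the conormal field $n_k(x,t):=k(x,t)n(x)$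 is uniformly outward pointing, nowhere tangent to $\partial D$ for every $t$, and $(x,t)\mapsto\sum_i k_{i,j}(x,t)n_i(x)\in\mathcal{C}^{1+\alpha,(1+\alpha)/2}(\partial D\times[0,T])$ for each $j$. (L) $l:\overline{D}\times[0,T]\to\mathbb{R}^d$ satisfies $l_i,\partial l_i/\partial x_j\in\mathcal{C}^{\alpha,\alpha/2}(\overline{D}\times[0,T])$ for all $i,j$. (V) $V\in\mathcal{C}^{\alpha,\alpha/2}(\overline{D}\times[0,T])$ is real-valued. (IF) $\varphi,\psi\in\mathcal{C}^{2+\alpha}(\overline{D})$ are real-valued, $\varphi$ satisfying the conormal boundary condition relative to $k$ at $t=0$ and $\psi$ satisfying it at $t=T$. Problems. Forward problem: $\partial_t u=\frac12\operatorname{div}_x(k\nabla_x u)-(l,\nabla_x u)_{\mathbb{R}^d}-Vu$ in $D\times(0,T]$, $u(\cdot,0)=\varphi$, $\partial u/\partial n_k=0$ on $\partial D\times(0,T]$. Adjoint problem: $-\partial_t v=\frac12\operatorname{div}_x(k\nabla_x v)+\operatorname{div}_x(vl)-Vv$ in $D\times[0,T)$, $v(\cdot,T)=\psi$, $\partial v/\partial n_k=0$ on $\partial D\times[0,T)$. $g_A(x,t;y,s)$ and $g_A^*(x,s;y,t)$ ($x,y\in\overline{D}$, $0\le s<t\le T$) are the respective parabolic Green functions: $U_A(t,s)f(x)=\int_D dy\,g_A(x,t;y,s)f(y)$ solves the forward equation with boundary condition and datum $f$ at time $s$, $U_A^*(t,s)f(x)=\int_D dy\,g_A^*(x,s;y,t)f(y)$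 solves the adjoint equation (in the variable $s$) with boundary condition and datum $f$ at time $t$; they satisfy $g_A^*(x,s;y,t)=g_A(y,t;x,s)$ and $g_A(x,t;y,s)=\int_D dz\,g_A(x,t;z,r)g_A(z,r;y,s)$ for $s<r<t$. The unique classical solutions of the two problems are $u_\varphi(x,t)=\int_D dy\,g_A(x,t;y,0)\varphi(y)$ ($u_\varphi(\cdot,0)=\varphi$) and $v_\psi(x,t)=\int_D dy\,g_A^*(x,t;y,T)\psi(y)$ ($v_\psi(\cdot,T)=\psi$). Transition densities. For $s<t$: $m^*(x,s;y,t):=g_A^*(x,s;y,t)\dfrac{v_\psi(y,t)}{v_\psi(x,s)}$ and $m(x,t;y,s):=g_A(x,t;y,s)\dfrac{u_\varphi(y,s)}{u_\varphi(x,t)}$. Bernstein process associated with $\mu$. With $p(x,t;z,r;y,s):=g_A(x,t;z,r)g_A(z,r;y,s)/g_A(x,t;y,s)$ for $s<r<t$, $Z_{\tau\in[0,T]}$ is the $\overline{D}$-valued process on $(\Omega,\mathcal{F},\mathbb{P}_\mu)$ with finite-dimensional distributions $\mathbb{P}_\mu(Z_0\in E_0,Z_{t_1}\in E_1,\dots,Z_{t_n}\in E_n,Z_T\in E_T)=\int_{E_0\times E_T}dx\,dy\,\mu(x,y)\int_{E_1}dx_1\cdots\int_{E_n}dx_n\prod_{i=1}^n p(y,T;x_i,t_i;x_{i-1},t_{i-1})$, $x_0=x$, $t_0=0<t_1<\dots<t_n<T$ (and $\mathbb{P}_\mu(Z_0\in E_0,Z_T\in E_T)=\mu(E_0\times E_T)$).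 It satisfies the Bernstein property $\mathbb{E}_\mu(h(Z_r)\mid\mathcal{F}_s^+\vee\mathcal{F}_t^-)=\mathbb{E}_\mu(h(Z_r)\mid Z_s,Z_t)$ for bounded Borel $h$ and $r\in(s,t)$, where $\mathcal{F}_s^+=\sigma(Z_\tau:\tau\le s)$, $\mathcal{F}_t^-=\sigma(Z_\tau:\tau\ge t)$. *)

theory Defs
  imports "HOL-Probability.Probability"
begin

section \<open>Derivatives, Hoelder classes and smooth domains\<close>

text \<open>
  Derivatives up to the boundary are Frechet derivatives within the closed domain. For a convex set
  with nonempty interior these are unique, and for a function on the closure they are the
  continuous extensions of the interior derivatives whenever such extensions exist.
  On a relatively open piece of a coordinate hyperplane only the tangential
  partial derivatives are meaningful; only these are used below.
\<close>

definition partial :: "(real^'n) set \<Rightarrow> 'n \<Rightarrow> (real^'n \<Rightarrow> 'b::real_normed_vector) \<Rightarrow> real^'n \<Rightarrow> 'b"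
  where "partial S i f x = frechet_derivative f (at x within S) (axis i 1)"

definition grad :: "(real^'n) set \<Rightarrow> (real^'n \<Rightarrow> real) \<Rightarrow> real^'n \<Rightarrow> real^'n"
  where "grad S f x = (\<chi> i. partial S i f x)"

definition divergence :: "(real^'n) set \<Rightarrow> (real^'n \<Rightarrow> real^'n) \<Rightarrow> real^'n \<Rightarrow> real"
  where "divergence S F x = (\<Sum>i\<in>UNIV. partial S i (\<lambda>z. F z $ i) x)"

definition holder :: "real \<Rightarrow> (real^'n) set \<Rightarrow> (real^'n \<Rightarrow> 'b::real_normed_vector) \<Rightarrow> bool"
  where "holder \<alpha> S f \<longleftrightarrow> bounded (f ` S) \<and>
    (\<exists>C. \<forall>x\<in>S. \<forall>y\<in>S. norm (f x - f y) \<le> C * norm (x - y) powr \<alpha>)"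

definition holder2 :: "real \<Rightarrow> (real^'n) set \<Rightarrow> (real^'n \<Rightarrow> 'b::real_normed_vector) \<Rightarrow> bool"
  \<comment> \<open>the class \<open>C\<^sup>2\<^sup>+\<^sup>\<alpha>\<close> on \<open>S\<close>\<close>
  where "holder2 \<alpha> S f \<longleftrightarrow>
    f differentiable_on S \<and> (\<forall>i. partial S i f differentiable_on S) \<and>
    holder \<alpha> S f \<and> (\<forall>i. holder \<alpha> S (partial S i f)) \<and>
    (\<forall>i j. holder \<alpha> S (partial S j (partial S i f)))"

definition par_holder :: "real \<Rightarrow> (real^'n) set \<Rightarrow> real \<Rightarrow> (real^'n \<Rightarrow> real \<Rightarrow> real) \<Rightarrow> bool"
  \<comment> \<open>the parabolic class with exponents \<open>\<alpha>\<close> in space and \<open>\<alpha>/2\<close> in time on \<open>S \<times> [0,T]\<close>\<close>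
  where "par_holder \<alpha> S T f \<longleftrightarrow>
    bounded ((\<lambda>(x,t). f x t) ` (S \<times> {0..T})) \<and>
    (\<exists>C. \<forall>x\<in>S. \<forall>y\<in>S. \<forall>t\<in>{0..T}. \<forall>s\<in>{0..T}.
      \<bar>f x t - f y s\<bar> \<le> C * (norm (x - y) powr \<alpha> + \<bar>t - s\<bar> powr (\<alpha>/2)))"

definition par_holder1 ::
  "real \<Rightarrow> (real^'n) set \<Rightarrow> 'n set \<Rightarrow> real \<Rightarrow> (real^'n \<Rightarrow> real \<Rightarrow> real) \<Rightarrow> bool"
  \<comment> \<open>exponents \<open>1+\<alpha>\<close> in space and \<open>(1+\<alpha>)/2\<close> in time, \<open>J\<close> being the set of coordinate
     directions tangent to \<open>S\<close>\<close>
  where "par_holder1 \<alpha> S J T f \<longleftrightarrow>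
    bounded ((\<lambda>(x,t). f x t) ` (S \<times> {0..T})) \<and>
    (\<forall>t\<in>{0..T}. (\<lambda>x. f x t) differentiable_on S) \<and>
    (\<forall>j\<in>J. par_holder \<alpha> S T (\<lambda>x t. partial S j (\<lambda>z. f z t) x)) \<and>
    (\<exists>C. \<forall>x\<in>S. \<forall>t\<in>{0..T}. \<forall>s\<in>{0..T}. \<bar>f x t - f x s\<bar> \<le> C * \<bar>t - s\<bar> powr ((1+\<alpha>)/2))"

definition straightening_chart ::
  "real \<Rightarrow> (real^'n) set \<Rightarrow> real^'n \<Rightarrow> real \<Rightarrow> 'n \<Rightarrow> (real^'n \<Rightarrow> real^'n) \<Rightarrow> (real^'n \<Rightarrow> real^'n) \<Rightarrow> bool"
  \<comment> \<open>\<open>\<theta>\<close>, with inverse \<open>\<eta>\<close>, flattens the boundary of \<open>D\<close> in the ball of radius \<open>e\<close> about \<open>a\<close>\<close>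
  where "straightening_chart \<alpha> D a e i \<theta> \<eta> \<longleftrightarrow>
    e > 0 \<and> open (\<theta> ` ball a e) \<and> (\<forall>x\<in>ball a e. \<eta> (\<theta> x) = x) \<and>
    holder2 \<alpha> (ball a e) \<theta> \<and> holder2 \<alpha> (\<theta> ` ball a e) \<eta> \<and>
    \<theta> ` (ball a e \<inter> D) = \<theta> ` ball a e \<inter> {y. y $ i > 0} \<and>
    \<theta> ` (ball a e \<inter> frontier D) = \<theta> ` ball a e \<inter> {y. y $ i = 0}"

definition smooth_boundary :: "real \<Rightarrow> (real^'n) set \<Rightarrow> bool"
  \<comment> \<open>the boundary is of class \<open>C\<^sup>2\<^sup>+\<^sup>\<alpha>\<close>\<close>
  where "smooth_boundary \<alpha> D \<longleftrightarrow>
    (\<forall>a\<in>frontier D. \<exists>e i \<theta> \<eta>. straightening_chart \<alpha> D a e i \<theta> \<eta>)"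

definition par_holder1_boundary ::
  "real \<Rightarrow> (real^'n) set \<Rightarrow> real \<Rightarrow> (real^'n \<Rightarrow> real \<Rightarrow> real) \<Rightarrow> bool"
  \<comment> \<open>the parabolic class of order \<open>1+\<alpha>\<close> on \<open>frontier D \<times> [0,T]\<close>, defined in local charts\<close>
  where "par_holder1_boundary \<alpha> D T b \<longleftrightarrow>
    (\<forall>a\<in>frontier D. \<exists>e i \<theta> \<eta>. straightening_chart \<alpha> D a e i \<theta> \<eta> \<and>
      par_holder1 \<alpha> (\<theta> ` ball a e \<inter> {y. y $ i = 0}) {j. j \<noteq> i} T (\<lambda>y t. b (\<eta> y) t))"

definition is_outer_normal :: "(real^'n) set \<Rightarrow> real^'n \<Rightarrow> real^'n \<Rightarrow> bool"
  where "is_outer_normal D x \<nu> \<longleftrightarrow> norm \<nu> = 1 \<and>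
    ((\<lambda>y. ((y - x) \<bullet> \<nu>) / norm (y - x)) \<longlongrightarrow> 0) (at x within frontier D) \<and>
    (\<forall>\<^sub>F h in at_right 0. x - h *\<^sub>R \<nu> \<in> D \<and> x + h *\<^sub>R \<nu> \<notin> closure D)"

definition outer_normal :: "(real^'n) set \<Rightarrow> real^'n \<Rightarrow> real^'n"
  where "outer_normal D x = (THE \<nu>. is_outer_normal D x \<nu>)"


section \<open>Hypotheses on the coefficients and on the data\<close>

definition conormal :: "(real^'n) set \<Rightarrow> (real^'n \<Rightarrow> real \<Rightarrow> real^'n^'n) \<Rightarrow> real^'n \<Rightarrow> real \<Rightarrow> real^'n"
  where "conormal D k x t = k x t *v outer_normal D x"

definition conormal_condition ::
  "(real^'n) set \<Rightarrow> (real^'n \<Rightarrow> real \<Rightarrow> real^'n^'n) \<Rightarrow> real \<Rightarrow> (real^'n \<Rightarrow> real) \<Rightarrow> bool"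
  where "conormal_condition D k t f \<longleftrightarrow>
    (\<forall>x\<in>frontier D. conormal D k x t \<bullet> grad (closure D) f x = 0)"

definition hyp_K ::
  "real \<Rightarrow> (real^'n) set \<Rightarrow> real \<Rightarrow> (real^'n \<Rightarrow> real \<Rightarrow> real^'n^'n) \<Rightarrow> bool"
  where "hyp_K \<alpha> D T k \<longleftrightarrow>
    (\<forall>x\<in>closure D. \<forall>t\<in>{0..T}. \<forall>i j. k x t $ i $ j = k x t $ j $ i) \<and>
    (\<forall>i j. par_holder \<alpha> (closure D) T (\<lambda>x t. k x t $ i $ j)) \<and>
    (\<forall>i j. \<forall>t\<in>{0..T}. (\<lambda>x. k x t $ i $ j) differentiable_on closure D) \<and>
    (\<forall>i j l. par_holder \<alpha> (closure D) T (\<lambda>x t. partial (closure D) l (\<lambda>z. k z t $ i $ j) x)) \<and>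
    (\<exists>\<kappa>>0. \<forall>x\<in>closure D. \<forall>t\<in>{0..T}. \<forall>q. (k x t *v q) \<bullet> q \<ge> \<kappa> * (norm q)\<^sup>2) \<and>
    (\<exists>c>0. \<forall>x\<in>frontier D. \<forall>t\<in>{0..T}. conormal D k x t \<bullet> outer_normal D x \<ge> c) \<and>
    (\<forall>j. par_holder1_boundary \<alpha> D T (\<lambda>x t. \<Sum>i\<in>UNIV. k x t $ i $ j * outer_normal D x $ i))"

definition hyp_L :: "real \<Rightarrow> (real^'n) set \<Rightarrow> real \<Rightarrow> (real^'n \<Rightarrow> real \<Rightarrow> real^'n) \<Rightarrow> bool"
  where "hyp_L \<alpha> D T l \<longleftrightarrow>
    (\<forall>i. par_holder \<alpha> (closure D) T (\<lambda>x t. l x t $ i)) \<and>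
    (\<forall>i. \<forall>t\<in>{0..T}. (\<lambda>x. l x t $ i) differentiable_on closure D) \<and>
    (\<forall>i j. par_holder \<alpha> (closure D) T (\<lambda>x t. partial (closure D) j (\<lambda>z. l z t $ i) x))"

definition hyp_V :: "real \<Rightarrow> (real^'n) set \<Rightarrow> real \<Rightarrow> (real^'n \<Rightarrow> real \<Rightarrow> real) \<Rightarrow> bool"
  where "hyp_V \<alpha> D T V \<longleftrightarrow> par_holder \<alpha> (closure D) T V"

definition hyp_IF ::
  "real \<Rightarrow> (real^'n) set \<Rightarrow> real \<Rightarrow> (real^'n \<Rightarrow> real \<Rightarrow> real^'n^'n) \<Rightarrow>
    (real^'n \<Rightarrow> real) \<Rightarrow> (real^'n \<Rightarrow> real) \<Rightarrow> bool"
  where "hyp_IF \<alpha> D T k \<phi> \<psi> \<longleftrightarrow>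
    holder2 \<alpha> (closure D) \<phi> \<and> conormal_condition D k 0 \<phi> \<and>
    holder2 \<alpha> (closure D) \<psi> \<and> conormal_condition D k T \<psi>"


section \<open>The forward and adjoint problems and their Green functions\<close>

definition spatially_C2 :: "(real^'n) set \<Rightarrow> real set \<Rightarrow> (real^'n \<Rightarrow> real \<Rightarrow> real) \<Rightarrow> bool"
  \<comment> \<open>\<open>C\<^sup>2\<close> in space inside \<open>D\<close>, \<open>C\<^sup>1\<close> in space up to the boundary, for times in \<open>I\<close>\<close>
  where "spatially_C2 D I u \<longleftrightarrow>
    (\<forall>t\<in>I. (\<lambda>x. u x t) differentiable_on closure D) \<and>
    continuous_on (closure D \<times> I) (\<lambda>(x,t). grad (closure D) (\<lambda>z. u z t) x) \<and>
    (\<forall>i. \<forall>t\<in>I. partial D i (\<lambda>z. u z t) differentiable_on D) \<and>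
    (\<forall>i j. continuous_on (D \<times> I) (\<lambda>(x,t). partial D j (partial D i (\<lambda>z. u z t)) x))"

definition diffusion ::
  "(real^'n) set \<Rightarrow> (real^'n \<Rightarrow> real \<Rightarrow> real^'n^'n) \<Rightarrow> (real^'n \<Rightarrow> real \<Rightarrow> real) \<Rightarrow> real^'n \<Rightarrow> real \<Rightarrow> real"
  where "diffusion D k u x t =
    1/2 * divergence D (\<lambda>z. k z t *v grad D (\<lambda>w. u w t) z) x"

definition forward_solution ::
  "(real^'n) set \<Rightarrow> real \<Rightarrow> (real^'n \<Rightarrow> real \<Rightarrow> real^'n^'n) \<Rightarrow> (real^'n \<Rightarrow> real \<Rightarrow> real^'n) \<Rightarrow>
    (real^'n \<Rightarrow> real \<Rightarrow> real) \<Rightarrow> real \<Rightarrow> (real^'n \<Rightarrow> real) \<Rightarrow> (real^'n \<Rightarrow> real \<Rightarrow> real) \<Rightarrow> bool"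
  \<comment> \<open>\<open>u\<close> is a classical solution on \<open>[s,T]\<close> with datum \<open>f\<close> at time \<open>s\<close>\<close>
  where "forward_solution D T k l V s f u \<longleftrightarrow>
    continuous_on (closure D \<times> {s..T}) (\<lambda>(x,t). u x t) \<and>
    spatially_C2 D {s<..T} u \<and>
    (\<forall>x\<in>D. \<forall>t\<in>{s<..T}. ((\<lambda>r. u x r) has_real_derivative
      diffusion D k u x t - l x t \<bullet> grad D (\<lambda>z. u z t) x - V x t * u x t) (at t within {s..T})) \<and>
    (\<forall>x\<in>closure D. u x s = f x) \<and>
    (\<forall>t\<in>{s<..T}. conormal_condition D k t (\<lambda>x. u x t))"

definition adjoint_solution ::
  "(real^'n) set \<Rightarrow> (real^'n \<Rightarrow> real \<Rightarrow> real^'n^'n) \<Rightarrow> (real^'n \<Rightarrow> real \<Rightarrow> real^'n) \<Rightarrow>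
    (real^'n \<Rightarrow> real \<Rightarrow> real) \<Rightarrow> real \<Rightarrow> (real^'n \<Rightarrow> real) \<Rightarrow> (real^'n \<Rightarrow> real \<Rightarrow> real) \<Rightarrow> bool"
  \<comment> \<open>\<open>v\<close> is a classical solution on \<open>[0,t]\<close> with datum \<open>f\<close> at the final time \<open>t\<close>\<close>
  where "adjoint_solution D k l V t f v \<longleftrightarrow>
    continuous_on (closure D \<times> {0..t}) (\<lambda>(x,s). v x s) \<and>
    spatially_C2 D {0..<t} v \<and>
    (\<forall>x\<in>D. \<forall>s\<in>{0..<t}. ((\<lambda>r. v x r) has_real_derivative
      - (diffusion D k v x s + divergence D (\<lambda>z. v z s *\<^sub>R l z s) x - V x s * v x s))
        (at s within {0..t})) \<and>
    (\<forall>x\<in>closure D. v x t = f x) \<and>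
    (\<forall>s\<in>{0..<t}. conormal_condition D k s (\<lambda>x. v x s))"

definition forward_evolution ::
  "(real^'n) set \<Rightarrow> (real^'n \<Rightarrow> real \<Rightarrow> real^'n \<Rightarrow> real \<Rightarrow> real) \<Rightarrow> real \<Rightarrow> (real^'n \<Rightarrow> real) \<Rightarrow>
    real^'n \<Rightarrow> real \<Rightarrow> real"
  where "forward_evolution D g s f x t = (if t = s then f x else (LINT y:D|lborel. g x t y s * f y))"

definition adjoint_evolution ::
  "(real^'n) set \<Rightarrow> (real^'n \<Rightarrow> real \<Rightarrow> real^'n \<Rightarrow> real \<Rightarrow> real) \<Rightarrow> real \<Rightarrow> (real^'n \<Rightarrow> real) \<Rightarrow>
    real^'n \<Rightarrow> real \<Rightarrow> real"
  where "adjoint_evolution D g' t f x s = (if s = t then f x else (LINT y:D|lborel. g' x s y t * f y))"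

text \<open>
  Argument order: \<open>g x t y s\<close> for the forward and \<open>g' x s y t\<close> for the adjoint Green function,
  both with \<open>s < t\<close>. The duality relation and the composition law belong to the definition of
  a pair of Green functions.
\<close>

definition green_functions ::
  "(real^'n) set \<Rightarrow> real \<Rightarrow> (real^'n \<Rightarrow> real \<Rightarrow> real^'n^'n) \<Rightarrow> (real^'n \<Rightarrow> real \<Rightarrow> real^'n) \<Rightarrow>
    (real^'n \<Rightarrow> real \<Rightarrow> real) \<Rightarrow> (real^'n \<Rightarrow> real \<Rightarrow> real^'n \<Rightarrow> real \<Rightarrow> real) \<Rightarrow>
    (real^'n \<Rightarrow> real \<Rightarrow> real^'n \<Rightarrow> real \<Rightarrow> real) \<Rightarrow> bool"
  where "green_functions D T k l V g g' \<longleftrightarrow>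
    (\<forall>f s. continuous_on (closure D) f \<longrightarrow> 0 \<le> s \<longrightarrow> s < T \<longrightarrow>
      forward_solution D T k l V s f (forward_evolution D g s f)) \<and>
    (\<forall>f t. continuous_on (closure D) f \<longrightarrow> 0 < t \<longrightarrow> t \<le> T \<longrightarrow>
      adjoint_solution D k l V t f (adjoint_evolution D g' t f)) \<and>
    (\<forall>x\<in>closure D. \<forall>y\<in>closure D. \<forall>s t. 0 \<le> s \<longrightarrow> s < t \<longrightarrow> t \<le> T \<longrightarrow>
      g' x s y t = g y t x s) \<and>
    (\<forall>x\<in>closure D. \<forall>y\<in>closure D. \<forall>s r t. 0 \<le> s \<longrightarrow> s < r \<longrightarrow> r < t \<longrightarrow> t \<le> T \<longrightarrow>
      g x t y s = (LINT z:D|lborel. g x t z r * g z r y s))"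

definition m_fwd ::
  "(real^'n \<Rightarrow> real \<Rightarrow> real^'n \<Rightarrow> real \<Rightarrow> real) \<Rightarrow> (real^'n \<Rightarrow> real \<Rightarrow> real) \<Rightarrow>
    real^'n \<Rightarrow> real \<Rightarrow> real^'n \<Rightarrow> real \<Rightarrow> real"
  \<comment> \<open>the density \<open>m\<^sup>*(x,s;y,t)\<close>, \<open>s < t\<close>\<close>
  where "m_fwd g' v x s y t = g' x s y t * (v y t / v x s)"

definition m_bwd ::
  "(real^'n \<Rightarrow> real \<Rightarrow> real^'n \<Rightarrow> real \<Rightarrow> real) \<Rightarrow> (real^'n \<Rightarrow> real \<Rightarrow> real) \<Rightarrow>
    real^'n \<Rightarrow> real \<Rightarrow> real^'n \<Rightarrow> real \<Rightarrow> real"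
  \<comment> \<open>the density \<open>m(x,t;y,s)\<close>, \<open>s < t\<close>\<close>
  where "m_bwd g u x t y s = g x t y s * (u y s / u x t)"

definition p_bridge ::
  "(real^'n \<Rightarrow> real \<Rightarrow> real^'n \<Rightarrow> real \<Rightarrow> real) \<Rightarrow>
    real^'n \<Rightarrow> real \<Rightarrow> real^'n \<Rightarrow> real \<Rightarrow> real^'n \<Rightarrow> real \<Rightarrow> real"
  where "p_bridge g x t z r y s = g x t z r * g z r y s / g x t y s"


section \<open>Bernstein and Markov processes\<close>

abbreviation borel_closure :: "(real^'n) set \<Rightarrow> (real^'n) measure"
  where "borel_closure D \<equiv> restrict_space borel (closure D)"

definition gen_algebra ::
  "'w measure \<Rightarrow> (real^'n) set \<Rightarrow> (real \<Rightarrow> 'w \<Rightarrow> real^'n) \<Rightarrow> real set \<Rightarrow> 'w measure"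
  \<comment> \<open>the sigma-algebra generated by the \<open>Z \<tau>\<close> with \<open>\<tau> \<in> I\<close>\<close>
  where "gen_algebra M D Z I = sigma (space M)
    {Z \<tau> -` A \<inter> space M | \<tau> A. \<tau> \<in> I \<and> A \<in> sets (borel_closure D)}"

definition bounded_borel :: "(real^'n) set \<Rightarrow> (real^'n \<Rightarrow> real) \<Rightarrow> bool"
  where "bounded_borel D h \<longleftrightarrow> h \<in> borel_measurable (borel_closure D) \<and> bounded (h ` closure D)"

text \<open>
  In the finite-dimensional distributions below, an \<open>n\<close>-fold integral over \<open>E 1, ..., E n\<close> is an
  integral over the product set with respect to the product of \<open>n\<close> copies of Lebesgue measure;
  the end points (\<open>x\<^sub>0 = x\<close>, \<open>x\<^sub>n\<^sub>+\<^sub>1 = y\<close>) are put in by function update.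
  For \<open>n = 0\<close> the product measure is a unit point mass, so that in particular the joint
  distribution of \<open>(Z 0, Z T)\<close> has density \<open>\<mu>\<close>.
\<close>

definition bernstein_process ::
  "(real^'n) set \<Rightarrow> real \<Rightarrow> (real^'n \<Rightarrow> real \<Rightarrow> real^'n \<Rightarrow> real \<Rightarrow> real) \<Rightarrow>
    (real^'n \<Rightarrow> real^'n \<Rightarrow> real) \<Rightarrow> 'w measure \<Rightarrow> (real \<Rightarrow> 'w \<Rightarrow> real^'n) \<Rightarrow> bool"
  where "bernstein_process D T g \<mu> M Z \<longleftrightarrow>
    prob_space M \<and>
    (\<forall>t\<in>{0..T}. Z t \<in> measurable M (borel_closure D)) \<and>
    (\<forall>n t E E\<^sub>T. t 0 = 0 \<longrightarrow> (\<forall>i<n. t i < t (Suc i)) \<longrightarrow> t n < T \<longrightarrow>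
      (\<forall>i\<le>n. E i \<in> sets (borel_closure D)) \<longrightarrow> E\<^sub>T \<in> sets (borel_closure D) \<longrightarrow>
      emeasure M {\<omega>\<in>space M. (\<forall>i\<le>n. Z (t i) \<omega> \<in> E i) \<and> Z T \<omega> \<in> E\<^sub>T} =
      (\<integral>\<^sup>+ xy\<in>E 0 \<times> E\<^sub>T. (case xy of (x, y) \<Rightarrow> ennreal (\<mu> x y) *
        (\<integral>\<^sup>+ z\<in>PiE {1..n} E.
          ennreal (\<Prod>i=1..n. p_bridge g y T ((z(0 := x)) i) (t i) ((z(0 := x)) (i - 1)) (t (i - 1)))
          \<partial>(Pi\<^sub>M {1..n} (\<lambda>_. lborel)))) \<partial>lborel)) \<and>
    (\<forall>s r t h. 0 \<le> s \<longrightarrow> s < r \<longrightarrow> r < t \<longrightarrow> t \<le> T \<longrightarrow> bounded_borel D h \<longrightarrow>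
      (AE \<omega> in M. real_cond_exp M (gen_algebra M D Z ({0..s} \<union> {t..T})) (\<lambda>\<omega>. h (Z r \<omega>)) \<omega>
        = real_cond_exp M (gen_algebra M D Z {s, t}) (\<lambda>\<omega>. h (Z r \<omega>)) \<omega>))"

definition forward_markov ::
  "(real^'n) set \<Rightarrow> real \<Rightarrow> 'w measure \<Rightarrow> (real \<Rightarrow> 'w \<Rightarrow> real^'n) \<Rightarrow>
    (real^'n \<Rightarrow> real \<Rightarrow> real^'n \<Rightarrow> real \<Rightarrow> real) \<Rightarrow> (real^'n \<Rightarrow> real) \<Rightarrow> bool"
  \<comment> \<open>transition density \<open>q x s y t\<close> (from \<open>x\<close> at time \<open>s\<close> to \<open>y\<close> at time \<open>t > s\<close>) and initial
     density \<open>\<rho>\<close>\<close>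
  where "forward_markov D T M Z q \<rho> \<longleftrightarrow>
    (\<forall>s t. 0 \<le> s \<longrightarrow> s < t \<longrightarrow> t \<le> T \<longrightarrow>
      (\<lambda>(x,y). q x s y t) \<in> borel_measurable (restrict_space borel (closure D \<times> closure D)) \<and>
      (\<forall>x\<in>closure D. \<forall>y\<in>closure D. 0 \<le> q x s y t) \<and>
      (\<forall>x\<in>closure D. (\<integral>\<^sup>+ y\<in>D. ennreal (q x s y t) \<partial>lborel) = 1)) \<and>
    (\<forall>s r t. 0 \<le> s \<longrightarrow> s < r \<longrightarrow> r < t \<longrightarrow> t \<le> T \<longrightarrow> (\<forall>x\<in>closure D. \<forall>y\<in>closure D.
      q x s y t = (LINT z:D|lborel. q x s z r * q z r y t))) \<and>
    (\<forall>E\<in>sets (borel_closure D).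
      emeasure M {\<omega>\<in>space M. Z 0 \<omega> \<in> E} = (\<integral>\<^sup>+ x\<in>E. ennreal (\<rho> x) \<partial>lborel)) \<and>
    (\<forall>s t h. 0 \<le> s \<longrightarrow> s < t \<longrightarrow> t \<le> T \<longrightarrow> bounded_borel D h \<longrightarrow> (AE \<omega> in M.
      real_cond_exp M (gen_algebra M D Z {0..s}) (\<lambda>\<omega>. h (Z t \<omega>)) \<omega>
        = real_cond_exp M (gen_algebra M D Z {s}) (\<lambda>\<omega>. h (Z t \<omega>)) \<omega> \<and>
      real_cond_exp M (gen_algebra M D Z {0..s}) (\<lambda>\<omega>. h (Z t \<omega>)) \<omega>
        = (LINT y:D|lborel. q (Z s \<omega>) s y t * h y)))"

definition backward_markov ::
  "(real^'n) set \<Rightarrow> real \<Rightarrow> 'w measure \<Rightarrow> (real \<Rightarrow> 'w \<Rightarrow> real^'n) \<Rightarrow>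
    (real^'n \<Rightarrow> real \<Rightarrow> real^'n \<Rightarrow> real \<Rightarrow> real) \<Rightarrow> (real^'n \<Rightarrow> real) \<Rightarrow> bool"
  \<comment> \<open>transition density \<open>q x t y s\<close> (from \<open>x\<close> at time \<open>t\<close> back to \<open>y\<close> at time \<open>s < t\<close>) and final
     density \<open>\<rho>\<close>\<close>
  where "backward_markov D T M Z q \<rho> \<longleftrightarrow>
    (\<forall>s t. 0 \<le> s \<longrightarrow> s < t \<longrightarrow> t \<le> T \<longrightarrow>
      (\<lambda>(x,y). q x t y s) \<in> borel_measurable (restrict_space borel (closure D \<times> closure D)) \<and>
      (\<forall>x\<in>closure D. \<forall>y\<in>closure D. 0 \<le> q x t y s) \<and>
      (\<forall>x\<in>closure D. (\<integral>\<^sup>+ y\<in>D. ennreal (q x t y s) \<partial>lborel) = 1)) \<and>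
    (\<forall>s r t. 0 \<le> s \<longrightarrow> s < r \<longrightarrow> r < t \<longrightarrow> t \<le> T \<longrightarrow> (\<forall>x\<in>closure D. \<forall>y\<in>closure D.
      q x t y s = (LINT z:D|lborel. q x t z r * q z r y s))) \<and>
    (\<forall>E\<in>sets (borel_closure D).
      emeasure M {\<omega>\<in>space M. Z T \<omega> \<in> E} = (\<integral>\<^sup>+ x\<in>E. ennreal (\<rho> x) \<partial>lborel)) \<and>
    (\<forall>s t h. 0 \<le> s \<longrightarrow> s < t \<longrightarrow> t \<le> T \<longrightarrow> bounded_borel D h \<longrightarrow> (AE \<omega> in M.
      real_cond_exp M (gen_algebra M D Z {t..T}) (\<lambda>\<omega>. h (Z s \<omega>)) \<omega>
        = real_cond_exp M (gen_algebra M D Z {t}) (\<lambda>\<omega>. h (Z s \<omega>)) \<omega> \<and>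
      real_cond_exp M (gen_algebra M D Z {t..T}) (\<lambda>\<omega>. h (Z s \<omega>)) \<omega>
        = (LINT y:D|lborel. q (Z t \<omega>) t y s * h y)))"

end

theory Submission
  imports Defs
begin

text \<open>
  The product of the bridge kernels telescopes: multiplied by the density \<open>\<mu>\<close>, it is a product of
  Green functions between consecutive times with \<open>\<phi>\<close> at one end and \<open>\<psi>\<close> at the other.
  By the composition law, integrating out everything before the first (after the last) observed
  time replaces \<open>\<phi>\<close> by \<open>u\<close> (\<open>\<psi>\<close> by \<open>v\<close>), so the density at arbitrary times \<open>t\<^sub>1 < \<dots> < t\<^sub>n\<close> is
  \<open>u(x\<^sub>1,t\<^sub>1) \<Prod> g(x\<^sub>i\<^sub>+\<^sub>1,t\<^sub>i\<^sub>+\<^sub>1;x\<^sub>i,t\<^sub>i) v(x\<^sub>n,t\<^sub>n)\<close>. Both Markov properties are h-transforms read off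
  from this symmetric formula, by integrating from either end.
\<close>

section \<open>Iterated Green kernels\<close>

text \<open>All computations take place in \<open>ennreal\<close>: the kernels are nonnegative, so
  Tonelli exchanges iterated integrals without integrability conditions. The analytic input is
  stated with Bochner integrals over D; strict positivity of their values and the nullity of the
  frontier of a convex set carry it over to nonnegative integrals over the closed domain, where the
  process lives.

  Densities are organised along lists of observations, which admit induction and can be cut at any
  observed time; the integrals over products of Lebesgue measure are identified with recursions over
  such lists. The bridge formula always observes both 0 and T; at an unwanted end time the whole
  state space is observed.

  The Markov properties concern sigma-algebras generated by uncountably many times. They reduce to
  finite cylinders by uniqueness of finite measures on an infinite product. One kernel argument
  serves both directions, since it only knows a set of conditioning times with a distinguished
  element, and a further time to be predicted.\<close>

lemma indicator_PiE_insert: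
  fixes n :: nat
  assumes "z \<in> extensional {1..n}"
  shows "indicator (PiE {1..Suc n} E) (z(Suc n := y))
    = (indicator (PiE {1..n} E) z * indicator (E (Suc n)) y :: 'b::semiring_1)"
proof -
  have "{1..Suc n} = insert (Suc n) {1..n}" by auto
  then have "(\<forall>i\<in>{1..Suc n}. (z(Suc n := y)) i \<in> E i) \<longleftrightarrow> (\<forall>i\<in>{1..n}. z i \<in> E i) \<and> y \<in> E (Suc n)"
    by auto
  \<comment> \<open>\<open>PiE\<close> also demands the value \<open>undefined\<close> off the index
    set; this is what the extensionality premise is for.\<close>
  moreover have "z(Suc n := y) \<in> extensional {1..Suc n}"
    using assms by (auto simp: extensional_def)
  ultimately have "z(Suc n := y) \<in> PiE {1..Suc n} E \<longleftrightarrow> z \<in> PiE {1..n} E \<and> y \<in> E (Suc n)"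
    using assms unfolding PiE_iff by blast
  then show ?thesis
    by (auto split: split_indicator)
qed

lemma upd_component_borel:
  fixes i j n :: nat
  assumes "i = j \<or> i \<in> {1..n}"
  shows "(\<lambda>z. (z(j := x)) i) \<in> borel_measurable (Pi\<^sub>M {1..n} (\<lambda>_. lborel :: 'a::euclidean_space measure))"
proof (cases "i = j")
  case False
  then have "(\<lambda>z. z i) \<in> measurable (Pi\<^sub>M {1..n} (\<lambda>_. lborel)) (lborel :: 'a measure)"
    using assms by (intro measurable_component_singleton) auto
  then show ?thesis using False by simp
qed simp

lemma sets_PiE_atLeastAtMost:
  fixes n :: nat
  assumes "\<And>i. i \<in> {1..n} \<Longrightarrow> E i \<in> sets borel"
  shows "PiE {1..n} E \<in> sets (Pi\<^sub>M {1..n} (\<lambda>_. lborel :: 'a::euclidean_space measure))"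
  using assms by (intro sets_PiM_I_finite) auto

text \<open>\<open>G t s x y\<close> stands for g(x,t;y,s), the later time and point first. In the
  evolution of \<open>V\<close> the first space argument is integrated: the adjoint flow uses the
  same kernel in the opposite direction. The evolution laws start from the end times 0 and T; the
  composition law extends them to all pairs of times. Since \<open>U\<close> and \<open>V\<close>
  vanish off \<open>S\<close>, observing all of \<open>S\<close> at an end time changes
  nothing.\<close>

locale green_kernel =
  fixes S :: "'a::euclidean_space set" and T :: real
    and G :: "real \<Rightarrow> real \<Rightarrow> 'a \<Rightarrow> 'a \<Rightarrow> ennreal"
    and U V :: "real \<Rightarrow> 'a \<Rightarrow> ennreal"
  assumes T_pos: "0 < T"
    and S_borel [measurable]: "S \<in> sets borel"
    and G_borel: "(\<lambda>(x, y). G t s x y) \<in> borel_measurable (borel \<Otimes>\<^sub>M borel)"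
    and U_borel [measurable]: "U t \<in> borel_measurable borel"
    and V_borel [measurable]: "V t \<in> borel_measurable borel"
    and U_outside: "x \<notin> S \<Longrightarrow> U t x = 0"
    and V_outside: "x \<notin> S \<Longrightarrow> V t x = 0"
    and chapman_kolmogorov:
      "0 \<le> s \<Longrightarrow> s < r \<Longrightarrow> r < t \<Longrightarrow> t \<le> T \<Longrightarrow> (\<integral>\<^sup>+ z. G t r x z * G r s z y \<partial>lborel) = G t s x y"
    and U_initial: "0 < t \<Longrightarrow> t \<le> T \<Longrightarrow> U t x = (\<integral>\<^sup>+ y. G t 0 x y * U 0 y \<partial>lborel)"
    and V_final: "0 \<le> s \<Longrightarrow> s < T \<Longrightarrow> V s x = (\<integral>\<^sup>+ y. G T s y x * V T y \<partial>lborel)"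
begin

lemma G_measurable [measurable (raw)]:
  assumes [measurable]: "f \<in> borel_measurable N" "h \<in> borel_measurable N"
  shows "(\<lambda>\<omega>. G t s (f \<omega>) (h \<omega>)) \<in> borel_measurable N"
proof -
  have "(\<lambda>\<omega>. (f \<omega>, h \<omega>)) \<in> measurable N (borel \<Otimes>\<^sub>M borel)"
    by measurable
  from measurable_compose[OF this G_borel[of t s]] show ?thesis by simp
qed

text \<open>Expanding \<open>U s\<close> from time 0 and exchanging the integrals leaves the
  composition of the kernels from 0 to \<open>s\<close> and from \<open>s\<close> to
  \<open>t\<close>. For \<open>s = 0\<close> it is the hypothesis itself.\<close>

lemma U_evolution:
  assumes "0 \<le> s" "s < t" "t \<le> T"
  shows "(\<integral>\<^sup>+ y. G t s x y * U s y \<partial>lborel) = U t x"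
proof (cases "s = 0")
  case False
  have "(\<integral>\<^sup>+ y. G t s x y * U s y \<partial>lborel)
      = (\<integral>\<^sup>+ y. (\<integral>\<^sup>+ z. G t s x y * (G s 0 y z * U 0 z) \<partial>lborel) \<partial>lborel)"
    using assms False by (subst U_initial) (auto simp: nn_integral_cmult)
  also have "\<dots> = (\<integral>\<^sup>+ z. (\<integral>\<^sup>+ y. G t s x y * (G s 0 y z * U 0 z) \<partial>lborel) \<partial>lborel)"
    by (rule lborel_pair.Fubini') measurable
  also have "\<dots> = (\<integral>\<^sup>+ z. (\<integral>\<^sup>+ y. G t s x y * G s 0 y z \<partial>lborel) * U 0 z \<partial>lborel)"
    by (simp add: nn_integral_multc mult.assoc[symmetric])
  also have "\<dots> = U t x"
    using assms False by (simp add: chapman_kolmogorov U_initial)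
  finally show ?thesis .
qed (use assms U_initial in simp)

lemma V_evolution:
  assumes "0 \<le> s" "s < t" "t \<le> T"
  shows "(\<integral>\<^sup>+ y. G t s y x * V t y \<partial>lborel) = V s x"
proof (cases "t = T")
  case False
  have "(\<integral>\<^sup>+ y. G t s y x * V t y \<partial>lborel)
      = (\<integral>\<^sup>+ y. (\<integral>\<^sup>+ z. G T t z y * G t s y x * V T z \<partial>lborel) \<partial>lborel)"
    using assms False by (subst V_final) (auto simp: nn_integral_cmult[symmetric] ac_simps)
  also have "\<dots> = (\<integral>\<^sup>+ z. (\<integral>\<^sup>+ y. G T t z y * G t s y x * V T z \<partial>lborel) \<partial>lborel)"
    by (rule lborel_pair.Fubini') measurable
  also have "\<dots> = V s x"
    using assms False by (simp add: nn_integral_multc chapman_kolmogorov V_final)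
  finally show ?thesis .
qed (use assms V_final in simp)

text \<open>Weight of the observations after time \<open>s\<close> given the position
  \<open>x\<close> at \<open>s\<close>, the earliest at the head. The final weight is a parameter
  because two are needed: \<open>V\<close> for a free end and \<open>\<lambda>r. G T r y\<close> for
  an end pinned at \<open>y\<close>. It depends on time because the last observed time varies with
  the list.\<close>

fun backward :: "(real \<Rightarrow> 'a \<Rightarrow> ennreal) \<Rightarrow> (real \<times> 'a set) list \<Rightarrow> real \<Rightarrow> 'a \<Rightarrow> ennreal" where
  "backward F [] s x = F s x"
| "backward F ((t, E) # ps) s x = (\<integral>\<^sup>+ y\<in>E. (G t s y x * backward F ps t y) \<partial>lborel)"

text \<open>The list runs backwards in time: its head is the last observation before
  \<open>t\<close>.\<close>

fun forward :: "(real \<times> 'a set) list \<Rightarrow> real \<Rightarrow> 'a \<Rightarrow> ennreal" where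
  "forward [] t x = U t x"
| "forward ((s, E) # ps) t x = (\<integral>\<^sup>+ y\<in>E. (G t s x y * forward ps s y) \<partial>lborel)"

text \<open>The weight at the first observed time is \<open>U\<close>, not the initial datum, so
  that neither 0 nor T has to be observed.\<close>

fun fdd :: "(real \<times> 'a set) list \<Rightarrow> ennreal" where
  "fdd [] = 1"
| "fdd ((t, E) # ps) = (\<integral>\<^sup>+ x\<in>E. (U t x * backward V ps t x) \<partial>lborel)"

text \<open>Measurability of the sections would not suffice: the pinned end point is later
  integrated by Tonelli, which needs the parameter and the point jointly. In the induction the
  hypothesis is restated for arbitrary measurable arguments, so that it applies to the integrand,
  where a new integration variable appears.\<close>

lemma backward_param_borel:
  assumes "\<And>r. (\<lambda>(p, x). F p r x) \<in> borel_measurable (borel \<Otimes>\<^sub>M borel)"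
    and "\<forall>(t, E)\<in>set ps. E \<in> sets borel"
  shows "(\<lambda>(p :: 'a, x). backward (F p) ps s x) \<in> borel_measurable (borel \<Otimes>\<^sub>M borel)"
  using assms(2)
proof (induction ps arbitrary: s)
  case Nil
  then show ?case using assms(1) by simp
next
  case (Cons q ps)
  obtain t E where q: "q = (t, E)" by force
  have [measurable]: "E \<in> sets borel" using Cons.prems q by auto
  have IH: "(\<lambda>(p, x). backward (F p) ps t x) \<in> borel_measurable (borel \<Otimes>\<^sub>M borel)"
    using Cons by auto
  have [measurable]: "(\<lambda>z. backward (F (f z)) ps t (h z)) \<in> borel_measurable N"
    if [measurable]: "f \<in> borel_measurable N" "h \<in> borel_measurable N"
    for N :: "'z measure" and f h
  proof -
    have "(\<lambda>z. (f z, h z)) \<in> measurable N (borel \<Otimes>\<^sub>M borel)"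
      by measurable
    from measurable_compose[OF this IH] show ?thesis by simp
  qed
  show ?case
    unfolding q backward.simps split_beta by measurable
qed

lemma backward_borel:
  assumes "\<And>r. F r \<in> borel_measurable borel"
    and "\<forall>(t, E)\<in>set ps. E \<in> sets borel"
  shows "backward F ps s \<in> borel_measurable borel"
proof -
  have [measurable]: "F r \<in> borel_measurable borel" for r by fact
  have "(\<lambda>(p :: 'a, x). backward ((\<lambda>p. F) p) ps s x) \<in> borel_measurable (borel \<Otimes>\<^sub>M borel)"
    by (rule backward_param_borel) (use assms(2) in measurable)
  from measurable_compose[OF _ this, of "\<lambda>x. (0, x)" borel] show ?thesis
    by simp
qed

lemma forward_borel:
  assumes "\<forall>(t, E)\<in>set ps. E \<in> sets borel"
  shows "forward ps s \<in> borel_measurable borel"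
  using assms
proof (induction ps arbitrary: s)
  case Nil
  have "forward [] s = U s" by auto
  then show ?case by simp
next
  case (Cons q ps)
  obtain t E where q: "q = (t, E)" by force
  have [measurable]: "E \<in> sets borel" "forward ps t \<in> borel_measurable borel"
    using Cons q by auto
  show ?case
    unfolding q forward.simps by measurable
qed

text \<open>A tail of observations acts on what precedes it as a final weight.\<close>

lemma backward_append:
  "backward F (ps @ qs) s x = backward (backward F qs) ps s x"
  by (induction ps arbitrary: s x) auto

text \<open>Cut at one observed time, the integrand factors into a weight of the past and a weight
  of the future; both Markov properties rest on this. Induction on the past from its last
  observation: the cut is moved from there to the next time by exchanging the two integrals.\<close>

lemma fdd_split:
  assumes "\<forall>(t, E)\<in>set (ps @ (t, E) # qs). E \<in> sets borel"
  shows "fdd (ps @ (t, E) # qs) = (\<integral>\<^sup>+ x\<in>E. (forward (rev ps) t x * backward V qs t x) \<partial>lborel)"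
  using assms
proof (induction ps arbitrary: t E qs rule: rev_induct)
  case (snoc p ps)
  obtain s C where p: "p = (s, C)" by force
  have [measurable]: "E \<in> sets borel" "C \<in> sets borel"
    using snoc.prems p by auto
  have [measurable]: "forward (rev ps) s \<in> borel_measurable borel"
    by (rule forward_borel) (use snoc.prems in auto)
  have [measurable]: "backward V qs t \<in> borel_measurable borel"
    by (rule backward_borel) (use snoc.prems in auto)
  let ?f = "\<lambda>y x. forward (rev ps) s y * G t s x y * backward V qs t x * indicator E x * indicator C y"
  have "fdd ((ps @ [p]) @ (t, E) # qs)
      = (\<integral>\<^sup>+ y\<in>C. (forward (rev ps) s y * backward V ((t, E) # qs) s y) \<partial>lborel)"
    using snoc.IH[of s C "(t, E) # qs"] snoc.prems p by auto
  also have "\<dots> = (\<integral>\<^sup>+ y. (\<integral>\<^sup>+ x. ?f y x \<partial>lborel) \<partial>lborel)"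
    by (auto intro!: nn_integral_cong simp: nn_integral_cmult nn_integral_multc mult.assoc split: split_indicator)
  also have "\<dots> = (\<integral>\<^sup>+ x. (\<integral>\<^sup>+ y. ?f y x \<partial>lborel) \<partial>lborel)"
    by (rule lborel_pair.Fubini') measurable
  also have "\<dots> = (\<integral>\<^sup>+ x. (\<integral>\<^sup>+ y. backward V qs t x * indicator E x * (G t s x y * forward (rev ps) s y * indicator C y) \<partial>lborel) \<partial>lborel)"
    by (simp add: ac_simps)
  also have "\<dots> = (\<integral>\<^sup>+ x\<in>E. (forward (rev (ps @ [p])) t x * backward V qs t x) \<partial>lborel)"
    using p by (subst nn_integral_cmult) (auto intro!: nn_integral_cong simp: ac_simps)
  finally show ?case .
qed simp

text \<open>Cutting at \<open>t\<close> leaves a past consisting of the time 0 alone; its weight is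
  the evolution of \<open>U 0\<close>, that is, \<open>U t\<close>. The indicator of
  \<open>S\<close> is absorbed because \<open>U 0\<close> vanishes off \<open>S\<close>.\<close>

lemma fdd_drop_initial:
  assumes "\<forall>(t, E)\<in>set ((t, E) # ps). E \<in> sets borel" "0 < t" "t \<le> T"
  shows "fdd ((0, S) # (t, E) # ps) = fdd ((t, E) # ps)"
proof -
  have "(\<integral>\<^sup>+ y. G t 0 x y * U 0 y * indicator S y \<partial>lborel) = U t x" for x
    using U_outside[of _ 0] assms
    by (subst U_evolution[of 0, symmetric]) (auto intro!: nn_integral_cong split: split_indicator)
  then show ?thesis
    using fdd_split[of "[(0, S)]" t E ps] assms by simp
qed

text \<open>The innermost integral is the evolution of \<open>V\<close> from T back to the last time
  before it; that \<open>V T\<close> vanishes off \<open>S\<close> absorbs the indicator.\<close>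

lemma backward_drop_final:
  assumes "\<forall>(t, E)\<in>set ps. 0 \<le> t \<and> t < T" "0 \<le> s" "s < T"
  shows "backward V (ps @ [(T, S)]) s x = backward V ps s x"
  using assms
proof (induction ps arbitrary: s x)
  case Nil
  then show ?case
    using V_outside[of _ T]
    by (auto intro!: nn_integral_cong split: split_indicator simp: V_evolution[of s T, symmetric])
next
  case (Cons p ps)
  obtain t E where p: "p = (t, E)" by force
  then show ?case using Cons by simp
qed

lemma fdd_drop_final:
  assumes "\<forall>(t, E)\<in>set ps. 0 \<le> t \<and> t < T" "ps \<noteq> []"
  shows "fdd (ps @ [(T, S)]) = fdd ps"
proof -
  obtain t E qs where "ps = (t, E) # qs" using assms(2) by (cases ps) auto
  then show ?thesis using assms(1) by (simp add: backward_drop_final)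
qed

text \<open>Turns the pinned end of a bridge into an ordinary observation at T: the integral over
  the end point is moved inwards past every observation until it meets the pinned kernel, where it
  is one more backward step.\<close>

lemma backward_terminal_integral:
  assumes "\<forall>(t, E)\<in>set ps. E \<in> sets borel" and [measurable]: "E \<in> sets borel"
  shows "(\<integral>\<^sup>+ y\<in>E. (V T y * backward (\<lambda>r. G T r y) ps s x) \<partial>lborel)
    = backward V (ps @ [(T, E)]) s x"
  using assms(1)
proof (induction ps arbitrary: s x)
  case Nil
  then show ?case by (simp add: ac_simps)
next
  case (Cons q ps)
  obtain t C where q: "q = (t, C)" by force
  have [measurable]: "C \<in> sets borel" using Cons.prems q by auto
  \<comment> \<open>Joint measurability in the end point and the current point, for the exchange of
    integrals below.\<close>
  have "(\<lambda>(y, x). backward (\<lambda>r. G T r y) ps t x) \<in> borel_measurable (borel \<Otimes>\<^sub>M borel)"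
    using Cons.prems by (intro backward_param_borel G_borel) auto
  then have [measurable]:
    "(\<lambda>(y, x). backward (\<lambda>r. G T r y) ps t x) \<in> borel_measurable (lborel \<Otimes>\<^sub>M lborel)"
    by (simp cong: measurable_cong_sets)
  let ?f = "\<lambda>y w. G t s w x * indicator C w * (V T y * backward (\<lambda>r. G T r y) ps t w * indicator E y)"
  have "(\<integral>\<^sup>+ y\<in>E. (V T y * backward (\<lambda>r. G T r y) (q # ps) s x) \<partial>lborel)
      = (\<integral>\<^sup>+ y. (\<integral>\<^sup>+ w. V T y * indicator E y * (G t s w x * backward (\<lambda>r. G T r y) ps t w * indicator C w) \<partial>lborel) \<partial>lborel)"
    unfolding q by (subst nn_integral_cmult) (auto intro!: nn_integral_cong simp: ac_simps)
  also have "\<dots> = (\<integral>\<^sup>+ y. (\<integral>\<^sup>+ w. ?f y w \<partial>lborel) \<partial>lborel)"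
    by (simp add: ac_simps)
  also have "\<dots> = (\<integral>\<^sup>+ w. (\<integral>\<^sup>+ y. ?f y w \<partial>lborel) \<partial>lborel)"
    by (rule lborel_pair.Fubini') measurable
  also have "\<dots> = (\<integral>\<^sup>+ w. G t s w x * indicator C w * (\<integral>\<^sup>+ y\<in>E. (V T y * backward (\<lambda>r. G T r y) ps t w) \<partial>lborel) \<partial>lborel)"
    by (subst nn_integral_cmult) auto
  also have "\<dots> = backward V ((q # ps) @ [(T, E)]) s x"
    using Cons q by (auto intro!: nn_integral_cong simp: ac_simps)
  finally show ?case .
qed

section \<open>Iterated kernels as integrals over finite products of Lebesgue measure\<close>

lemma backward_integrand_borel:
  fixes n :: nat
  assumes F: "\<And>r. F r \<in> borel_measurable borel" and E: "\<And>i. i \<in> {1..n} \<Longrightarrow> E i \<in> sets borel"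
  shows "(\<lambda>z. (\<Prod>i=1..n. G (t i) (t (i - 1)) ((z(0 := x)) i) ((z(0 := x)) (i - 1)))
      * F (t n) ((z(0 := x)) n) * indicator (PiE {1..n} E) z) \<in> borel_measurable (Pi\<^sub>M {1..n} (\<lambda>_. lborel))"
proof -
  have [measurable]: "F r \<in> borel_measurable borel" for r by (rule F)
  have comp: "(\<lambda>z. (z(0 := x)) i) \<in> borel_measurable (Pi\<^sub>M {1..n} (\<lambda>_. lborel))" if "i \<le> n" for i
    using that by (intro upd_component_borel) auto
  show ?thesis
    using sets_PiE_atLeastAtMost[OF E]
    by (intro borel_measurable_times_ennreal borel_measurable_prod_ennreal G_measurable
        borel_measurable_indicator comp measurable_compose[OF comp]) auto
qed

lemma forward_integrand_borel:
  fixes n :: nat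
  assumes E: "\<And>i. i \<in> {1..n} \<Longrightarrow> E i \<in> sets borel"
  shows "(\<lambda>z. U (t 1) ((z(Suc n := y)) 1)
      * (\<Prod>i=1..n. G (t (Suc i)) (t i) ((z(Suc n := y)) (Suc i)) ((z(Suc n := y)) i))
      * indicator (PiE {1..n} E) z) \<in> borel_measurable (Pi\<^sub>M {1..n} (\<lambda>_. lborel))"
proof -
  have comp: "(\<lambda>z. (z(Suc n := y)) i) \<in> borel_measurable (Pi\<^sub>M {1..n} (\<lambda>_. lborel))" if "i \<in> {1..Suc n}" for i
    using that by (intro upd_component_borel) auto
  show ?thesis
    using sets_PiE_atLeastAtMost[OF E]
    by (intro borel_measurable_times_ennreal borel_measurable_prod_ennreal G_measurable
        borel_measurable_indicator comp measurable_compose[OF comp]) auto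
qed

text \<open>The last coordinate is peeled off and its integral is absorbed into the final weight, so
  the induction has to leave \<open>F\<close> arbitrary. The start point sits at index 0, outside
  the integrated coordinates, and is put in by the update.\<close>

lemma backward_PiM:
  assumes "\<And>r. F r \<in> borel_measurable borel" "\<And>i. i \<in> {1..n} \<Longrightarrow> E i \<in> sets borel"
  shows "(\<integral>\<^sup>+ z\<in>PiE {1..n} E. ((\<Prod>i=1..n. G (t i) (t (i - 1)) ((z(0 := x)) i) ((z(0 := x)) (i - 1)))
      * F (t n) ((z(0 := x)) n)) \<partial>(Pi\<^sub>M {1..n} (\<lambda>_. lborel)))
    = backward F (map (\<lambda>i. (t i, E i)) [1..<Suc n]) (t 0) x"
  using assms
proof (induction n arbitrary: F)
  case 0
  then show ?case
    by (simp add: PiM_empty nn_integral_count_space_finite)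
next
  case (Suc n)
  interpret product_sigma_finite "\<lambda>_::nat. lborel :: 'a measure" ..
  have [measurable]: "F r \<in> borel_measurable borel" for r by (rule Suc.prems)
  have E [measurable]: "E i \<in> sets borel" if "i \<in> {1..Suc n}" for i using Suc.prems that by auto
  have ins: "{1..Suc n} = insert (Suc n) {1..n}" by auto
  \<comment> \<open>One backward step as a function of time and point; it equals
    \<open>backward\<close> on a one-element list, so \<open>backward_append\<close> reassembles the
    list at the end.\<close>
  define F' where "F' r w = (\<integral>\<^sup>+ y\<in>E (Suc n). (G (t (Suc n)) r y w * F (t (Suc n)) y) \<partial>lborel)" for r w
  have [measurable]: "F' r \<in> borel_measurable borel" for r
    unfolding F'_def using E[of "Suc n"] by measurable
  let ?P = "\<lambda>z. (\<Prod>i=1..n. G (t i) (t (i - 1)) ((z(0 := x)) i) ((z(0 := x)) (i - 1)))"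
  have "(\<integral>\<^sup>+ z\<in>PiE {1..Suc n} E. ((\<Prod>i=1..Suc n. G (t i) (t (i - 1)) ((z(0 := x)) i) ((z(0 := x)) (i - 1)))
      * F (t (Suc n)) ((z(0 := x)) (Suc n))) \<partial>(Pi\<^sub>M {1..Suc n} (\<lambda>_. lborel)))
    = (\<integral>\<^sup>+ z. (\<integral>\<^sup>+ y. (?P z * indicator (PiE {1..n} E) z) * (G (t (Suc n)) (t n) y ((z(0 := x)) n)
          * F (t (Suc n)) y * indicator (E (Suc n)) y) \<partial>lborel) \<partial>(Pi\<^sub>M {1..n} (\<lambda>_. lborel)))"
    (is "?L = ?R")
  proof -
    let ?f = "\<lambda>n z. (\<Prod>i=1..n. G (t i) (t (i - 1)) ((z(0 := x)) i) ((z(0 := x)) (i - 1)))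
      * F (t n) ((z(0 := x)) n) * indicator (PiE {1..n} E) z"
    have "?f (Suc n) \<in> borel_measurable (Pi\<^sub>M {1..Suc n} (\<lambda>_. lborel))"
      by (rule backward_integrand_borel) (use Suc.prems in auto)
    then have "?L = (\<integral>\<^sup>+ z. (\<integral>\<^sup>+ y. ?f (Suc n) (z(Suc n := y)) \<partial>lborel) \<partial>(Pi\<^sub>M {1..n} (\<lambda>_. lborel)))"
      unfolding ins by (intro product_nn_integral_insert) auto
    also have "\<dots> = ?R"
    proof (intro nn_integral_cong)
      fix z y assume "z \<in> space (Pi\<^sub>M {1..n} (\<lambda>_. lborel :: 'a measure))"
      then have z: "z \<in> extensional {1..n}" by (simp add: space_PiM PiE_def)
      have "(\<Prod>i=1..n. G (t i) (t (i - 1)) (((z(Suc n := y))(0 := x)) i) (((z(Suc n := y))(0 := x)) (i - 1))) = ?P z"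
        by (intro prod.cong) auto
      then show "?f (Suc n) (z(Suc n := y)) = (?P z * indicator (PiE {1..n} E) z)
          * (G (t (Suc n)) (t n) y ((z(0 := x)) n) * F (t (Suc n)) y * indicator (E (Suc n)) y)"
        unfolding indicator_PiE_insert[OF z]
        by (simp add: ac_simps del: One_nat_def)
    qed
    finally show ?thesis .
  qed
  also have "\<dots> = (\<integral>\<^sup>+ z\<in>PiE {1..n} E. (?P z * F' (t n) ((z(0 := x)) n)) \<partial>(Pi\<^sub>M {1..n} (\<lambda>_. lborel)))"
    unfolding F'_def using E[of "Suc n"] upd_component_borel[of n 0 n x]
    by (subst nn_integral_cmult) (auto intro!: nn_integral_cong simp: ac_simps)
  also have "\<dots> = backward F' (map (\<lambda>i. (t i, E i)) [1..<Suc n]) (t 0) x"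
    using Suc.prems by (intro Suc.IH) auto
  also have "F' = backward F [(t (Suc n), E (Suc n))]"
    by (auto simp: F'_def fun_eq_iff)
  also have "backward (backward F [(t (Suc n), E (Suc n))]) (map (\<lambda>i. (t i, E i)) [1..<Suc n]) (t 0) x
      = backward F (map (\<lambda>i. (t i, E i)) [1..<Suc (Suc n)]) (t 0) x"
    unfolding backward_append[symmetric] by simp
  finally show ?case .
qed

text \<open>Here the end point is fixed at index \<open>Suc n\<close>. Peeling off the last
  coordinate \<open>w\<close> makes \<open>w\<close> the end point of a shorter path, which is why
  \<open>y\<close> is arbitrary in the induction. For \<open>n = 0\<close> index 1 is the end point
  itself and \<open>U (t 1) y\<close> remains.\<close>

lemma forward_PiM:
  assumes "\<And>i. i \<in> {1..n} \<Longrightarrow> E i \<in> sets borel"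
  shows "(\<integral>\<^sup>+ z\<in>PiE {1..n} E. (U (t 1) ((z(Suc n := y)) 1)
      * (\<Prod>i=1..n. G (t (Suc i)) (t i) ((z(Suc n := y)) (Suc i)) ((z(Suc n := y)) i))) \<partial>(Pi\<^sub>M {1..n} (\<lambda>_. lborel)))
    = forward (rev (map (\<lambda>i. (t i, E i)) [1..<Suc n])) (t (Suc n)) y"
  using assms
proof (induction n arbitrary: y)
  case 0
  then show ?case
    by (simp add: PiM_empty nn_integral_count_space_finite)
next
  case (Suc n)
  interpret product_sigma_finite "\<lambda>_::nat. lborel :: 'a measure" ..
  have E [measurable]: "E i \<in> sets borel" if "i \<in> {1..Suc n}" for i using Suc.prems that by auto
  have ins: "{1..Suc n} = insert (Suc n) {1..n}" by auto
  let ?Q = "\<lambda>n z. U (t 1) (z 1) * (\<Prod>i=1..n. G (t (Suc i)) (t i) (z (Suc i)) (z i))"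
  have meas: "(\<lambda>z. ?Q m (z(Suc m := x)) * indicator (PiE {1..m} E) z) \<in> borel_measurable (Pi\<^sub>M {1..m} (\<lambda>_. lborel))"
    if "m \<le> Suc n" for m and x :: 'a
    using that E by (intro forward_integrand_borel) auto
  have Q: "?Q (Suc n) (z(Suc (Suc n) := y)) = ?Q n z * G (t (Suc (Suc n))) (t (Suc n)) y (z (Suc n))" for z
  proof -
    have "(\<Prod>i=1..n. G (t (Suc i)) (t i) ((z(Suc (Suc n) := y)) (Suc i)) ((z(Suc (Suc n) := y)) i))
        = (\<Prod>i=1..n. G (t (Suc i)) (t i) (z (Suc i)) (z i))"
      by (intro prod.cong) auto
    then show ?thesis by (simp add: mult.assoc)
  qed
  have "(\<integral>\<^sup>+ z\<in>PiE {1..Suc n} E. ?Q (Suc n) (z(Suc (Suc n) := y)) \<partial>(Pi\<^sub>M {1..Suc n} (\<lambda>_. lborel)))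
    = (\<integral>\<^sup>+ w. (\<integral>\<^sup>+ z. G (t (Suc (Suc n))) (t (Suc n)) y w * indicator (E (Suc n)) w
        * (?Q n (z(Suc n := w)) * indicator (PiE {1..n} E) z) \<partial>(Pi\<^sub>M {1..n} (\<lambda>_. lborel))) \<partial>lborel)"
    (is "?L = ?R")
  proof -
    let ?f = "\<lambda>z. ?Q (Suc n) (z(Suc (Suc n) := y)) * indicator (PiE {1..Suc n} E) z"
    have "?f \<in> borel_measurable (Pi\<^sub>M {1..Suc n} (\<lambda>_. lborel))"
      by (rule meas) simp
    \<comment> \<open>The new coordinate is kept outermost: the inner integral then has the form of
      the induction hypothesis with end point \<open>w\<close>.\<close>
    then have "?L = (\<integral>\<^sup>+ w. (\<integral>\<^sup>+ z. ?f (z(Suc n := w)) \<partial>(Pi\<^sub>M {1..n} (\<lambda>_. lborel))) \<partial>lborel)"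
      unfolding ins by (intro product_nn_integral_insert_rev) auto
    also have "\<dots> = ?R"
    proof (intro nn_integral_cong)
      fix z w assume "z \<in> space (Pi\<^sub>M {1..n} (\<lambda>_. lborel :: 'a measure))"
      then have z: "z \<in> extensional {1..n}" by (simp add: space_PiM PiE_def)
      show "?f (z(Suc n := w)) = G (t (Suc (Suc n))) (t (Suc n)) y w * indicator (E (Suc n)) w
          * (?Q n (z(Suc n := w)) * indicator (PiE {1..n} E) z)"
        unfolding Q indicator_PiE_insert[OF z] by (simp add: ac_simps del: One_nat_def)
    qed
    finally show ?thesis .
  qed
  also have "\<dots> = (\<integral>\<^sup>+ w\<in>E (Suc n). (G (t (Suc (Suc n))) (t (Suc n)) y w
      * (\<integral>\<^sup>+ z\<in>PiE {1..n} E. ?Q n (z(Suc n := w)) \<partial>(Pi\<^sub>M {1..n} (\<lambda>_. lborel)))) \<partial>lborel)"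
    using meas[of n] by (subst nn_integral_cmult) (auto intro!: nn_integral_cong simp: ac_simps)
  also have "\<dots> = forward (rev (map (\<lambda>i. (t i, E i)) [1..<Suc (Suc n)])) (t (Suc (Suc n))) y"
    using Suc by simp
  finally show ?case .
qed

end

section \<open>Finite-dimensional distributions\<close>

text \<open>The formula is required for cylinders that observe both 0 and T, the form in which a
  bridge description yields it. All other cylinders are recovered by observing \<open>S\<close> at
  the missing end times.\<close>

locale bernstein_marginals = green_kernel S T G U V + prob_space M
  for S :: "'a::euclidean_space set" and T G U V and M :: "'w measure" +
  fixes Z :: "real \<Rightarrow> 'w \<Rightarrow> 'a"
  assumes Z_measurable: "t \<in> {0..T} \<Longrightarrow> Z t \<in> measurable M (restrict_space borel S)"
    and emeasure_bridge:
      "sorted_wrt (<) (map fst ((0, E0) # ps @ [(T, E1)])) \<Longrightarrow>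
       \<forall>(t, E)\<in>set ((0, E0) # ps @ [(T, E1)]). E \<in> sets (restrict_space borel S) \<Longrightarrow>
       emeasure M {\<omega>\<in>space M. \<forall>(t, E)\<in>set ((0, E0) # ps @ [(T, E1)]). Z t \<omega> \<in> E}
       = fdd ((0, E0) # ps @ [(T, E1)])"
begin

lemma Z_in: "t \<in> {0..T} \<Longrightarrow> \<omega> \<in> space M \<Longrightarrow> Z t \<omega> \<in> S"
  using measurable_space[OF Z_measurable] by (auto simp: space_restrict_space)

lemma S_in: "S \<in> sets (restrict_space borel S)"
  by (auto simp: sets_restrict_space_iff S_borel)

lemma emeasure_cylinder_initial:
  assumes "sorted_wrt (<) (map fst ((0, E) # ps))"
    and "\<forall>(t, E)\<in>set ((0, E) # ps). t \<le> T \<and> E \<in> sets (restrict_space borel S)"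
  shows "emeasure M {\<omega>\<in>space M. \<forall>(t, E)\<in>set ((0, E) # ps). Z t \<omega> \<in> E} = fdd ((0, E) # ps)"
proof (cases "\<exists>(t, C)\<in>set ps. t = T")
  case True
  then obtain C qs rs where qs: "ps = qs @ (T, C) # rs"
    by (auto simp: in_set_conv_decomp)
  \<comment> \<open>Times increase strictly and do not exceed T, so nothing follows an observation
    at T.\<close>
  have "rs = []"
  proof (rule ccontr)
    assume "rs \<noteq> []"
    then obtain t B where "(t, B) \<in> set rs" by (cases rs) auto
    then have "T < t" "t \<le> T"
      using assms qs by (auto simp: sorted_wrt_append)
    then show False by simp
  qed
  show ?thesis
    using assms unfolding qs \<open>rs = []\<close> by (intro emeasure_bridge) auto
next
  case False
  have le: "\<forall>(t, C)\<in>set ((0, E) # ps). t \<le> T" and "\<forall>t\<in>fst ` set ps. 0 < t"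
    using assms T_pos by auto
  with False T_pos have range: "\<forall>(t, C)\<in>set ((0, E) # ps). 0 \<le> t \<and> t < T"
    by force
  \<comment> \<open>T is not observed: adding the sure event \<open>Z T\<close> in \<open>S\<close>
    changes neither the cylinder nor, by the evolution of \<open>V\<close>, the value of the
    formula.\<close>
  have "{\<omega>\<in>space M. \<forall>(t, E)\<in>set ((0, E) # ps). Z t \<omega> \<in> E}
      = {\<omega>\<in>space M. \<forall>(t, E)\<in>set ((0, E) # ps @ [(T, S)]). Z t \<omega> \<in> E}"
    using Z_in[of T] T_pos by (intro Collect_cong) auto
  also have "emeasure M \<dots> = fdd ((0, E) # ps @ [(T, S)])"
  proof (intro emeasure_bridge)
    show "sorted_wrt (<) (map fst ((0, E) # ps @ [(T, S)]))"
      using assms(1) range by (auto simp: sorted_wrt_append)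
    show "\<forall>(t, E)\<in>set ((0, E) # ps @ [(T, S)]). E \<in> sets (restrict_space borel S)"
      using assms(2) S_in by auto
  qed
  also have "\<dots> = fdd ((0, E) # ps)"
    using fdd_drop_final[OF range] by simp
  finally show ?thesis .
qed

text \<open>The same device at the other end: the sure event that \<open>Z 0\<close> lies in
  \<open>S\<close> is added if the list starts later than 0.\<close>

lemma emeasure_cylinder:
  assumes "ps \<noteq> []" "sorted_wrt (<) (map fst ps)"
    and "\<forall>(t, E)\<in>set ps. 0 \<le> t \<and> t \<le> T \<and> E \<in> sets (restrict_space borel S)"
  shows "emeasure M {\<omega>\<in>space M. \<forall>(t, E)\<in>set ps. Z t \<omega> \<in> E} = fdd ps"
proof -
  obtain t E qs where ps: "ps = (t, E) # qs" using assms(1) by (cases ps) auto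
  show ?thesis
  proof (cases "t = 0")
    case True
    show ?thesis
      using assms(2,3) unfolding ps True by (intro emeasure_cylinder_initial) auto
  next
    case False
    have "{\<omega>\<in>space M. \<forall>(t, E)\<in>set ps. Z t \<omega> \<in> E}
        = {\<omega>\<in>space M. \<forall>(t, E)\<in>set ((0, S) # ps). Z t \<omega> \<in> E}"
      using Z_in[of 0] T_pos by (intro Collect_cong) auto
    also have "emeasure M \<dots> = fdd ((0, S) # ps)"
    proof (rule emeasure_cylinder_initial)
      have "0 < t" using assms(3) False ps by auto
      then show "sorted_wrt (<) (map fst ((0, S) # ps))"
        using assms(2) unfolding ps by auto
      show "\<forall>(t, E)\<in>set ((0, S) # ps). t \<le> T \<and> E \<in> sets (restrict_space borel S)"
        using assms(3) S_in T_pos by auto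
    qed
    also have "\<dots> = fdd ps"
      unfolding ps
    proof (rule fdd_drop_initial)
      show "\<forall>(t, E)\<in>set ((t, E) # qs). E \<in> sets borel"
        using assms(3) ps by (auto simp: sets_restrict_space_iff S_borel)
      show "0 < t" "t \<le> T"
        using assms(3) False ps by auto
    qed
    finally show ?thesis .
  qed
qed

lemma emeasure_marginal:
  assumes "t \<in> {0..T}" "E \<in> sets (restrict_space borel S)"
  shows "emeasure M {\<omega>\<in>space M. Z t \<omega> \<in> E} = (\<integral>\<^sup>+ x\<in>E. (U t x * V t x) \<partial>lborel)"
  using emeasure_cylinder[of "[(t, E)]"] assms by simp

text \<open>The point is the order of quantifiers: \<open>\<rho>\<close>, the forward weight of the
  past, does not depend on \<open>C\<close> and \<open>B\<close>, and \<open>B\<close> enters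
  through a kernel that does not depend on the past. This is the Markov property on cylinders. A
  finite set of times is used, as the cylinders of an infinite product require; sorting turns it
  into a list.\<close>

lemma emeasure_past_present_next:
  assumes J: "finite J" "J \<subseteq> {0..<s}" and s: "0 \<le> s" "s < t" "t \<le> T"
    and E: "\<And>\<tau>. \<tau> \<in> J \<Longrightarrow> E \<tau> \<in> sets (restrict_space borel S)"
  shows "\<exists>\<rho>\<in>borel_measurable borel. \<forall>C\<in>sets (restrict_space borel S). \<forall>B\<in>sets (restrict_space borel S).
    emeasure M {\<omega>\<in>space M. (\<forall>\<tau>\<in>J. Z \<tau> \<omega> \<in> E \<tau>) \<and> Z s \<omega> \<in> C \<and> Z t \<omega> \<in> B}
    = (\<integral>\<^sup>+ x\<in>C. (\<rho> x * (\<integral>\<^sup>+ y\<in>B. (G t s y x * V t y) \<partial>lborel)) \<partial>lborel)"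
proof
  define ps where "ps = map (\<lambda>\<tau>. (\<tau>, E \<tau>)) (sorted_list_of_set J)"
  have ps: "set ps = (\<lambda>\<tau>. (\<tau>, E \<tau>)) ` J"
    using J by (simp add: ps_def)
  have sorted: "sorted_wrt (<) (map fst ps)"
    using strict_sorted_list_of_set[of J] by (simp add: ps_def comp_def)
  have E': "E \<tau> \<in> sets borel" if "\<tau> \<in> J" for \<tau>
    using E[OF that] by (auto simp: sets_restrict_space_iff S_borel)
  then show "forward (rev ps) s \<in> borel_measurable borel"
    by (intro forward_borel) (auto simp: ps)
  show "\<forall>C\<in>sets (restrict_space borel S). \<forall>B\<in>sets (restrict_space borel S).
    emeasure M {\<omega>\<in>space M. (\<forall>\<tau>\<in>J. Z \<tau> \<omega> \<in> E \<tau>) \<and> Z s \<omega> \<in> C \<and> Z t \<omega> \<in> B}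
    = (\<integral>\<^sup>+ x\<in>C. (forward (rev ps) s x * (\<integral>\<^sup>+ y\<in>B. (G t s y x * V t y) \<partial>lborel)) \<partial>lborel)"
  proof (intro ballI)
    fix C B assume CB: "C \<in> sets (restrict_space borel S)" "B \<in> sets (restrict_space borel S)"
    have "{\<omega>\<in>space M. (\<forall>\<tau>\<in>J. Z \<tau> \<omega> \<in> E \<tau>) \<and> Z s \<omega> \<in> C \<and> Z t \<omega> \<in> B}
        = {\<omega>\<in>space M. \<forall>(t, E)\<in>set (ps @ (s, C) # [(t, B)]). Z t \<omega> \<in> E}"
      by (auto simp: ps)
    also have "emeasure M \<dots> = fdd (ps @ (s, C) # [(t, B)])"
    proof (rule emeasure_cylinder)
      have "\<forall>\<tau>\<in>J. \<tau> < s \<and> \<tau> < t" using J s by auto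
      then show "sorted_wrt (<) (map fst (ps @ (s, C) # [(t, B)]))"
        using sorted s by (auto simp: sorted_wrt_append ps)
      have "\<forall>\<tau>\<in>J. 0 \<le> \<tau> \<and> \<tau> \<le> T" using J s by auto
      then show "\<forall>(t, E)\<in>set (ps @ (s, C) # [(t, B)]). 0 \<le> t \<and> t \<le> T \<and> E \<in> sets (restrict_space borel S)"
        using E CB s by (auto simp: ps)
    qed simp
    also have "\<dots> = (\<integral>\<^sup>+ x\<in>C. (forward (rev ps) s x * backward V [(t, B)] s x) \<partial>lborel)"
      using CB E' by (intro fdd_split) (auto simp: ps sets_restrict_space_iff S_borel)
    finally show "emeasure M {\<omega>\<in>space M. (\<forall>\<tau>\<in>J. Z \<tau> \<omega> \<in> E \<tau>) \<and> Z s \<omega> \<in> C \<and> Z t \<omega> \<in> B}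
      = (\<integral>\<^sup>+ x\<in>C. (forward (rev ps) s x * (\<integral>\<^sup>+ y\<in>B. (G t s y x * V t y) \<partial>lborel)) \<partial>lborel)"
      by simp
  qed
qed

text \<open>The time-reversed form: \<open>\<rho>\<close> is now the backward weight of the
  observations after \<open>t\<close>, and the remaining kernel carries \<open>U s\<close>.\<close>

lemma emeasure_future_present_previous:
  assumes J: "finite J" "J \<subseteq> {t<..T}" and s: "0 \<le> s" "s < t" "t \<le> T"
    and E: "\<And>\<tau>. \<tau> \<in> J \<Longrightarrow> E \<tau> \<in> sets (restrict_space borel S)"
  shows "\<exists>\<rho>\<in>borel_measurable borel. \<forall>C\<in>sets (restrict_space borel S). \<forall>B\<in>sets (restrict_space borel S).
    emeasure M {\<omega>\<in>space M. (\<forall>\<tau>\<in>J. Z \<tau> \<omega> \<in> E \<tau>) \<and> Z t \<omega> \<in> C \<and> Z s \<omega> \<in> B}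
    = (\<integral>\<^sup>+ x\<in>C. (\<rho> x * (\<integral>\<^sup>+ y\<in>B. (G t s x y * U s y) \<partial>lborel)) \<partial>lborel)"
proof
  define ps where "ps = map (\<lambda>\<tau>. (\<tau>, E \<tau>)) (sorted_list_of_set J)"
  have ps: "set ps = (\<lambda>\<tau>. (\<tau>, E \<tau>)) ` J"
    using J by (simp add: ps_def)
  have sorted: "sorted_wrt (<) (map fst ps)"
    using strict_sorted_list_of_set[of J] by (simp add: ps_def comp_def)
  have E': "E \<tau> \<in> sets borel" if "\<tau> \<in> J" for \<tau>
    using E[OF that] by (auto simp: sets_restrict_space_iff S_borel)
  then show "backward V ps t \<in> borel_measurable borel"
    by (intro backward_borel) (auto simp: ps)
  show "\<forall>C\<in>sets (restrict_space borel S). \<forall>B\<in>sets (restrict_space borel S).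
    emeasure M {\<omega>\<in>space M. (\<forall>\<tau>\<in>J. Z \<tau> \<omega> \<in> E \<tau>) \<and> Z t \<omega> \<in> C \<and> Z s \<omega> \<in> B}
    = (\<integral>\<^sup>+ x\<in>C. (backward V ps t x * (\<integral>\<^sup>+ y\<in>B. (G t s x y * U s y) \<partial>lborel)) \<partial>lborel)"
  proof (intro ballI)
    fix C B assume CB: "C \<in> sets (restrict_space borel S)" "B \<in> sets (restrict_space borel S)"
    have "{\<omega>\<in>space M. (\<forall>\<tau>\<in>J. Z \<tau> \<omega> \<in> E \<tau>) \<and> Z t \<omega> \<in> C \<and> Z s \<omega> \<in> B}
        = {\<omega>\<in>space M. \<forall>(t, E)\<in>set ([(s, B)] @ (t, C) # ps). Z t \<omega> \<in> E}"
      by (auto simp: ps)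
    also have "emeasure M \<dots> = fdd ([(s, B)] @ (t, C) # ps)"
    proof (rule emeasure_cylinder)
      have "\<forall>\<tau>\<in>J. s < \<tau> \<and> t < \<tau>" using J s by auto
      then show "sorted_wrt (<) (map fst ([(s, B)] @ (t, C) # ps))"
        using sorted s by (auto simp: ps)
      have "\<forall>\<tau>\<in>J. 0 \<le> \<tau> \<and> \<tau> \<le> T" using J s by auto
      then show "\<forall>(t, E)\<in>set ([(s, B)] @ (t, C) # ps). 0 \<le> t \<and> t \<le> T \<and> E \<in> sets (restrict_space borel S)"
        using E CB s by (auto simp: ps)
    qed simp
    also have "\<dots> = (\<integral>\<^sup>+ x\<in>C. (forward (rev [(s, B)]) t x * backward V ps t x) \<partial>lborel)"
      using CB E' by (intro fdd_split) (auto simp: ps sets_restrict_space_iff S_borel)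
    finally show "emeasure M {\<omega>\<in>space M. (\<forall>\<tau>\<in>J. Z \<tau> \<omega> \<in> E \<tau>) \<and> Z t \<omega> \<in> C \<and> Z s \<omega> \<in> B}
      = (\<integral>\<^sup>+ x\<in>C. (backward V ps t x * (\<integral>\<^sup>+ y\<in>B. (G t s x y * U s y) \<partial>lborel)) \<partial>lborel)"
      by (simp add: ac_simps)
  qed
qed

end

section \<open>Conditional expectations from cylinder identities\<close>

lemma borel_closure_sets:
  "A \<in> sets (borel_closure D) \<longleftrightarrow> A \<in> sets borel \<and> A \<subseteq> closure D"
  by (auto simp: sets_restrict_space_iff)

text \<open>The preimages of product-measurable sets under the restricted path map form a
  sigma-algebra containing all generators. Identities on the generated sigma-algebra thus become
  equalities of image measures on a possibly uncountable product.\<close>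

lemma sets_gen_algebra_vimage:
  assumes Z: "\<And>\<tau>. \<tau> \<in> I \<Longrightarrow> Z \<tau> \<in> measurable M (borel_closure D)"
    and A: "A \<in> sets (gen_algebra M D Z I)"
  obtains A' where "A' \<in> sets (Pi\<^sub>M I (\<lambda>_. borel_closure D))"
    "A = (\<lambda>\<omega>. \<lambda>\<tau>\<in>I. Z \<tau> \<omega>) -` A' \<inter> space M"
proof -
  let ?X = "\<lambda>\<omega>. \<lambda>\<tau>\<in>I. Z \<tau> \<omega>" and ?P = "Pi\<^sub>M I (\<lambda>_. borel_closure D)"
  have X: "?X \<in> measurable M ?P"
    by (rule measurable_restrict) (rule Z)
  then have sets_eq: "sets (vimage_algebra (space M) ?X ?P) = {?X -` A' \<inter> space M | A'. A' \<in> sets ?P}"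
    by (intro sets_vimage_algebra2) (auto dest: measurable_space)
  have "sigma_sets (space M) {Z \<tau> -` A \<inter> space M | \<tau> A. \<tau> \<in> I \<and> A \<in> sets (borel_closure D)}
      \<subseteq> sets (vimage_algebra (space M) ?X ?P)"
  proof -
    have "Z \<tau> -` A \<inter> space M \<in> sets (vimage_algebra (space M) ?X ?P)"
      if "\<tau> \<in> I" "A \<in> sets (borel_closure D)" for \<tau> A
    proof -
      have "(\<lambda>w. w \<tau>) -` A \<inter> space ?P \<in> sets ?P"
        using that by (intro measurable_sets[OF measurable_component_singleton]) auto
      moreover have "Z \<tau> -` A \<inter> space M = ?X -` ((\<lambda>w. w \<tau>) -` A \<inter> space ?P) \<inter> space M"
        using that measurable_space[OF X] by auto
      ultimately show ?thesis unfolding sets_eq by blast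
    qed
    then show ?thesis
      by (intro sets.sigma_sets_subset[of _ "vimage_algebra (space M) ?X ?P", simplified]) auto
  qed
  moreover have "A \<in> sigma_sets (space M) {Z \<tau> -` A \<inter> space M | \<tau> A. \<tau> \<in> I \<and> A \<in> sets (borel_closure D)}"
    using A unfolding gen_algebra_def by (subst (asm) sets_measure_of) auto
  ultimately show thesis
    using that unfolding sets_eq by blast
qed

lemma space_gen_algebra [simp]: "space (gen_algebra M D Z I) = space M"
  unfolding gen_algebra_def by (rule space_measure_of) auto

lemma sets_gen_algebra:
  "sets (gen_algebra M D Z I)
    = sigma_sets (space M) {Z \<tau> -` A \<inter> space M | \<tau> A. \<tau> \<in> I \<and> A \<in> sets (borel_closure D)}"
  unfolding gen_algebra_def by (rule sets_measure_of) auto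

lemma sets_gen_algebra_mono:
  "I \<subseteq> J \<Longrightarrow> sets (gen_algebra M D Z I) \<subseteq> sets (gen_algebra M D Z J)"
  unfolding sets_gen_algebra by (intro sigma_sets_mono') blast

lemma subalgebra_gen_algebra:
  assumes "\<And>\<tau>. \<tau> \<in> I \<Longrightarrow> Z \<tau> \<in> measurable M (borel_closure D)"
  shows "subalgebra M (gen_algebra M D Z I)"
proof -
  have "sigma_sets (space M) {Z \<tau> -` A \<inter> space M | \<tau> A. \<tau> \<in> I \<and> A \<in> sets (borel_closure D)} \<subseteq> sets M"
    using assms by (intro sets.sigma_sets_subset) (auto intro: measurable_sets)
  then show ?thesis
    unfolding subalgebra_def sets_gen_algebra by simp
qed

lemma measurable_gen_algebra:
  assumes "\<tau> \<in> I" "Z \<tau> \<in> measurable M (borel_closure D)"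
  shows "Z \<tau> \<in> measurable (gen_algebra M D Z I) (borel_closure D)"
proof (rule measurableI)
  fix A assume "A \<in> sets (borel_closure D)"
  then show "Z \<tau> -` A \<inter> space (gen_algebra M D Z I) \<in> sets (gen_algebra M D Z I)"
    using assms unfolding sets_gen_algebra by auto
qed (use assms measurable_space[OF assms(2)] in auto)

lemma borel_measurable_borel_closure:
  "X \<in> measurable N (borel_closure D) \<Longrightarrow> X \<in> borel_measurable N"
  by (simp add: measurable_restrict_space2_iff)

text \<open>\<open>I\<close> is the set of conditioning times, \<open>s\<close> the one of them on
  which the prediction depends, and \<open>t\<close> the time predicted. No order between
  \<open>s\<close> and \<open>t\<close> is fixed, so both Markov properties are instances. In
  \<open>joint\<close> the weight \<open>\<rho>\<close> may depend on the cylinder over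
  \<open>J\<close>, but not on \<open>C\<close> and \<open>B\<close>.\<close>

locale transition_kernel = prob_space M
  for M :: "'w measure" +
  fixes D :: "(real^'n) set" and Z :: "real \<Rightarrow> 'w \<Rightarrow> real^'n" and I :: "real set" and s t :: real
    and q :: "real^'n \<Rightarrow> real^'n \<Rightarrow> real"
  assumes Z: "\<And>\<tau>. \<tau> \<in> insert t I \<Longrightarrow> Z \<tau> \<in> measurable M (borel_closure D)"
    and s: "s \<in> I"
    and q_borel: "(\<lambda>(x, y). q x y) \<in> borel_measurable (borel \<Otimes>\<^sub>M borel)"
    and q_nonneg: "\<And>x y. 0 \<le> q x y"
    and q_total: "\<And>x. x \<in> closure D \<Longrightarrow> (\<integral>\<^sup>+ y\<in>closure D. ennreal (q x y) \<partial>lborel) = 1"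
    and joint: "\<And>J E. finite J \<Longrightarrow> J \<subseteq> I - {s} \<Longrightarrow> (\<And>\<tau>. \<tau> \<in> J \<Longrightarrow> E \<tau> \<in> sets (borel_closure D)) \<Longrightarrow>
      \<exists>\<rho>\<in>borel_measurable borel. \<forall>C\<in>sets (borel_closure D). \<forall>B\<in>sets (borel_closure D).
        emeasure M {\<omega>\<in>space M. (\<forall>\<tau>\<in>J. Z \<tau> \<omega> \<in> E \<tau>) \<and> Z s \<omega> \<in> C \<and> Z t \<omega> \<in> B}
        = (\<integral>\<^sup>+ x\<in>C. (\<rho> x * (\<integral>\<^sup>+ y\<in>B. ennreal (q x y) \<partial>lborel)) \<partial>lborel)"
begin

lemma q_measurable [measurable (raw)]:
  assumes [measurable]: "f \<in> borel_measurable N" "h \<in> borel_measurable N"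
  shows "(\<lambda>\<omega>. q (f \<omega>) (h \<omega>)) \<in> borel_measurable N"
proof -
  have "(\<lambda>\<omega>. (f \<omega>, h \<omega>)) \<in> measurable N (borel \<Otimes>\<^sub>M borel)"
    by measurable
  from measurable_compose[OF this q_borel] show ?thesis by simp
qed

lemma Z_borel [measurable]: "Z t \<in> borel_measurable M" "Z s \<in> borel_measurable M"
  using Z[of t] Z[of s] s borel_measurable_borel_closure by auto

lemma Z_in: "\<tau> \<in> insert t I \<Longrightarrow> \<omega> \<in> space M \<Longrightarrow> Z \<tau> \<omega> \<in> closure D"
  using measurable_space[OF Z] by (auto simp: space_restrict_space)

definition kernel :: "(real^'n \<Rightarrow> ennreal) \<Rightarrow> real^'n \<Rightarrow> ennreal"
  where "kernel F x = (\<integral>\<^sup>+ y\<in>closure D. (ennreal (q x y) * F y) \<partial>lborel)"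

lemma kernel_borel [measurable]:
  assumes [measurable]: "F \<in> borel_measurable borel"
  shows "kernel F \<in> borel_measurable borel"
proof -
  have [measurable]: "closure D \<in> sets borel" by simp
  show ?thesis unfolding kernel_def[abs_def] by measurable
qed

text \<open>Restricted to the cylinder, the law of \<open>Z s\<close> has a density built from
  \<open>\<rho>\<close>, and the law of \<open>Z t\<close> has the density obtained by applying
  \<open>q\<close> to it. Both sides of the identity are then the same double integral, in the two
  orders.\<close>

lemma cylinder_integral:
  assumes J: "finite J" "J \<subseteq> I" and E: "\<And>\<tau>. \<tau> \<in> J \<Longrightarrow> E \<tau> \<in> sets (borel_closure D)"
    and F [measurable]: "F \<in> borel_measurable borel"
  defines "A \<equiv> {\<omega>\<in>space M. \<forall>\<tau>\<in>J. Z \<tau> \<omega> \<in> E \<tau>}"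
  shows "(\<integral>\<^sup>+ \<omega>\<in>A. F (Z t \<omega>) \<partial>M) = (\<integral>\<^sup>+ \<omega>\<in>A. kernel F (Z s \<omega>) \<partial>M)"
proof -
  have [measurable]: "closure D \<in> sets borel" by simp
  have A [measurable]: "A \<in> sets M"
  proof -
    have "{\<omega>\<in>space M. Z \<tau> \<omega> \<in> E \<tau>} \<in> sets M" if "\<tau> \<in> J" for \<tau>
    proof -
      have "Z \<tau> \<in> measurable M (borel_closure D)" using Z J that by auto
      then have "Z \<tau> -` E \<tau> \<inter> space M \<in> sets M" using E[OF that] by (rule measurable_sets)
      then show ?thesis by (simp add: vimage_def Int_def conj_commute)
    qed
    then show ?thesis
      unfolding A_def using J by (intro sets.sets_Collect_finite_All) auto
  qed
  \<comment> \<open>A condition at time \<open>s\<close>, if there is one, is moved out of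
    \<open>J\<close>, since \<open>joint\<close> treats \<open>s\<close> separately; without one,
    the whole closed domain is taken.\<close>
  define C where "C = (if s \<in> J then E s else closure D)"
  have C: "C \<in> sets (borel_closure D)"
    using E by (auto simp: C_def borel_closure_sets)
  then have [measurable]: "C \<in> sets borel" and CD: "C \<subseteq> closure D" by (auto simp: borel_closure_sets)
  obtain \<rho> where [measurable]: "\<rho> \<in> borel_measurable borel" and \<rho>:
    "\<And>C B. C \<in> sets (borel_closure D) \<Longrightarrow> B \<in> sets (borel_closure D) \<Longrightarrow>
      emeasure M {\<omega>\<in>space M. (\<forall>\<tau>\<in>J - {s}. Z \<tau> \<omega> \<in> E \<tau>) \<and> Z s \<omega> \<in> C \<and> Z t \<omega> \<in> B}
        = (\<integral>\<^sup>+ x\<in>C. (\<rho> x * (\<integral>\<^sup>+ y\<in>B. ennreal (q x y) \<partial>lborel)) \<partial>lborel)"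
  proof -
    have "\<exists>\<rho>\<in>borel_measurable borel. \<forall>C\<in>sets (borel_closure D). \<forall>B\<in>sets (borel_closure D).
      emeasure M {\<omega>\<in>space M. (\<forall>\<tau>\<in>J - {s}. Z \<tau> \<omega> \<in> E \<tau>) \<and> Z s \<omega> \<in> C \<and> Z t \<omega> \<in> B}
        = (\<integral>\<^sup>+ x\<in>C. (\<rho> x * (\<integral>\<^sup>+ y\<in>B. ennreal (q x y) \<partial>lborel)) \<partial>lborel)"
      using J E by (intro joint) auto
    then show ?thesis using that by blast
  qed
  \<comment> \<open>\<open>joint\<close> speaks of subsets of the closed domain; intersecting with
    it loses nothing because the process stays there.\<close>
  have restr: "{\<omega>\<in>space M. \<omega> \<in> A \<and> Z s \<omega> \<in> C' \<and> Z t \<omega> \<in> B}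
      = {\<omega>\<in>space M. (\<forall>\<tau>\<in>J - {s}. Z \<tau> \<omega> \<in> E \<tau>) \<and> Z s \<omega> \<in> C \<inter> C' \<and> Z t \<omega> \<in> B \<inter> closure D}" for C' B
  proof -
    have "Z s \<omega> \<in> closure D" "Z t \<omega> \<in> closure D" if "\<omega> \<in> space M" for \<omega>
      using Z_in[OF _ that] s by auto
    moreover have "(\<forall>\<tau>\<in>J. Z \<tau> \<omega> \<in> E \<tau>) \<longleftrightarrow> (\<forall>\<tau>\<in>J - {s}. Z \<tau> \<omega> \<in> E \<tau>) \<and> (s \<in> J \<longrightarrow> Z s \<omega> \<in> E s)" for \<omega>
      by auto
    moreover have "Z s \<omega> \<in> C \<longleftrightarrow> (s \<in> J \<longrightarrow> Z s \<omega> \<in> E s)" if "\<omega> \<in> space M" for \<omega>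
      using Z_in[OF _ that] s by (simp add: C_def)
    ultimately show ?thesis
      unfolding A_def by (intro Collect_cong) (simp, blast)
  qed
  let ?N = "density M (indicator A)"
  have emeasure_A: "emeasure M {\<omega>\<in>space M. \<omega> \<in> A \<and> Z s \<omega> \<in> C' \<and> Z t \<omega> \<in> B}
      = (\<integral>\<^sup>+ x\<in>C \<inter> C'. (\<rho> x * (\<integral>\<^sup>+ y\<in>B \<inter> closure D. ennreal (q x y) \<partial>lborel)) \<partial>lborel)"
    if "C' \<in> sets borel" "B \<in> sets borel" for C' B
  proof -
    have "C \<inter> C' \<in> sets (borel_closure D)" "B \<inter> closure D \<in> sets (borel_closure D)"
      using that CD by (auto simp: borel_closure_sets)
    then show ?thesis unfolding restr by (rule \<rho>)
  qed
  \<comment> \<open>\<open>Z t\<close> is left unrestricted, and the total mass 1 of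
    \<open>q\<close> removes the inner integral.\<close>
  have "distr ?N borel (Z s) = density lborel (\<lambda>x. \<rho> x * indicator C x)"
  proof (rule measure_eqI)
    fix C' assume "C' \<in> sets (distr ?N borel (Z s))"
    then have [measurable]: "C' \<in> sets borel" by simp
    have "emeasure (distr ?N borel (Z s)) C' = (\<integral>\<^sup>+ \<omega>. indicator A \<omega> * indicator (Z s -` C' \<inter> space M) \<omega> \<partial>M)"
      by (simp add: emeasure_distr emeasure_density)
    also have "\<dots> = (\<integral>\<^sup>+ \<omega>. indicator {\<omega>\<in>space M. \<omega> \<in> A \<and> Z s \<omega> \<in> C' \<and> Z t \<omega> \<in> UNIV} \<omega> \<partial>M)"
      by (intro nn_integral_cong) (auto split: split_indicator)
    also have "\<dots> = emeasure M {\<omega>\<in>space M. \<omega> \<in> A \<and> Z s \<omega> \<in> C' \<and> Z t \<omega> \<in> UNIV}"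
      by (intro nn_integral_indicator) measurable
    also have "\<dots> = emeasure (density lborel (\<lambda>x. \<rho> x * indicator C x)) C'"
      using CD q_total by (subst emeasure_A)
        (auto simp: emeasure_density subset_eq intro!: nn_integral_cong split: split_indicator)
    finally show "emeasure (distr ?N borel (Z s)) C' = emeasure (density lborel (\<lambda>x. \<rho> x * indicator C x)) C'" .
  qed simp
  \<comment> \<open>Now \<open>Z s\<close> is left unrestricted within \<open>C\<close>, and the
    order of integration is exchanged.\<close>
  moreover have "distr ?N borel (Z t)
      = density lborel (\<lambda>y. (\<integral>\<^sup>+ x\<in>C. (\<rho> x * ennreal (q x y)) \<partial>lborel) * indicator (closure D) y)"
  proof (rule measure_eqI)
    fix B assume "B \<in> sets (distr ?N borel (Z t))"
    then have [measurable]: "B \<in> sets borel" by simp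
    let ?f = "\<lambda>x y. \<rho> x * ennreal (q x y) * indicator C x * indicator (B \<inter> closure D) y"
    have "emeasure (distr ?N borel (Z t)) B = (\<integral>\<^sup>+ \<omega>. indicator A \<omega> * indicator (Z t -` B \<inter> space M) \<omega> \<partial>M)"
      by (simp add: emeasure_distr emeasure_density)
    also have "\<dots> = (\<integral>\<^sup>+ \<omega>. indicator {\<omega>\<in>space M. \<omega> \<in> A \<and> Z s \<omega> \<in> UNIV \<and> Z t \<omega> \<in> B} \<omega> \<partial>M)"
      by (intro nn_integral_cong) (auto split: split_indicator)
    also have "\<dots> = emeasure M {\<omega>\<in>space M. \<omega> \<in> A \<and> Z s \<omega> \<in> UNIV \<and> Z t \<omega> \<in> B}"
      by (intro nn_integral_indicator) measurable
    also have "\<dots> = (\<integral>\<^sup>+ x. (\<integral>\<^sup>+ y. ?f x y \<partial>lborel) \<partial>lborel)"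
      by (subst emeasure_A) (auto intro!: nn_integral_cong simp: nn_integral_cmult mult.assoc split: split_indicator)
    also have "\<dots> = (\<integral>\<^sup>+ y. (\<integral>\<^sup>+ x. ?f x y \<partial>lborel) \<partial>lborel)"
      by (rule lborel_pair.Fubini') measurable
    also have "\<dots> = emeasure (density lborel (\<lambda>y. (\<integral>\<^sup>+ x\<in>C. (\<rho> x * ennreal (q x y)) \<partial>lborel) * indicator (closure D) y)) B"
      by (auto simp: emeasure_density nn_integral_multc intro!: nn_integral_cong split: split_indicator)
    finally show "emeasure (distr ?N borel (Z t)) B
      = emeasure (density lborel (\<lambda>y. (\<integral>\<^sup>+ x\<in>C. (\<rho> x * ennreal (q x y)) \<partial>lborel) * indicator (closure D) y)) B" .
  qed simp
  moreover have "(\<integral>\<^sup>+ y. (\<integral>\<^sup>+ x\<in>C. (\<rho> x * ennreal (q x y)) \<partial>lborel) * indicator (closure D) y * F y \<partial>lborel)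
      = (\<integral>\<^sup>+ x. \<rho> x * indicator C x * kernel F x \<partial>lborel)"
  proof -
    let ?f = "\<lambda>x y. \<rho> x * indicator C x * (ennreal (q x y) * F y * indicator (closure D) y)"
    have "(\<integral>\<^sup>+ y. (\<integral>\<^sup>+ x\<in>C. (\<rho> x * ennreal (q x y)) \<partial>lborel) * indicator (closure D) y * F y \<partial>lborel)
      = (\<integral>\<^sup>+ y. (\<integral>\<^sup>+ x. ?f x y \<partial>lborel) \<partial>lborel)"
      by (auto intro!: nn_integral_cong simp: nn_integral_cmult ac_simps split: split_indicator)
    also have "\<dots> = (\<integral>\<^sup>+ x. (\<integral>\<^sup>+ y. ?f x y \<partial>lborel) \<partial>lborel)"
      by (rule lborel_pair.Fubini') measurable
    also have "\<dots> = (\<integral>\<^sup>+ x. \<rho> x * indicator C x * kernel F x \<partial>lborel)"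
      unfolding kernel_def by (subst nn_integral_cmult) auto
    finally show ?thesis .
  qed
  moreover have "(\<integral>\<^sup>+ \<omega>\<in>A. F (Z t \<omega>) \<partial>M) = (\<integral>\<^sup>+ y. F y \<partial>distr ?N borel (Z t))"
    "(\<integral>\<^sup>+ \<omega>\<in>A. kernel F (Z s \<omega>) \<partial>M) = (\<integral>\<^sup>+ x. kernel F x \<partial>distr ?N borel (Z s))"
    by (simp_all add: nn_integral_distr nn_integral_density mult.commute)
  ultimately show ?thesis
    by (simp add: nn_integral_density)
qed

text \<open>Both sides are values of image measures under the path map, with densities
  \<open>F (Z t)\<close> and \<open>kernel F (Z s)\<close>. They agree on the finite-dimensional
  cylinders by \<open>cylinder_integral\<close>, hence everywhere.\<close>

lemma gen_algebra_integral:
  assumes F [measurable]: "F \<in> borel_measurable borel" and bound: "\<And>x. F x \<le> ennreal c"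
    and A: "A \<in> sets (gen_algebra M D Z I)"
  shows "(\<integral>\<^sup>+ \<omega>\<in>A. F (Z t \<omega>) \<partial>M) = (\<integral>\<^sup>+ \<omega>\<in>A. kernel F (Z s \<omega>) \<partial>M)"
proof -
  let ?X = "\<lambda>\<omega>. \<lambda>\<tau>\<in>I. Z \<tau> \<omega>" and ?P = "Pi\<^sub>M I (\<lambda>_. borel_closure D)"
  have X [measurable]: "?X \<in> measurable M ?P"
    by (rule measurable_restrict) (use Z in auto)
  let ?L = "distr (density M (\<lambda>\<omega>. F (Z t \<omega>))) ?P ?X"
  let ?R = "distr (density M (\<lambda>\<omega>. kernel F (Z s \<omega>))) ?P ?X"
  have emeasure_distr_density: "emeasure (distr (density M f) ?P ?X) B = (\<integral>\<^sup>+ \<omega>\<in>?X -` B \<inter> space M. f \<omega> \<partial>M)"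
    if [measurable]: "f \<in> borel_measurable M" "B \<in> sets ?P" for f B
    by (simp add: emeasure_distr emeasure_density)
  have "?L = ?R"
  proof (rule measure_eqI_PiM_infinite)
    fix B J assume J: "finite J" "J \<subseteq> I" "\<And>\<tau>. \<tau> \<in> J \<Longrightarrow> B \<tau> \<in> sets (borel_closure D)"
    let ?B = "prod_emb I (\<lambda>_. borel_closure D) J (Pi\<^sub>E J B)"
    have [measurable]: "?B \<in> sets ?P"
      using J by (intro sets_PiM_I) auto
    have "?X -` ?B \<inter> space M = {\<omega>\<in>space M. \<forall>\<tau>\<in>J. Z \<tau> \<omega> \<in> B \<tau>}"
      using J Z_in by (auto simp: prod_emb_iff PiE_iff extensional_def space_restrict_space subset_eq)
    then show "emeasure ?L ?B = emeasure ?R ?B"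
      using cylinder_integral[OF J F] by (simp add: emeasure_distr_density)
  next
    have "(\<integral>\<^sup>+ \<omega>. F (Z t \<omega>) \<partial>M) \<le> (\<integral>\<^sup>+ \<omega>. ennreal c \<partial>M)"
      by (intro nn_integral_mono bound)
    then have "(\<integral>\<^sup>+ \<omega>. F (Z t \<omega>) \<partial>M) \<noteq> \<infinity>"
      by (auto simp: emeasure_space_1 top_unique)
    moreover have "emeasure ?L (space ?P) = (\<integral>\<^sup>+ \<omega>. F (Z t \<omega>) \<partial>M)"
      using measurable_space[OF X]
      by (subst emeasure_distr_density) (auto intro!: nn_integral_cong simp del: space_PiM split: split_indicator)
    \<comment> \<open>This is where the bound on \<open>F\<close> enters: uniqueness from cylinders
      needs a finite measure.\<close>
    ultimately show "finite_measure ?L"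
      by (intro finite_measureI) simp
  qed simp_all
  moreover obtain A' where "A' \<in> sets ?P" "A = ?X -` A' \<inter> space M"
    using sets_gen_algebra_vimage[of I Z M D A] Z A by auto
  ultimately show ?thesis
    using emeasure_distr_density[of "\<lambda>\<omega>. F (Z t \<omega>)" A'] emeasure_distr_density[of "\<lambda>\<omega>. kernel F (Z s \<omega>)" A']
    by simp
qed

text \<open>Both conditional expectations are shown to equal \<open>k (Z s)\<close>: this variable
  is measurable for the observation at \<open>s\<close> alone and has the right integrals over every
  set of the larger sigma-algebra. A signed \<open>h\<close> is shifted by its bound to become
  nonnegative; as \<open>q\<close> has mass 1, the kernel shifts by the same constant, which cancels
  at the end.\<close>

lemma cond_exp_kernel:
  assumes h: "bounded_borel D h"
  defines "k \<equiv> \<lambda>x. LINT y:closure D|lborel. q x y * h y"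
  shows "AE \<omega> in M. real_cond_exp M (gen_algebra M D Z I) (\<lambda>\<omega>. h (Z t \<omega>)) \<omega> = k (Z s \<omega>)"
    and "AE \<omega> in M. real_cond_exp M (gen_algebra M D Z {s}) (\<lambda>\<omega>. h (Z t \<omega>)) \<omega> = k (Z s \<omega>)"
proof -
  have cl [measurable]: "closure D \<in> sets borel" by simp
  \<comment> \<open>Extension by zero, because \<open>h\<close> is known to be Borel on the closed
    domain only.\<close>
  define h0 where "h0 y = indicator (closure D) y * h y" for y
  have h0 [measurable]: "h0 \<in> borel_measurable borel"
    using h unfolding bounded_borel_def h0_def[abs_def]
    by (subst (asm) borel_measurable_restrict_space_iff) auto
  obtain c where "0 < c" "\<forall>y\<in>closure D. \<bar>h y\<bar> \<le> c"
    using h unfolding bounded_borel_def bounded_pos by auto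
  then have c0: "0 \<le> c \<and> \<bar>h0 y\<bar> \<le> c" for y
    by (auto simp: h0_def split: split_indicator)
  have k_alt: "k x = (\<integral>y. indicator (closure D) y * (q x y * h0 y) \<partial>lborel)" for x
    unfolding k_def set_lebesgue_integral_def h0_def by (intro Bochner_Integration.integral_cong) (auto split: split_indicator)
  have k_borel [measurable]: "k \<in> borel_measurable borel"
    unfolding k_alt[abs_def] by measurable
  have q_int: "set_integrable lborel (closure D) (q x)" "(LINT y:closure D|lborel. q x y) = 1" if "x \<in> closure D" for x
  proof -
    have *: "(\<integral>\<^sup>+ y. ennreal (indicator (closure D) y * q x y) \<partial>lborel) = ennreal 1"
      using q_total[OF that] by (simp add: mult.commute ennreal_mult'' ennreal_indicator q_nonneg)
    show "set_integrable lborel (closure D) (q x)"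
      unfolding set_integrable_def using * q_nonneg by (intro integrableI_nonneg) auto
    show "(LINT y:closure D|lborel. q x y) = 1"
      unfolding set_lebesgue_integral_def using * q_nonneg
      by (subst integral_eq_nn_integral) auto
  qed
  have qh_int: "set_integrable lborel (closure D) (\<lambda>y. q x y * h0 y)" if "x \<in> closure D" for x
    unfolding set_integrable_def
  proof (rule Bochner_Integration.integrable_bound)
    show "integrable lborel (\<lambda>y. c * (indicator (closure D) y *\<^sub>R q x y))"
      using q_int(1)[OF that] unfolding set_integrable_def by simp
    show "AE y in lborel. norm (indicator (closure D) y *\<^sub>R (q x y * h0 y)) \<le> norm (c * (indicator (closure D) y *\<^sub>R q x y))"
      using c0 q_nonneg by (auto simp: abs_mult mult.commute[of c] intro!: AE_I2 mult_left_mono split: split_indicator)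
  qed measurable
  have k_bound: "\<bar>k x\<bar> \<le> c" and kernel_eq: "kernel (\<lambda>y. ennreal (h0 y + c)) x = ennreal (k x + c)" if "x \<in> closure D" for x
  proof -
    have int: "set_integrable lborel (closure D) (\<lambda>y. q x y * (h0 y + c))"
      using qh_int[OF that] q_int(1)[OF that] by (simp add: distrib_left set_integral_add)
    have eq: "(LINT y:closure D|lborel. q x y * (h0 y + c)) = k x + c"
      using qh_int[OF that] q_int[OF that]
      by (simp add: distrib_left set_integral_add) (simp add: k_alt set_lebesgue_integral_def)
    have pos: "0 \<le> h0 y + c" "h0 y \<le> c" for y using c0[of y] by auto
    show "kernel (\<lambda>y. ennreal (h0 y + c)) x = ennreal (k x + c)"
      unfolding eq[symmetric] kernel_def set_lebesgue_integral_def
      using int pos q_nonneg unfolding set_integrable_def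
      by (subst nn_integral_eq_integral[symmetric])
        (auto intro!: nn_integral_cong simp: ennreal_mult split: split_indicator)
    have q_cmult: "set_integrable lborel (closure D) (\<lambda>y. q x y * b)" for b
      using q_int(1)[OF that] by simp
    have q_val: "(LINT y:closure D|lborel. q x y * b) = b" for b
      using q_int(2)[OF that] by simp
    have k_eq: "k x = (LINT y:closure D|lborel. q x y * h0 y)"
      by (simp add: k_alt set_lebesgue_integral_def)
    have "(LINT y:closure D|lborel. q x y * h0 y) \<le> (LINT y:closure D|lborel. q x y * c)"
      using qh_int[OF that] q_cmult pos q_nonneg by (intro set_integral_mono mult_left_mono) auto
    moreover have "(LINT y:closure D|lborel. q x y * (- c)) \<le> (LINT y:closure D|lborel. q x y * h0 y)"
      using c0 by (intro set_integral_mono mult_left_mono qh_int[OF that] q_cmult q_nonneg) (auto simp: abs_le_iff minus_le_iff)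
    ultimately show "\<bar>k x\<bar> \<le> c"
      unfolding q_val k_eq[symmetric] by linarith
  qed
  have in_cl: "Z t \<omega> \<in> closure D" "Z s \<omega> \<in> closure D" if "\<omega> \<in> space M" for \<omega>
    using Z_in[OF _ that] s by auto
  have int: "integrable M (\<lambda>\<omega>. h0 (Z t \<omega>))" "integrable M (\<lambda>\<omega>. k (Z s \<omega>))"
    using c0 k_bound in_cl by (auto intro!: integrable_const_bound[where B = c] AE_I2)
  have set_int_eq: "(LINT \<omega>:A|M. h0 (Z t \<omega>)) = (LINT \<omega>:A|M. k (Z s \<omega>))"
    if A: "A \<in> sets (gen_algebra M D Z I)" for A
  proof -
    have [measurable]: "A \<in> sets M"
      using subalgebra_gen_algebra[of I Z M D] Z A by (auto simp: subalgebra_def)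
    have *: "(LINT \<omega>:A|M. f \<omega> + c) = (LINT \<omega>:A|M. f \<omega>) + (LINT \<omega>:A|M. c)" if "integrable M f" for f
    proof (rule set_integral_add)
      have "set_integrable M A f'" if "integrable M f'" for f' :: "'w \<Rightarrow> real"
        unfolding set_integrable_def using that by (intro integrable_mult_indicator) auto
      then show "set_integrable M A f" "set_integrable M A (\<lambda>_. c)" using that by auto
    qed
    \<comment> \<open>Translation between the Bochner integral and the nonnegative one; the shift by
      \<open>c\<close> makes the integrand nonnegative on the space.\<close>
    have **: "(LINT \<omega>:A|M. f \<omega> + c) = enn2real (\<integral>\<^sup>+ \<omega>\<in>A. ennreal (f \<omega> + c) \<partial>M)"
      if "integrable M f" "\<And>\<omega>. \<omega> \<in> space M \<Longrightarrow> \<bar>f \<omega>\<bar> \<le> c" for f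
    proof -
      have "0 \<le> f \<omega> + c" if "\<omega> \<in> space M" for \<omega>
        using \<open>\<And>\<omega>. \<omega> \<in> space M \<Longrightarrow> \<bar>f \<omega>\<bar> \<le> c\<close>[OF that] by linarith
      then show ?thesis
        unfolding set_lebesgue_integral_def using \<open>integrable M f\<close>
        by (subst integral_eq_nn_integral)
          (auto intro!: AE_I2 arg_cong[where f = enn2real] nn_integral_cong split: split_indicator)
    qed
    have "(\<integral>\<^sup>+ \<omega>\<in>A. ennreal (h0 (Z t \<omega>) + c) \<partial>M) = (\<integral>\<^sup>+ \<omega>\<in>A. kernel (\<lambda>y. ennreal (h0 y + c)) (Z s \<omega>) \<partial>M)"
      using c0 by (intro gen_algebra_integral[of "\<lambda>y. ennreal (h0 y + c)" "c + c"] A) (auto intro!: ennreal_leI simp: abs_le_iff)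
    also have "\<dots> = (\<integral>\<^sup>+ \<omega>\<in>A. ennreal (k (Z s \<omega>) + c) \<partial>M)"
      using in_cl by (intro nn_integral_cong) (simp add: kernel_eq)
    finally have "(LINT \<omega>:A|M. h0 (Z t \<omega>) + c) = (LINT \<omega>:A|M. k (Z s \<omega>) + c)"
      using int c0 k_bound in_cl by (simp add: **)
    then show ?thesis using int by (simp add: *)
  qed
  \<comment> \<open>Covers \<open>I\<close> and \<open>{s}\<close> at once: any set of times between
    them generates a smaller sigma-algebra than \<open>I\<close>, on which the integrals still
    agree, and still makes \<open>Z s\<close> measurable.\<close>
  have cond_exp: "AE \<omega> in M. real_cond_exp M (gen_algebra M D Z I') (\<lambda>\<omega>. h (Z t \<omega>)) \<omega> = k (Z s \<omega>)"
    if I': "s \<in> I'" "I' \<subseteq> I" for I'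
  proof -
    have sub: "subalgebra M (gen_algebra M D Z I')"
      using Z I' by (intro subalgebra_gen_algebra) auto
    interpret finite_measure_subalgebra M "gen_algebra M D Z I'"
      by standard (rule sub)
    show ?thesis
    proof (rule real_cond_exp_charact)
      fix A assume A: "A \<in> sets (gen_algebra M D Z I')"
      have "(LINT \<omega>:A|M. h (Z t \<omega>)) = (LINT \<omega>:A|M. h0 (Z t \<omega>))"
        unfolding set_lebesgue_integral_def
        by (intro Bochner_Integration.integral_cong) (auto simp: h0_def in_cl)
      then show "(LINT \<omega>:A|M. h (Z t \<omega>)) = (LINT \<omega>:A|M. k (Z s \<omega>))"
        using set_int_eq[OF subsetD[OF sets_gen_algebra_mono[OF I'(2)] A]] by simp
    next
      have "integrable M (\<lambda>\<omega>. h (Z t \<omega>)) = integrable M (\<lambda>\<omega>. h0 (Z t \<omega>))"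
        by (intro Bochner_Integration.integrable_cong) (auto simp: h0_def in_cl)
      then show "integrable M (\<lambda>\<omega>. h (Z t \<omega>))" using int by simp
      show "integrable M (\<lambda>\<omega>. k (Z s \<omega>))" by (rule int)
      have "Z s \<in> borel_measurable (gen_algebra M D Z I')"
        using Z s I' by (intro borel_measurable_borel_closure[of _ _ D] measurable_gen_algebra) auto
      then show "(\<lambda>\<omega>. k (Z s \<omega>)) \<in> borel_measurable (gen_algebra M D Z I')"
        by measurable
    qed
  qed
  show "AE \<omega> in M. real_cond_exp M (gen_algebra M D Z I) (\<lambda>\<omega>. h (Z t \<omega>)) \<omega> = k (Z s \<omega>)"
    "AE \<omega> in M. real_cond_exp M (gen_algebra M D Z {s}) (\<lambda>\<omega>. h (Z t \<omega>)) \<omega> = k (Z s \<omega>)"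
    using cond_exp s by auto
qed

end

text \<open>Here \<open>q\<close> is the unnormalised kernel \<open>\<kappa>\<close> divided by the
  value of \<open>W\<close> at the starting point. Multiplying back moves that factor into
  \<open>\<rho>\<close>, which may be any measurable weight; \<open>W\<close> must be neither 0 nor
  infinite for the cancellation. The kernel is extended by zero because its measurability is given
  on the closed domain.\<close>

lemma transition_kernel_h_transform:
  fixes q :: "real^'n \<Rightarrow> real^'n \<Rightarrow> real" and \<kappa> :: "real^'n \<Rightarrow> real^'n \<Rightarrow> ennreal"
  assumes "prob_space M"
    and Z: "\<And>\<tau>. \<tau> \<in> insert t I \<Longrightarrow> Z \<tau> \<in> measurable M (borel_closure D)" "s \<in> I"
    and q_borel: "(\<lambda>(x, y). q x y) \<in> borel_measurable (restrict_space borel (closure D \<times> closure D))"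
    and q_nonneg: "\<And>x y. x \<in> closure D \<Longrightarrow> y \<in> closure D \<Longrightarrow> 0 \<le> q x y"
    and W [measurable]: "W \<in> borel_measurable borel" and W_pos: "\<And>x. x \<in> closure D \<Longrightarrow> W x \<noteq> 0 \<and> W x \<noteq> \<infinity>"
    and q_eq: "\<And>x y. x \<in> closure D \<Longrightarrow> y \<in> closure D \<Longrightarrow> ennreal (q x y) = \<kappa> x y / W x"
    and q_total: "\<And>x. x \<in> closure D \<Longrightarrow> (\<integral>\<^sup>+ y\<in>closure D. ennreal (q x y) \<partial>lborel) = 1"
    and joint: "\<And>J E. finite J \<Longrightarrow> J \<subseteq> I - {s} \<Longrightarrow> (\<And>\<tau>. \<tau> \<in> J \<Longrightarrow> E \<tau> \<in> sets (borel_closure D)) \<Longrightarrow>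
      \<exists>\<rho>\<in>borel_measurable borel. \<forall>C\<in>sets (borel_closure D). \<forall>B\<in>sets (borel_closure D).
        emeasure M {\<omega>\<in>space M. (\<forall>\<tau>\<in>J. Z \<tau> \<omega> \<in> E \<tau>) \<and> Z s \<omega> \<in> C \<and> Z t \<omega> \<in> B}
        = (\<integral>\<^sup>+ x\<in>C. (\<rho> x * (\<integral>\<^sup>+ y\<in>B. \<kappa> x y \<partial>lborel)) \<partial>lborel)"
  shows "transition_kernel M D Z I s t (\<lambda>x y. if x \<in> closure D \<and> y \<in> closure D then q x y else 0)"
    (is "transition_kernel M D Z I s t ?q")
proof -
  interpret prob_space M by fact
  have cl [measurable]: "closure D \<in> sets borel" by simp
  have clcl: "closure D \<times> closure D \<in> sets borel"
    by (intro borel_closed closed_Times) auto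
  have "(\<lambda>p. indicator (closure D \<times> closure D) p *\<^sub>R (case p of (x, y) \<Rightarrow> q x y)) \<in> borel_measurable borel"
    using q_borel clcl by (subst (asm) borel_measurable_restrict_space_iff) auto
  also have "(\<lambda>p. indicator (closure D \<times> closure D) p *\<^sub>R (case p of (x, y) \<Rightarrow> q x y)) = (\<lambda>(x, y). ?q x y)"
    by (auto simp: fun_eq_iff)
  finally have q': "(\<lambda>(x, y). ?q x y) \<in> borel_measurable (borel \<Otimes>\<^sub>M borel)"
    by (simp add: borel_prod)
  have q'_borel: "(\<lambda>y. ?q x y) \<in> borel_measurable borel" for x
    using measurable_compose[OF _ q', of "\<lambda>y. (x, y)" borel] by simp
  show ?thesis
  proof
    show "Z \<tau> \<in> measurable M (borel_closure D)" if "\<tau> \<in> insert t I" for \<tau>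
      using Z that by blast
    show "s \<in> I" by fact
    show "(\<lambda>(x, y). ?q x y) \<in> borel_measurable (borel \<Otimes>\<^sub>M borel)" by fact
    show "0 \<le> ?q x y" for x y using q_nonneg by simp
    show "(\<integral>\<^sup>+ y\<in>closure D. ennreal (?q x y) \<partial>lborel) = 1" if "x \<in> closure D" for x
      using q_total[OF that] that by (subst (asm) nn_integral_cong[where v = "\<lambda>y. ennreal (?q x y) * indicator (closure D) y"])
        (auto split: split_indicator)
  next
    fix J and E :: "real \<Rightarrow> (real^'n) set"
    assume "finite J" "J \<subseteq> I - {s}" "\<And>\<tau>. \<tau> \<in> J \<Longrightarrow> E \<tau> \<in> sets (borel_closure D)"
    with joint[of J E] obtain \<rho> where [measurable]: "\<rho> \<in> borel_measurable borel" and \<rho>: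
      "\<And>C B. C \<in> sets (borel_closure D) \<Longrightarrow> B \<in> sets (borel_closure D) \<Longrightarrow>
        emeasure M {\<omega>\<in>space M. (\<forall>\<tau>\<in>J. Z \<tau> \<omega> \<in> E \<tau>) \<and> Z s \<omega> \<in> C \<and> Z t \<omega> \<in> B}
          = (\<integral>\<^sup>+ x\<in>C. (\<rho> x * (\<integral>\<^sup>+ y\<in>B. \<kappa> x y \<partial>lborel)) \<partial>lborel)"
      by blast
    have eq: "(\<integral>\<^sup>+ y\<in>B. \<kappa> x y \<partial>lborel) = W x * (\<integral>\<^sup>+ y\<in>B. ennreal (?q x y) \<partial>lborel)"
      if x: "x \<in> closure D" and B: "B \<in> sets (borel_closure D)" for x B
    proof -
      have [measurable]: "B \<in> sets borel" and BD: "B \<subseteq> closure D" using B by (auto simp: borel_closure_sets)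
      have [measurable]: "(\<lambda>y. ?q x y) \<in> borel_measurable borel" by (rule q'_borel)
      have "W x * (\<integral>\<^sup>+ y\<in>B. ennreal (?q x y) \<partial>lborel) = (\<integral>\<^sup>+ y. W x * (ennreal (?q x y) * indicator B y) \<partial>lborel)"
        by (rule nn_integral_cmult[symmetric]) measurable
      also have "\<dots> = (\<integral>\<^sup>+ y\<in>B. \<kappa> x y \<partial>lborel)"
        using x BD W_pos[OF x]
        by (intro nn_integral_cong)
          (auto simp: q_eq subset_eq ennreal_times_divide mult_divide_eq_ennreal mult.commute[of "W x" "\<kappa> x _"] split: split_indicator)
      finally show ?thesis ..
    qed
    have "emeasure M {\<omega>\<in>space M. (\<forall>\<tau>\<in>J. Z \<tau> \<omega> \<in> E \<tau>) \<and> Z s \<omega> \<in> C \<and> Z t \<omega> \<in> B}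
        = (\<integral>\<^sup>+ x\<in>C. (\<rho> x * W x * (\<integral>\<^sup>+ y\<in>B. ennreal (?q x y) \<partial>lborel)) \<partial>lborel)"
      if C: "C \<in> sets (borel_closure D)" and B: "B \<in> sets (borel_closure D)" for C B
      unfolding \<rho>[OF C B]
    proof (rule nn_integral_cong)
      fix x
      show "\<rho> x * (\<integral>\<^sup>+ y\<in>B. \<kappa> x y \<partial>lborel) * indicator C x
        = \<rho> x * W x * (\<integral>\<^sup>+ y\<in>B. ennreal (?q x y) \<partial>lborel) * indicator C x"
        using C eq[OF _ B, of x] by (cases "x \<in> C") (auto simp: borel_closure_sets subset_eq mult.assoc)
    qed
    moreover have "(\<lambda>x. \<rho> x * W x) \<in> borel_measurable borel" by measurable
    ultimately show "\<exists>\<rho>\<in>borel_measurable borel. \<forall>C\<in>sets (borel_closure D). \<forall>B\<in>sets (borel_closure D).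
        emeasure M {\<omega>\<in>space M. (\<forall>\<tau>\<in>J. Z \<tau> \<omega> \<in> E \<tau>) \<and> Z s \<omega> \<in> C \<and> Z t \<omega> \<in> B}
        = (\<integral>\<^sup>+ x\<in>C. (\<rho> x * (\<integral>\<^sup>+ y\<in>B. ennreal (?q x y) \<partial>lborel)) \<partial>lborel)"
      by (intro bexI[where x = "\<lambda>x. \<rho> x * W x"]) blast+
  qed
qed

section \<open>Green functions and h-transforms\<close>

text \<open>
  A non-integrable function has Bochner integral 0, so a positive value already entails integrability.
\<close>

lemma nn_set_integral_eq_of_pos:
  assumes "0 < (LINT y:A|N. f y)" "\<And>y. y \<in> A \<Longrightarrow> 0 \<le> (f y :: real)"
  shows "(\<integral>\<^sup>+ y\<in>A. ennreal (f y) \<partial>N) = ennreal (LINT y:A|N. f y)"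
proof -
  have "integrable N (\<lambda>y. indicator A y *\<^sub>R f y)"
    using assms(1) not_integrable_integral_eq unfolding set_lebesgue_integral_def by fastforce
  moreover have "(\<integral>\<^sup>+ y\<in>A. ennreal (f y) \<partial>N) = (\<integral>\<^sup>+ y. ennreal (indicator A y *\<^sub>R f y) \<partial>N)"
    by (intro nn_integral_cong) (auto split: split_indicator)
  ultimately show ?thesis
    unfolding set_lebesgue_integral_def using assms(2)
    by (auto intro!: nn_integral_eq_integral AE_I2 split: split_indicator)
qed

text \<open>The frontier of a convex set is Lebesgue null. This reconciles the Green functions,
  integrated over D, with the process, which takes values in the closure.\<close>

lemma AE_closure_convex:
  fixes D :: "'a::euclidean_space set"
  assumes "open D" "convex D"
  shows "AE x in lborel. x \<in> closure D \<longrightarrow> x \<in> D"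
proof -
  have "frontier D \<in> null_sets lebesgue"
    using negligible_convex_frontier[OF assms(2)] negligible_iff_null_sets by blast
  then have "frontier D \<in> null_sets lborel"
    by (subst (asm) null_sets_completion_iff) auto
  then have "AE x in lborel. x \<notin> frontier D"
    by (rule AE_not_in)
  then show ?thesis
    by eventually_elim (auto simp: frontier_def interior_open[OF assms(1)])
qed

lemma nn_integral_closure_convex:
  fixes D :: "'a::euclidean_space set"
  assumes "open D" "convex D"
  shows "(\<integral>\<^sup>+ x\<in>closure D. f x \<partial>lborel) = (\<integral>\<^sup>+ x\<in>D. f x \<partial>lborel)"
proof (rule nn_integral_cong_AE)
  show "AE x in lborel. f x * indicator (closure D) x = f x * indicator D x"
    using AE_closure_convex[OF assms]
    by eventually_elim (use closure_subset[of D] in \<open>auto split: split_indicator\<close>)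
qed

lemma set_integral_closure_convex:
  fixes D :: "'a::euclidean_space set" and f :: "'a \<Rightarrow> real"
  assumes D: "open D" "convex D" and f: "f \<in> borel_measurable (restrict_space borel (closure D))"
  shows "(LINT x:closure D|lborel. f x) = (LINT x:D|lborel. f x)"
  unfolding set_lebesgue_integral_def
proof (rule integral_cong_AE)
  have f': "(\<lambda>x. indicator (closure D) x *\<^sub>R f x) \<in> borel_measurable borel"
    using f by (subst (asm) borel_measurable_restrict_space_iff) auto
  then show "(\<lambda>x. indicator (closure D) x *\<^sub>R f x) \<in> borel_measurable lborel"
    by simp
  \<comment> \<open>Equality of Bochner integrals from equality almost everywhere needs both
    integrands measurable; the one over D inherits this from the one over the closure.\<close>
  have "(\<lambda>x. indicator D x *\<^sub>R (indicator (closure D) x *\<^sub>R f x)) \<in> borel_measurable borel"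
    by (intro borel_measurable_scaleR f' borel_measurable_indicator borel_open D)
  also have "(\<lambda>x. indicator D x *\<^sub>R (indicator (closure D) x *\<^sub>R f x)) = (\<lambda>x. indicator D x *\<^sub>R f x)"
    using closure_subset[of D] by (auto simp: fun_eq_iff split: split_indicator)
  finally show "(\<lambda>x. indicator D x *\<^sub>R f x) \<in> borel_measurable lborel"
    by simp
  show "AE x in lborel. indicator (closure D) x *\<^sub>R f x = indicator D x *\<^sub>R f x"
    using AE_closure_convex[OF D]
    by eventually_elim (use closure_subset[of D] in \<open>auto split: split_indicator\<close>)
qed

text \<open>The quotients of an h-transform cancel along a path, leaving the last value over the
  first. Index 0 belongs to the hypothesis: \<open>b 0\<close> is a denominator, also for
  \<open>n = 0\<close>.\<close>

lemma prod_telescope_up: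
  fixes a b :: "nat \<Rightarrow> 'b::field"
  assumes "\<And>i. i \<le> n \<Longrightarrow> b i \<noteq> 0"
  shows "(\<Prod>i=1..n. a i * (b i / b (i - 1))) = (\<Prod>i=1..n. a i) * (b n / b 0)"
  using assms by (induction n) auto

lemma prod_telescope_down:
  fixes a b :: "nat \<Rightarrow> 'b::field"
  assumes "\<And>i. i \<in> {1..Suc n} \<Longrightarrow> b i \<noteq> 0"
  shows "(\<Prod>i=1..n. a i * (b i / b (Suc i))) = (\<Prod>i=1..n. a i) * (b 1 / b (Suc n))"
  using assms by (induction n) auto

lemma chain_less:
  fixes t :: "nat \<Rightarrow> real"
  assumes "\<And>i. a \<le> i \<Longrightarrow> i < b \<Longrightarrow> t i < t (Suc i)" "a \<le> i" "i < j" "j \<le> b"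
  shows "t i < t j"
  using assms(3,4)
proof (induction j)
  case (Suc j)
  then show ?case
    using assms(1)[of j] assms(2) by (cases "i = j") auto
qed simp

lemma sorted_wrt_chain:
  fixes t :: "nat \<Rightarrow> real"
  assumes "\<And>i. a \<le> i \<Longrightarrow> i < b \<Longrightarrow> t i < t (Suc i)"
  shows "sorted_wrt (<) (map t [a..<Suc b])"
  unfolding sorted_wrt_iff_nth_less
  using chain_less[of a b t] assms by (auto simp del: upt_Suc)

text \<open>The analytic facts that feed the probabilistic argument. \<open>u\<close> and
  \<open>v\<close> are given by their integral formulas, so these can be unfolded; continuity at
  fixed times yields Borel measurability; strict positivity permits division by \<open>u\<close>,
  \<open>v\<close> and \<open>g\<close>.\<close>

locale positive_green_functions =
  fixes D :: "(real^'n) set" and T :: real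
    and g g' :: "real^'n \<Rightarrow> real \<Rightarrow> real^'n \<Rightarrow> real \<Rightarrow> real"
    and \<phi> \<psi> :: "real^'n \<Rightarrow> real" and u v :: "real^'n \<Rightarrow> real \<Rightarrow> real"
  assumes T_pos: "0 < T" and D: "open D" "convex D"
    and duality: "\<And>x y s t. x \<in> closure D \<Longrightarrow> y \<in> closure D \<Longrightarrow> 0 \<le> s \<Longrightarrow> s < t \<Longrightarrow> t \<le> T \<Longrightarrow>
      g' x s y t = g y t x s"
    and composition: "\<And>x y s r t. x \<in> closure D \<Longrightarrow> y \<in> closure D \<Longrightarrow> 0 \<le> s \<Longrightarrow> s < r \<Longrightarrow> r < t \<Longrightarrow> t \<le> T \<Longrightarrow>
      g x t y s = (LINT z:D|lborel. g x t z r * g z r y s)"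
    and g_pos: "\<And>x y s t. x \<in> closure D \<Longrightarrow> y \<in> closure D \<Longrightarrow> 0 \<le> s \<Longrightarrow> s < t \<Longrightarrow> t \<le> T \<Longrightarrow> 0 < g x t y s"
    and g_cont: "\<And>s t. 0 \<le> s \<Longrightarrow> s < t \<Longrightarrow> t \<le> T \<Longrightarrow> continuous_on (closure D \<times> closure D) (\<lambda>(x, y). g x t y s)"
    and u_def: "u = forward_evolution D g 0 \<phi>" and v_def: "v = adjoint_evolution D g' T \<psi>"
    and u_pos: "\<And>x t. x \<in> closure D \<Longrightarrow> 0 \<le> t \<Longrightarrow> t \<le> T \<Longrightarrow> 0 < u x t"
    and v_pos: "\<And>x t. x \<in> closure D \<Longrightarrow> 0 \<le> t \<Longrightarrow> t \<le> T \<Longrightarrow> 0 < v x t"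
    and u_cont: "\<And>t. 0 \<le> t \<Longrightarrow> t \<le> T \<Longrightarrow> continuous_on (closure D) (\<lambda>x. u x t)"
    and v_cont: "\<And>t. 0 \<le> t \<Longrightarrow> t \<le> T \<Longrightarrow> continuous_on (closure D) (\<lambda>x. v x t)"
begin

text \<open>
  Nothing is known about \<open>g\<close> off the closed domain or for times out of order; the extension by zero
  makes measurability unconditional.
\<close>

definition G :: "real \<Rightarrow> real \<Rightarrow> real^'n \<Rightarrow> real^'n \<Rightarrow> ennreal" where
  "G t s x y = (if x \<in> closure D \<and> y \<in> closure D \<and> 0 \<le> s \<and> s < t \<and> t \<le> T then ennreal (g x t y s) else 0)"

definition U :: "real \<Rightarrow> real^'n \<Rightarrow> ennreal" where
  "U t x = (if x \<in> closure D \<and> 0 \<le> t \<and> t \<le> T then ennreal (u x t) else 0)"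

definition V :: "real \<Rightarrow> real^'n \<Rightarrow> ennreal" where
  "V t x = (if x \<in> closure D \<and> 0 \<le> t \<and> t \<le> T then ennreal (v x t) else 0)"

lemma u_0: "u x 0 = \<phi> x" and v_T: "v x T = \<psi> x"
  by (simp_all add: u_def v_def forward_evolution_def adjoint_evolution_def)

text \<open>Each integral law asserts a Bochner integral with a strictly positive value, hence a
  convergent one, and so transfers to the nonnegative integral. Replacing D by its closure changes a
  null set, and points off the closure contribute zero.\<close>

sublocale green_kernel "closure D" T G U V
proof
  show "0 < T" by (rule T_pos)
  show "closure D \<in> sets borel" by simp
  have clcl: "closed (closure D \<times> closure D)" by (intro closed_Times) auto
  show "(\<lambda>(x, y). G t s x y) \<in> borel_measurable (borel \<Otimes>\<^sub>M borel)" for t s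
  proof (cases "0 \<le> s \<and> s < t \<and> t \<le> T")
    case True
    have "(\<lambda>p. if p \<in> closure D \<times> closure D then ennreal (case p of (x, y) \<Rightarrow> g x t y s) else 0) \<in> borel_measurable borel"
      using True clcl
      by (intro borel_measurable_continuous_on_if continuous_on_ennreal g_cont continuous_on_const borel_closed) auto
    also have "(\<lambda>p. if p \<in> closure D \<times> closure D then ennreal (case p of (x, y) \<Rightarrow> g x t y s) else 0)
        = (\<lambda>(x, y). G t s x y)"
      using True by (auto simp: G_def fun_eq_iff)
    finally show ?thesis by (simp add: borel_prod)
  next
    case False
    then have "(\<lambda>(x, y). G t s x y) = (\<lambda>_. 0)" by (auto simp: G_def fun_eq_iff)
    then show ?thesis by simp
  qed
  have slice: "(\<lambda>x. if x \<in> closure D \<and> 0 \<le> t \<and> t \<le> T then ennreal (w x t) else 0) \<in> borel_measurable borel"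
    if "0 \<le> t \<Longrightarrow> t \<le> T \<Longrightarrow> continuous_on (closure D) (\<lambda>x. w x t)" for w :: "real^'n \<Rightarrow> real \<Rightarrow> real" and t
  proof (cases "0 \<le> t \<and> t \<le> T")
    case True
    then have "(\<lambda>x. if x \<in> closure D then ennreal (w x t) else 0) \<in> borel_measurable borel"
      using that by (intro borel_measurable_continuous_on_if continuous_on_ennreal continuous_on_const) auto
    with True show ?thesis by simp
  qed (auto simp: measurable_const)
  show "U t \<in> borel_measurable borel" "V t \<in> borel_measurable borel" for t
    using slice[of t u] slice[of t v] u_cont v_cont unfolding U_def[abs_def] V_def[abs_def] by auto
  show "U t x = 0" "V t x = 0" if "x \<notin> closure D" for x t
    using that by (auto simp: U_def V_def)
  show "(\<integral>\<^sup>+ z. G t r x z * G r s z y \<partial>lborel) = G t s x y"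
    if st: "0 \<le> s" "s < r" "r < t" "t \<le> T" for s r t x y
  proof (cases "x \<in> closure D \<and> y \<in> closure D")
    case True
    then have pos: "0 < g x t y s" using g_pos st by simp
    have "(\<integral>\<^sup>+ z. G t r x z * G r s z y \<partial>lborel) = (\<integral>\<^sup>+ z\<in>closure D. ennreal (g x t z r * g z r y s) \<partial>lborel)"
      using True st g_pos less_imp_le by (intro nn_integral_cong) (auto simp: G_def ennreal_mult less_imp_le split: split_indicator)
    also have "\<dots> = (\<integral>\<^sup>+ z\<in>D. ennreal (g x t z r * g z r y s) \<partial>lborel)"
      by (rule nn_integral_closure_convex[OF D])
    also have "\<dots> = ennreal (g x t y s)"
      using True st pos composition[of x y s r t] g_pos closure_subset[of D]
      by (subst nn_set_integral_eq_of_pos) (auto intro!: mult_nonneg_nonneg simp: less_imp_le subset_eq)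
    finally show ?thesis using True st by (simp add: G_def)
  qed (auto simp: G_def)
  show "U t x = (\<integral>\<^sup>+ y. G t 0 x y * U 0 y \<partial>lborel)" if t: "0 < t" "t \<le> T" for t x
  proof (cases "x \<in> closure D")
    case True
    then have u: "u x t = (LINT y:D|lborel. g x t y 0 * u y 0)"
      using t by (simp add: u_0) (simp add: u_def forward_evolution_def)
    have "(\<integral>\<^sup>+ y. G t 0 x y * U 0 y \<partial>lborel) = (\<integral>\<^sup>+ y\<in>closure D. ennreal (g x t y 0 * u y 0) \<partial>lborel)"
      using True t T_pos u_pos g_pos by (intro nn_integral_cong) (auto simp: G_def U_def ennreal_mult less_imp_le split: split_indicator)
    also have "\<dots> = (\<integral>\<^sup>+ y\<in>D. ennreal (g x t y 0 * u y 0) \<partial>lborel)"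
      by (rule nn_integral_closure_convex[OF D])
    also have "\<dots> = ennreal (u x t)"
      using True t T_pos u u_pos[of x t] u_pos g_pos closure_subset[of D]
      by (subst nn_set_integral_eq_of_pos) (auto intro!: mult_nonneg_nonneg simp: less_imp_le subset_eq)
    finally show ?thesis using True t by (simp add: U_def)
  qed (auto simp: G_def U_def)
  show "V s x = (\<integral>\<^sup>+ y. G T s y x * V T y \<partial>lborel)" if s: "0 \<le> s" "s < T" for s x
  proof (cases "x \<in> closure D")
    case True
    \<comment> \<open>Duality rewrites the adjoint evolution as integration of \<open>g\<close> in
      its first argument, so that one kernel serves \<open>U\<close> and \<open>V\<close>.\<close>
    have "v x s = (LINT y:D|lborel. g' x s y T * v y T)"
      using s by (simp add: v_T) (simp add: v_def adjoint_evolution_def)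
    also have "\<dots> = (LINT y:D|lborel. g y T x s * v y T)"
      unfolding set_lebesgue_integral_def using True s closure_subset[of D]
      by (intro Bochner_Integration.integral_cong) (auto simp: duality subset_eq split: split_indicator)
    finally have v: "v x s = (LINT y:D|lborel. g y T x s * v y T)" .
    have "(\<integral>\<^sup>+ y. G T s y x * V T y \<partial>lborel) = (\<integral>\<^sup>+ y\<in>closure D. ennreal (g y T x s * v y T) \<partial>lborel)"
      using True s T_pos v_pos g_pos by (intro nn_integral_cong) (auto simp: G_def V_def ennreal_mult less_imp_le split: split_indicator)
    also have "\<dots> = (\<integral>\<^sup>+ y\<in>D. ennreal (g y T x s * v y T) \<partial>lborel)"
      by (rule nn_integral_closure_convex[OF D])
    also have "\<dots> = ennreal (v x s)"
      using True s T_pos v v_pos[of x s] v_pos g_pos closure_subset[of D]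
      by (subst nn_set_integral_eq_of_pos) (auto intro!: mult_nonneg_nonneg simp: less_imp_le subset_eq)
    finally show ?thesis using True s by (simp add: V_def)
  qed (auto simp: G_def V_def)
qed

section \<open>The transition densities as h-transforms of the Green function\<close>

lemma U_pos: "x \<in> closure D \<Longrightarrow> 0 \<le> t \<Longrightarrow> t \<le> T \<Longrightarrow> U t x \<noteq> 0 \<and> U t x \<noteq> \<infinity>"
  using u_pos[of x t] by (auto simp: U_def)

lemma V_pos: "x \<in> closure D \<Longrightarrow> 0 \<le> t \<Longrightarrow> t \<le> T \<Longrightarrow> V t x \<noteq> 0 \<and> V t x \<noteq> \<infinity>"
  using v_pos[of x t] by (auto simp: V_def)

lemma m_fwd_pos:
  "x \<in> closure D \<Longrightarrow> y \<in> closure D \<Longrightarrow> 0 \<le> s \<Longrightarrow> s < t \<Longrightarrow> t \<le> T \<Longrightarrow> 0 < m_fwd g' v x s y t"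
  unfolding m_fwd_def duality using g_pos[of y x s t] v_pos[of x s] v_pos[of y t] by simp

lemma m_bwd_pos:
  "x \<in> closure D \<Longrightarrow> y \<in> closure D \<Longrightarrow> 0 \<le> s \<Longrightarrow> s < t \<Longrightarrow> t \<le> T \<Longrightarrow> 0 < m_bwd g u x t y s"
  unfolding m_bwd_def using g_pos[of x y s t] u_pos[of x t] u_pos[of y s] by simp

lemma ennreal_m_fwd:
  assumes "x \<in> closure D" "y \<in> closure D" "0 \<le> s" "s < t" "t \<le> T"
  shows "ennreal (m_fwd g' v x s y t) = G t s y x * V t y / V s x"
  using assms g_pos[of y x s t] v_pos[of x s] v_pos[of y t]
  by (simp add: m_fwd_def duality G_def V_def divide_ennreal ennreal_mult[symmetric])

lemma ennreal_m_bwd: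
  assumes "x \<in> closure D" "y \<in> closure D" "0 \<le> s" "s < t" "t \<le> T"
  shows "ennreal (m_bwd g u x t y s) = G t s x y * U s y / U t x"
  using assms g_pos[of x y s t] u_pos[of x t] u_pos[of y s]
  by (simp add: m_bwd_def G_def U_def divide_ennreal ennreal_mult[symmetric])

text \<open>\<open>V\<close> is invariant under the kernel read from later to earlier times: the
  numerator integrates to the denominator \<open>V s x\<close>, which is positive and
  finite.\<close>

lemma m_fwd_total:
  assumes x: "x \<in> closure D" and st: "0 \<le> s" "s < t" "t \<le> T"
  shows "(\<integral>\<^sup>+ y\<in>closure D. ennreal (m_fwd g' v x s y t) \<partial>lborel) = 1"
proof -
  have "(\<integral>\<^sup>+ y\<in>closure D. ennreal (m_fwd g' v x s y t) \<partial>lborel) = (\<integral>\<^sup>+ y. G t s y x * V t y / V s x \<partial>lborel)"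
    using x st by (intro nn_integral_cong) (auto simp: ennreal_m_fwd G_def split: split_indicator)
  also have "\<dots> = (\<integral>\<^sup>+ y. G t s y x * V t y \<partial>lborel) / V s x"
    by (intro nn_integral_divide) measurable
  also have "\<dots> = 1"
    using V_pos[of x s] x st by (simp add: V_evolution ennreal_divide_self less_top[symmetric])
  finally show ?thesis .
qed

lemma m_bwd_total:
  assumes x: "x \<in> closure D" and st: "0 \<le> s" "s < t" "t \<le> T"
  shows "(\<integral>\<^sup>+ y\<in>closure D. ennreal (m_bwd g u x t y s) \<partial>lborel) = 1"
proof -
  have "(\<integral>\<^sup>+ y\<in>closure D. ennreal (m_bwd g u x t y s) \<partial>lborel) = (\<integral>\<^sup>+ y. G t s x y * U s y / U t x \<partial>lborel)"
    using x st by (intro nn_integral_cong) (auto simp: ennreal_m_bwd G_def split: split_indicator)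
  also have "\<dots> = (\<integral>\<^sup>+ y. G t s x y * U s y \<partial>lborel) / U t x"
    by (intro nn_integral_divide) measurable
  also have "\<dots> = 1"
    using U_pos[of x t] x st by (simp add: U_evolution ennreal_divide_self less_top[symmetric])
  finally show ?thesis .
qed

text \<open>The intermediate value of \<open>v\<close> cancels and the outer quotient does not
  involve \<open>z\<close>. What remains is the composition law of \<open>g\<close> with its end
  points exchanged by duality.\<close>

lemma m_fwd_composition:
  assumes xy: "x \<in> closure D" "y \<in> closure D" and st: "0 \<le> s" "s < r" "r < t" "t \<le> T"
  shows "m_fwd g' v x s y t = (LINT z:D|lborel. m_fwd g' v x s z r * m_fwd g' v z r y t)"
proof -
  have "m_fwd g' v x s z r * m_fwd g' v z r y t = (v y t / v x s) * (g y t z r * g z r x s)" if "z \<in> D" for z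
    using that xy st v_pos[of z r] closure_subset[of D] by (auto simp: m_fwd_def duality subset_eq)
  then have "(LINT z:D|lborel. m_fwd g' v x s z r * m_fwd g' v z r y t)
      = (LINT z:D|lborel. (v y t / v x s) * (g y t z r * g z r x s))"
    unfolding set_lebesgue_integral_def by (intro Bochner_Integration.integral_cong) (auto split: split_indicator)
  also have "\<dots> = (v y t / v x s) * (LINT z:D|lborel. g y t z r * g z r x s)"
    by (rule set_integral_mult_right)
  also have "\<dots> = m_fwd g' v x s y t"
    using xy st composition[of y x s r t] by (simp add: m_fwd_def duality)
  finally show ?thesis ..
qed

lemma m_bwd_composition:
  assumes xy: "x \<in> closure D" "y \<in> closure D" and st: "0 \<le> s" "s < r" "r < t" "t \<le> T"
  shows "m_bwd g u x t y s = (LINT z:D|lborel. m_bwd g u x t z r * m_bwd g u z r y s)"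
proof -
  have "m_bwd g u x t z r * m_bwd g u z r y s = (u y s / u x t) * (g x t z r * g z r y s)" if "z \<in> D" for z
    using that xy st u_pos[of z r] closure_subset[of D] by (auto simp: m_bwd_def subset_eq)
  then have "(LINT z:D|lborel. m_bwd g u x t z r * m_bwd g u z r y s)
      = (LINT z:D|lborel. (u y s / u x t) * (g x t z r * g z r y s))"
    unfolding set_lebesgue_integral_def by (intro Bochner_Integration.integral_cong) (auto split: split_indicator)
  also have "\<dots> = (u y s / u x t) * (LINT z:D|lborel. g x t z r * g z r y s)"
    by (rule set_integral_mult_right)
  also have "\<dots> = m_bwd g u x t y s"
    using xy st composition[of x y s r t] by (simp add: m_bwd_def)
  finally show ?thesis ..
qed

lemma m_fwd_borel:
  assumes st: "0 \<le> s" "s < t" "t \<le> T"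
  shows "(\<lambda>(x, y). m_fwd g' v x s y t) \<in> borel_measurable (restrict_space borel (closure D \<times> closure D))"
proof (rule borel_measurable_continuous_on_restrict)
  \<comment> \<open>The swap reflects duality: the first argument of \<open>m_fwd\<close> is the
    second space argument of \<open>g\<close>.\<close>
  have "continuous_on (closure D \<times> closure D) (\<lambda>p. (\<lambda>(x, y). g x t y s) (prod.swap p))"
    by (rule continuous_on_compose2[OF g_cont[OF st]]) (auto intro!: continuous_intros simp: prod.swap_def)
  moreover have "continuous_on (closure D \<times> closure D) (\<lambda>p. v (snd p) t)" "continuous_on (closure D \<times> closure D) (\<lambda>p. v (fst p) s)"
    using st by (auto intro!: continuous_on_compose2[OF v_cont] continuous_intros)
  ultimately have "continuous_on (closure D \<times> closure D) (\<lambda>p. (\<lambda>(x, y). g x t y s) (prod.swap p) * (v (snd p) t / v (fst p) s))"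
  proof (intro continuous_intros)
    show "\<forall>p\<in>closure D \<times> closure D. v (fst p) s \<noteq> 0"
      using v_pos[of _ s] st by (fastforce simp: mem_Times_iff)
  qed
  then show "continuous_on (closure D \<times> closure D) (\<lambda>(x, y). m_fwd g' v x s y t)"
    using st by (subst continuous_on_cong[OF refl]) (auto simp: m_fwd_def duality)
qed

lemma m_bwd_borel:
  assumes st: "0 \<le> s" "s < t" "t \<le> T"
  shows "(\<lambda>(x, y). m_bwd g u x t y s) \<in> borel_measurable (restrict_space borel (closure D \<times> closure D))"
proof (rule borel_measurable_continuous_on_restrict)
  have "continuous_on (closure D \<times> closure D) (\<lambda>p. u (snd p) s)" "continuous_on (closure D \<times> closure D) (\<lambda>p. u (fst p) t)"
    using st by (auto intro!: continuous_on_compose2[OF u_cont] continuous_intros)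
  with g_cont[OF st] have "continuous_on (closure D \<times> closure D) (\<lambda>p. (\<lambda>(x, y). g x t y s) p * (u (snd p) s / u (fst p) t))"
  proof (intro continuous_intros)
    show "\<forall>p\<in>closure D \<times> closure D. u (fst p) t \<noteq> 0"
      using u_pos[of _ t] st by (fastforce simp: mem_Times_iff)
  qed
  then show "continuous_on (closure D \<times> closure D) (\<lambda>(x, y). m_bwd g u x t y s)"
    by (subst continuous_on_cong[OF refl]) (auto simp: m_bwd_def)
qed

end

lemma ennreal_mult_quotient:
  "0 \<le> a \<Longrightarrow> 0 \<le> b \<Longrightarrow> 0 < c \<Longrightarrow> ennreal (a * (b / c)) = ennreal a * ennreal b / ennreal c"
  by (simp add: divide_ennreal ennreal_mult[symmetric])

section \<open>Path integrals of the transition and bridge densities\<close>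

context positive_green_functions
begin

text \<open>Common form of two h-transforms: \<open>h = v\<close> gives the forward transition
  densities, and \<open>h w r = g y T w r\<close> gives the bridge pinned at \<open>y\<close> at
  time T. After telescoping, the last value of \<open>h\<close> becomes the final weight and the
  first one a divisor. The conditions on \<open>h\<close> are confined to times up to
  \<open>t n\<close>, since the pinned kernel is meaningful only before T.\<close>

lemma weighted_path_integral:
  assumes chain: "\<And>i. i < n \<Longrightarrow> t i < t (Suc i)" and t: "0 \<le> t 0" "t n \<le> T"
    and E: "\<And>i. i \<in> {1..n} \<Longrightarrow> E i \<in> sets (borel_closure D)" and x: "x \<in> closure D"
    and h_pos: "\<And>w r. w \<in> closure D \<Longrightarrow> t 0 \<le> r \<Longrightarrow> r \<le> t n \<Longrightarrow> 0 < h w r"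
    and F: "\<And>r. F r \<in> borel_measurable borel"
    and F_eq: "\<And>w r. w \<in> closure D \<Longrightarrow> t 0 \<le> r \<Longrightarrow> r \<le> t n \<Longrightarrow> F r w = ennreal (h w r)"
  shows "(\<integral>\<^sup>+ z\<in>PiE {1..n} E. ennreal (\<Prod>i=1..n. g ((z(0 := x)) i) (t i) ((z(0 := x)) (i - 1)) (t (i - 1))
      * (h ((z(0 := x)) i) (t i) / h ((z(0 := x)) (i - 1)) (t (i - 1)))) \<partial>(Pi\<^sub>M {1..n} (\<lambda>_. lborel)))
    = backward F (map (\<lambda>i. (t i, E i)) [1..<Suc n]) (t 0) x / ennreal (h x (t 0))"
proof -
  have less: "t i < t j" if "i < j" "j \<le> n" for i j
    using chain_less[of 0 n t i j] chain that by auto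
  have range: "t 0 \<le> t i" "t i \<le> t n" if "i \<le> n" for i
    using less[of 0 i] less[of i n] that by (cases "i = 0"; cases "i = n"; force)+
  have E': "E i \<in> sets borel" "E i \<subseteq> closure D" if "i \<in> {1..n}" for i
    using E[OF that] by (auto simp: borel_closure_sets)
  let ?f = "\<lambda>z. (\<Prod>i=1..n. G (t i) (t (i - 1)) ((z(0 := x)) i) ((z(0 := x)) (i - 1)))
      * F (t n) ((z(0 := x)) n) * indicator (PiE {1..n} E) z"
  have eq: "ennreal (\<Prod>i=1..n. g ((z(0 := x)) i) (t i) ((z(0 := x)) (i - 1)) (t (i - 1))
      * (h ((z(0 := x)) i) (t i) / h ((z(0 := x)) (i - 1)) (t (i - 1))))
      = (\<Prod>i=1..n. G (t i) (t (i - 1)) ((z(0 := x)) i) ((z(0 := x)) (i - 1)))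
      * F (t n) ((z(0 := x)) n) / ennreal (h x (t 0))"
    if z: "z \<in> PiE {1..n} E" for z
  proof -
    define w where "w = z(0 := x)"
    have w: "w i \<in> closure D" if "i \<le> n" for i
      using z E'(2)[of i] x that by (cases "i = 0") (auto simp: w_def PiE_iff)
    have h: "0 < h (w i) (t i)" if "i \<le> n" for i
      using w[OF that] range[OF that] by (rule h_pos)
    have step: "0 \<le> t (i - 1) \<and> t (i - 1) < t i \<and> t i \<le> T" if "i \<in> {1..n}" for i
    proof -
      have "i - 1 \<le> n" "i - 1 < i" "i \<le> n" using that by auto
      then show ?thesis using less[of "i - 1" i] range[of i] range[of "i - 1"] t by linarith
    qed
    have g: "0 < g (w i) (t i) (w (i - 1)) (t (i - 1))" if "i \<in> {1..n}" for i
      using step[OF that] w[of i] w[of "i - 1"] that by (intro g_pos) auto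
    have "(\<Prod>i=1..n. g (w i) (t i) (w (i - 1)) (t (i - 1)) * (h (w i) (t i) / h (w (i - 1)) (t (i - 1))))
        = (\<Prod>i=1..n. g (w i) (t i) (w (i - 1)) (t (i - 1))) * (h (w n) (t n) / h (w 0) (t 0))"
      using h by (intro prod_telescope_up) (auto simp: less_imp_neq[symmetric])
    also have "ennreal \<dots> = ennreal (\<Prod>i=1..n. g (w i) (t i) (w (i - 1)) (t (i - 1))) * ennreal (h (w n) (t n)) / ennreal (h (w 0) (t 0))"
      using h[of n] h[of 0] g by (intro ennreal_mult_quotient prod_nonneg) (auto simp: less_imp_le)
    also have "ennreal (\<Prod>i=1..n. g (w i) (t i) (w (i - 1)) (t (i - 1))) = (\<Prod>i=1..n. G (t i) (t (i - 1)) (w i) (w (i - 1)))"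
      using g step w by (subst prod_ennreal[symmetric]) (auto intro!: prod.cong simp: G_def less_imp_le)
    also have "ennreal (h (w n) (t n)) = F (t n) (w n)"
      using w[of n] range[of n] by (simp add: F_eq)
    also have "w 0 = x" by (simp add: w_def)
    finally show ?thesis unfolding w_def .
  qed
  have "(\<integral>\<^sup>+ z\<in>PiE {1..n} E. ennreal (\<Prod>i=1..n. g ((z(0 := x)) i) (t i) ((z(0 := x)) (i - 1)) (t (i - 1))
      * (h ((z(0 := x)) i) (t i) / h ((z(0 := x)) (i - 1)) (t (i - 1)))) \<partial>(Pi\<^sub>M {1..n} (\<lambda>_. lborel)))
    = (\<integral>\<^sup>+ z. ?f z / ennreal (h x (t 0)) \<partial>(Pi\<^sub>M {1..n} (\<lambda>_. lborel)))"
  proof (rule nn_integral_cong)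
    \<comment> \<open>Off the product set both sides vanish through the indicator; inside it all
      coordinates lie in the closed domain and \<open>eq\<close> applies.\<close>
    fix z show "ennreal (\<Prod>i=1..n. g ((z(0 := x)) i) (t i) ((z(0 := x)) (i - 1)) (t (i - 1))
      * (h ((z(0 := x)) i) (t i) / h ((z(0 := x)) (i - 1)) (t (i - 1)))) * indicator (PiE {1..n} E) z = ?f z / ennreal (h x (t 0))"
      by (cases "z \<in> PiE {1..n} E")
        (simp_all only: eq indicator_simps mult_1_right mult_zero_right ennreal_zero_divide not_False_eq_True)
  qed
  also have "\<dots> = (\<integral>\<^sup>+ z. ?f z \<partial>(Pi\<^sub>M {1..n} (\<lambda>_. lborel))) / ennreal (h x (t 0))"
    by (intro nn_integral_divide backward_integrand_borel F E')
  also have "(\<integral>\<^sup>+ z. ?f z \<partial>(Pi\<^sub>M {1..n} (\<lambda>_. lborel))) = backward F (map (\<lambda>i. (t i, E i)) [1..<Suc n]) (t 0) x"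
    by (intro backward_PiM F E')
  finally show ?thesis .
qed

lemma m_fwd_path_integral:
  assumes chain: "\<And>i. i < n \<Longrightarrow> t i < t (Suc i)" and t: "0 \<le> t 0" "t n \<le> T"
    and E: "\<And>i. i \<in> {1..n} \<Longrightarrow> E i \<in> sets (borel_closure D)" and x: "x \<in> closure D"
  shows "(\<integral>\<^sup>+ z\<in>PiE {1..n} E. ennreal (\<Prod>i=1..n. m_fwd g' v ((z(0 := x)) (i - 1)) (t (i - 1)) ((z(0 := x)) i) (t i))
      \<partial>(Pi\<^sub>M {1..n} (\<lambda>_. lborel)))
    = backward V (map (\<lambda>i. (t i, E i)) [1..<Suc n]) (t 0) x / V (t 0) x"
proof -
  have less: "t i < t j" if "i < j" "j \<le> n" for i j
    using chain_less[of 0 n t i j] chain that by auto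
  have range: "t 0 \<le> t i" "t i \<le> t n" if "i \<le> n" for i
    using less[of 0 i] less[of i n] that by (cases "i = 0"; cases "i = n"; force)+
  have "(\<integral>\<^sup>+ z\<in>PiE {1..n} E. ennreal (\<Prod>i=1..n. m_fwd g' v ((z(0 := x)) (i - 1)) (t (i - 1)) ((z(0 := x)) i) (t i))
      \<partial>(Pi\<^sub>M {1..n} (\<lambda>_. lborel)))
    = (\<integral>\<^sup>+ z\<in>PiE {1..n} E. ennreal (\<Prod>i=1..n. g ((z(0 := x)) i) (t i) ((z(0 := x)) (i - 1)) (t (i - 1))
      * (v ((z(0 := x)) i) (t i) / v ((z(0 := x)) (i - 1)) (t (i - 1)))) \<partial>(Pi\<^sub>M {1..n} (\<lambda>_. lborel)))"
  proof (rule nn_integral_cong)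
    fix z
    have "m_fwd g' v ((z(0 := x)) (i - 1)) (t (i - 1)) ((z(0 := x)) i) (t i)
        = g ((z(0 := x)) i) (t i) ((z(0 := x)) (i - 1)) (t (i - 1))
          * (v ((z(0 := x)) i) (t i) / v ((z(0 := x)) (i - 1)) (t (i - 1)))"
      if z: "z \<in> PiE {1..n} E" and i: "i \<in> {1..n}" for i
    proof -
      have "(z(0 := x)) j \<in> closure D" if "j \<le> n" for j
        using z E[of j] x that by (cases "j = 0") (auto simp: PiE_iff borel_closure_sets)
      then have "(z(0 := x)) (i - 1) \<in> closure D" "(z(0 := x)) i \<in> closure D"
        using i by (auto simp del: fun_upd_apply)
      moreover have "i - 1 \<le> n" "i - 1 < i" "i \<le> n" using i by auto
      then have "0 \<le> t (i - 1)" "t (i - 1) < t i" "t i \<le> T"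
        using less[of "i - 1" i] range[of i] range[of "i - 1"] t by linarith+
      ultimately show ?thesis
        unfolding m_fwd_def by (subst duality) auto
    qed
    then have "(\<Prod>i=1..n. m_fwd g' v ((z(0 := x)) (i - 1)) (t (i - 1)) ((z(0 := x)) i) (t i))
      = (\<Prod>i=1..n. g ((z(0 := x)) i) (t i) ((z(0 := x)) (i - 1)) (t (i - 1))
        * (v ((z(0 := x)) i) (t i) / v ((z(0 := x)) (i - 1)) (t (i - 1))))" if "z \<in> PiE {1..n} E"
      using that by (intro prod.cong refl) blast
    then show "ennreal (\<Prod>i=1..n. m_fwd g' v ((z(0 := x)) (i - 1)) (t (i - 1)) ((z(0 := x)) i) (t i)) * indicator (PiE {1..n} E) z
      = ennreal (\<Prod>i=1..n. g ((z(0 := x)) i) (t i) ((z(0 := x)) (i - 1)) (t (i - 1))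
        * (v ((z(0 := x)) i) (t i) / v ((z(0 := x)) (i - 1)) (t (i - 1)))) * indicator (PiE {1..n} E) z"
      by (cases "z \<in> PiE {1..n} E") (simp_all only: indicator_simps mult_zero_right not_False_eq_True)
  qed
  also have "\<dots> = backward V (map (\<lambda>i. (t i, E i)) [1..<Suc n]) (t 0) x / ennreal (v x (t 0))"
    using chain t E x v_pos by (intro weighted_path_integral V_borel) (auto simp: V_def)
  finally show ?thesis
    using x t less[of 0 n] by (cases "n = 0") (auto simp: V_def)
qed

text \<open>The bridge density is an h-transform of \<open>g\<close> by the kernel pinned at the end
  point, so its product telescopes as well.\<close>

lemma p_bridge_path_integral:
  assumes chain: "\<And>i. i < n \<Longrightarrow> t i < t (Suc i)" and t: "0 \<le> t 0" "t n < T"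
    and E: "\<And>i. i \<in> {1..n} \<Longrightarrow> E i \<in> sets (borel_closure D)" and x: "x \<in> closure D" and y: "y \<in> closure D"
  shows "(\<integral>\<^sup>+ z\<in>PiE {1..n} E. ennreal (\<Prod>i=1..n. p_bridge g y T ((z(0 := x)) i) (t i) ((z(0 := x)) (i - 1)) (t (i - 1)))
      \<partial>(Pi\<^sub>M {1..n} (\<lambda>_. lborel)))
    = backward (\<lambda>r. G T r y) (map (\<lambda>i. (t i, E i)) [1..<Suc n]) (t 0) x / ennreal (g y T x (t 0))"
proof -
  have p: "p_bridge g y T w r w' r' = g w r w' r' * (g y T w r / g y T w' r')" for w r w' r'
    by (simp add: p_bridge_def)
  show ?thesis
    unfolding p
  proof (rule weighted_path_integral)
    show "G T r y \<in> borel_measurable borel" for r by measurable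
  qed (use chain t E x y g_pos in \<open>auto simp: G_def\<close>)
qed

text \<open>The quotients now have the earlier value of \<open>u\<close> above the later one and
  telescope downwards, leaving \<open>u\<close> at the first observation over \<open>u\<close> at
  the fixed end point, index \<open>Suc n\<close>.\<close>

lemma m_bwd_path_integral:
  assumes chain: "\<And>i. i \<in> {1..n} \<Longrightarrow> t i < t (Suc i)" and t: "0 \<le> t 1" "t (Suc n) \<le> T"
    and E: "\<And>i. i \<in> {1..n} \<Longrightarrow> E i \<in> sets (borel_closure D)" and y: "y \<in> closure D"
  shows "(\<integral>\<^sup>+ z\<in>PiE {1..n} E.
      ennreal (\<Prod>i=1..n. m_bwd g u ((z(Suc n := y)) (Suc i)) (t (Suc i)) ((z(Suc n := y)) i) (t i))
      \<partial>(Pi\<^sub>M {1..n} (\<lambda>_. lborel)))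
    = forward (rev (map (\<lambda>i. (t i, E i)) [1..<Suc n])) (t (Suc n)) y / U (t (Suc n)) y"
proof -
  have less: "t i < t j" if "1 \<le> i" "i < j" "j \<le> Suc n" for i j
    using chain_less[of 1 "Suc n" t i j] chain that by auto
  have range: "0 \<le> t i \<and> t i \<le> T" if "i \<in> {1..Suc n}" for i
    using less[of 1 i] less[of i "Suc n"] t that by (cases "i = 1"; cases "i = Suc n"; force)
  have E': "E i \<in> sets borel" "E i \<subseteq> closure D" if "i \<in> {1..n}" for i
    using E[OF that] by (auto simp: borel_closure_sets)
  let ?f = "\<lambda>z. U (t 1) ((z(Suc n := y)) 1)
      * (\<Prod>i=1..n. G (t (Suc i)) (t i) ((z(Suc n := y)) (Suc i)) ((z(Suc n := y)) i)) * indicator (PiE {1..n} E) z"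
  have eq: "ennreal (\<Prod>i=1..n. m_bwd g u ((z(Suc n := y)) (Suc i)) (t (Suc i)) ((z(Suc n := y)) i) (t i))
      = U (t 1) ((z(Suc n := y)) 1)
        * (\<Prod>i=1..n. G (t (Suc i)) (t i) ((z(Suc n := y)) (Suc i)) ((z(Suc n := y)) i)) / U (t (Suc n)) y"
    if z: "z \<in> PiE {1..n} E" for z
  proof -
    define w where "w = z(Suc n := y)"
    have w: "w i \<in> closure D" if "i \<in> {1..Suc n}" for i
      using z E'(2)[of i] y that by (cases "i = Suc n") (auto simp: w_def PiE_iff)
    have u: "0 < u (w i) (t i)" if "i \<in> {1..Suc n}" for i
      using w[OF that] range[OF that] by (intro u_pos) auto
    have g: "0 < g (w (Suc i)) (t (Suc i)) (w i) (t i)" if "i \<in> {1..n}" for i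
      using chain[OF that] range[of i] range[of "Suc i"] w[of i] w[of "Suc i"] that by (intro g_pos) auto
    have "(\<Prod>i=1..n. m_bwd g u (w (Suc i)) (t (Suc i)) (w i) (t i))
        = (\<Prod>i=1..n. g (w (Suc i)) (t (Suc i)) (w i) (t i)) * (u (w 1) (t 1) / u (w (Suc n)) (t (Suc n)))"
      unfolding m_bwd_def using u by (intro prod_telescope_down) (auto simp: less_imp_neq[symmetric])
    also have "ennreal \<dots> = ennreal (u (w 1) (t 1)) * ennreal (\<Prod>i=1..n. g (w (Suc i)) (t (Suc i)) (w i) (t i))
        / ennreal (u (w (Suc n)) (t (Suc n)))"
      using u[of 1] u[of "Suc n"] g
      by (subst ennreal_mult_quotient) (auto intro!: prod_nonneg simp: less_imp_le mult.commute)
    also have "ennreal (\<Prod>i=1..n. g (w (Suc i)) (t (Suc i)) (w i) (t i)) = (\<Prod>i=1..n. G (t (Suc i)) (t i) (w (Suc i)) (w i))"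
      using g chain range w by (subst prod_ennreal[symmetric]) (auto intro!: prod.cong simp: G_def less_imp_le)
    also have "ennreal (u (w 1) (t 1)) = U (t 1) (w 1)"
      using w[of 1] range[of 1] by (simp add: U_def)
    also have "ennreal (u (w (Suc n)) (t (Suc n))) = U (t (Suc n)) y"
      using range[of "Suc n"] y by (simp add: U_def w_def)
    finally show ?thesis unfolding w_def .
  qed
  have "(\<integral>\<^sup>+ z\<in>PiE {1..n} E.
      ennreal (\<Prod>i=1..n. m_bwd g u ((z(Suc n := y)) (Suc i)) (t (Suc i)) ((z(Suc n := y)) i) (t i))
      \<partial>(Pi\<^sub>M {1..n} (\<lambda>_. lborel)))
    = (\<integral>\<^sup>+ z. ?f z / U (t (Suc n)) y \<partial>(Pi\<^sub>M {1..n} (\<lambda>_. lborel)))"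
  proof (rule nn_integral_cong)
    fix z show "ennreal (\<Prod>i=1..n. m_bwd g u ((z(Suc n := y)) (Suc i)) (t (Suc i)) ((z(Suc n := y)) i) (t i))
      * indicator (PiE {1..n} E) z = ?f z / U (t (Suc n)) y"
      by (cases "z \<in> PiE {1..n} E")
        (simp_all only: eq indicator_simps mult_1_right mult_zero_right ennreal_zero_divide not_False_eq_True)
  qed
  also have "\<dots> = (\<integral>\<^sup>+ z. ?f z \<partial>(Pi\<^sub>M {1..n} (\<lambda>_. lborel))) / U (t (Suc n)) y"
    by (intro nn_integral_divide forward_integrand_borel E')
  also have "(\<integral>\<^sup>+ z. ?f z \<partial>(Pi\<^sub>M {1..n} (\<lambda>_. lborel)))
      = forward (rev (map (\<lambda>i. (t i, E i)) [1..<Suc n])) (t (Suc n)) y"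
    by (intro forward_PiM E')
  finally show ?thesis .
qed

end

section \<open>The Bernstein process\<close>

locale bernstein_green = positive_green_functions D T g g' \<phi> \<psi> u v
  for D :: "(real^'n) set" and T g g' \<phi> \<psi> u v +
  fixes M :: "'w measure" and Z :: "real \<Rightarrow> 'w \<Rightarrow> real^'n"
  assumes bernstein: "bernstein_process D T g (\<lambda>x y. \<phi> x * g y T x 0 * \<psi> y) M Z"
begin

text \<open>The factor \<open>g y T x 0\<close> of the end point density cancels against the divisor
  left by the bridge, which separates the data: one weight depends on \<open>x\<close>, the other on
  \<open>y\<close>.\<close>

lemma bridge_density:
  assumes chain: "\<And>i. i < n \<Longrightarrow> t i < t (Suc i)" and t: "t 0 = 0" "t n < T"
    and E: "\<And>i. i \<in> {1..n} \<Longrightarrow> E i \<in> sets (borel_closure D)" and x: "x \<in> closure D" and y: "y \<in> closure D"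
  shows "ennreal (\<phi> x * g y T x 0 * \<psi> y) * (\<integral>\<^sup>+ z\<in>PiE {1..n} E.
      ennreal (\<Prod>i=1..n. p_bridge g y T ((z(0 := x)) i) (t i) ((z(0 := x)) (i - 1)) (t (i - 1)))
      \<partial>(Pi\<^sub>M {1..n} (\<lambda>_. lborel)))
    = U 0 x * (V T y * backward (\<lambda>r. G T r y) (map (\<lambda>i. (t i, E i)) [1..<Suc n]) 0 x)"
proof -
  have "0 < g y T x 0" "0 < \<phi> x" "0 < \<psi> y"
    using g_pos[of y x 0 T] u_pos[of x 0] v_pos[of y T] T_pos x y by (auto simp: u_0 v_T)
  then have "ennreal (\<phi> x * g y T x 0 * \<psi> y) = U 0 x * V T y * ennreal (g y T x 0)"
    using x y T_pos by (simp add: U_def V_def u_0 v_T ennreal_mult[symmetric] mult_ac)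
  moreover have "c * ennreal (g y T x 0) * (b / ennreal (g y T x 0)) = c * b" for b c
    using \<open>0 < g y T x 0\<close> mult_divide_eq_ennreal[of "ennreal (g y T x 0)" "c * b"]
    by (simp add: ennreal_times_divide mult_ac)
  ultimately show ?thesis
    using p_bridge_path_integral[of n t E x y] chain t E x y by (simp add: mult.assoc)
qed

text \<open>Translates the given distributions, indexed by functions of time indices and integrated
  over pairs of end points, into the list recursion. The integral over the final end point is
  carried out by \<open>backward_terminal_integral\<close>.\<close>

sublocale bernstein_marginals "closure D" T G U V M Z
proof (intro bernstein_marginals.intro green_kernel_axioms bernstein_marginals_axioms.intro)
  show "prob_space M" using bernstein unfolding bernstein_process_def by blast
next
  show "Z t \<in> measurable M (borel_closure D)" if "t \<in> {0..T}" for t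
    using bernstein that unfolding bernstein_process_def by blast
next
  fix E0 E1 and ps :: "(real \<times> (real^'n) set) list"
  assume sorted: "sorted_wrt (<) (map fst ((0, E0) # ps @ [(T, E1)]))"
    and sets: "\<forall>(t, E)\<in>set ((0, E0) # ps @ [(T, E1)]). E \<in> sets (borel_closure D)"
  \<comment> \<open>The list without the observation at T, so that its indices 0 to \<open>n\<close>
    match those of the bridge formula, with time 0 at index 0.\<close>
  define L where "L = (0, E0) # ps"
  define n where "n = length ps"
  define t where "t i = fst (L ! i)" for i
  define E where "E i = snd (L ! i)" for i
  have t0: "t 0 = 0" and E0: "E 0 = E0" by (simp_all add: t_def E_def L_def)
  have L_map: "L = map (\<lambda>i. (t i, E i)) [0..<Suc n]"
    by (rule nth_equalityI) (auto simp: t_def E_def n_def L_def simp del: upt_Suc)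
  have ps: "ps = map (\<lambda>i. (t i, E i)) [1..<Suc n]"
    by (rule nth_equalityI) (auto simp: t_def E_def n_def L_def simp del: upt_Suc)
  have nth: "map fst (L @ [(T, E1)]) ! i = (if i \<le> n then t i else T)" if "i \<le> Suc n" for i
    using that by (auto simp: L_map nth_append simp del: upt_Suc)
  have less: "(if i \<le> n then t i else T) < (if j \<le> n then t j else T)" if "i < j" "j \<le> Suc n" for i j
    using sorted_wrt_nth_less[of "(<)" "map fst (L @ [(T, E1)])" i j] sorted that nth[of i] nth[of j]
    by (auto simp: L_def n_def)
  have chain: "t i < t (Suc i)" if "i < n" for i using less[of i "Suc i"] that by simp
  have tn: "t n < T" using less[of n "Suc n"] by simp
  have E: "E i \<in> sets (borel_closure D)" if "i \<le> n" for i
  proof -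
    have "L ! i \<in> set L" using that by (intro nth_mem) (simp add: L_def n_def)
    then show ?thesis using sets by (auto simp: E_def L_def split_beta)
  qed
  have E1: "E1 \<in> sets (borel_closure D)" using sets by simp
  have [measurable]: "E0 \<in> sets borel" "E1 \<in> sets borel" and cl: "E0 \<subseteq> closure D" "E1 \<subseteq> closure D"
    using E[of 0] E1 E0 by (auto simp: borel_closure_sets)
  have ps_sets: "\<forall>(t, E)\<in>set ps. E \<in> sets borel"
    using sets by (auto simp: borel_closure_sets)
  let ?b = "\<lambda>y. backward (\<lambda>r. G T r y) ps 0"
  have "(\<lambda>(y, x). ?b y x) \<in> borel_measurable (borel \<Otimes>\<^sub>M borel)"
    by (intro backward_param_borel G_borel ps_sets)
  from measurable_compose[OF measurable_pair_swap' this]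
  have [measurable]: "(\<lambda>(x, y). ?b y x) \<in> borel_measurable (lborel \<Otimes>\<^sub>M lborel)"
    by (simp add: split_beta cong: measurable_cong_sets)
  have [measurable]: "?b y \<in> borel_measurable borel" "(\<lambda>y. ?b y x) \<in> borel_measurable borel" for x y
    using measurable_compose[OF _ \<open>(\<lambda>(y, x). ?b y x) \<in> borel_measurable (borel \<Otimes>\<^sub>M borel)\<close>, of "\<lambda>x. (y, x)" borel]
      measurable_compose[OF _ \<open>(\<lambda>(y, x). ?b y x) \<in> borel_measurable (borel \<Otimes>\<^sub>M borel)\<close>, of "\<lambda>y. (y, x)" borel]
    by auto
  have "{\<omega>\<in>space M. \<forall>(t, E)\<in>set ((0, E0) # ps @ [(T, E1)]). Z t \<omega> \<in> E}
      = {\<omega>\<in>space M. \<forall>(t, E)\<in>set (L @ [(T, E1)]). Z t \<omega> \<in> E}"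
    by (simp add: L_def)
  also have "\<dots> = {\<omega>\<in>space M. (\<forall>i\<le>n. Z (t i) \<omega> \<in> E i) \<and> Z T \<omega> \<in> E1}"
    unfolding L_map by (auto simp del: upt_Suc)
  also have "emeasure M \<dots> = (\<integral>\<^sup>+ xy\<in>E 0 \<times> E1. (case xy of (x, y) \<Rightarrow> ennreal (\<phi> x * g y T x 0 * \<psi> y) *
        (\<integral>\<^sup>+ z\<in>PiE {1..n} E.
          ennreal (\<Prod>i=1..n. p_bridge g y T ((z(0 := x)) i) (t i) ((z(0 := x)) (i - 1)) (t (i - 1)))
          \<partial>(Pi\<^sub>M {1..n} (\<lambda>_. lborel)))) \<partial>lborel)"
    by (rule bernstein[unfolded bernstein_process_def, THEN conjunct2, THEN conjunct2, THEN conjunct1, rule_format])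
      (use t0 chain tn E E1 in auto)
  also have "\<dots> = (\<integral>\<^sup>+ xy. (case xy of (x, y) \<Rightarrow> U 0 x * indicator E0 x * (V T y * ?b y x * indicator E1 y)) \<partial>lborel)"
  proof (rule nn_integral_cong)
    fix xy :: "(real^'n) \<times> (real^'n)"
    obtain x y where xy: "xy = (x, y)" by force
    have "ennreal (\<phi> x * g y T x 0 * \<psi> y) * (\<integral>\<^sup>+ z\<in>PiE {1..n} E.
          ennreal (\<Prod>i=1..n. p_bridge g y T ((z(0 := x)) i) (t i) ((z(0 := x)) (i - 1)) (t (i - 1)))
          \<partial>(Pi\<^sub>M {1..n} (\<lambda>_. lborel))) = U 0 x * (V T y * ?b y x)" if "x \<in> E0" "y \<in> E1"
      unfolding ps by (rule bridge_density) (use chain t0 tn E cl that in auto)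
    then have "ennreal (\<phi> x * g y T x 0 * \<psi> y) * (\<integral>\<^sup>+ z\<in>PiE {1..n} E.
          ennreal (\<Prod>i=1..n. p_bridge g y T ((z(0 := x)) i) (t i) ((z(0 := x)) (i - 1)) (t (i - 1)))
          \<partial>(Pi\<^sub>M {1..n} (\<lambda>_. lborel))) * indicator (E 0 \<times> E1) (x, y)
      = U 0 x * indicator E0 x * (V T y * ?b y x * indicator E1 y)"
      unfolding E0 indicator_times by (cases "x \<in> E0"; cases "y \<in> E1")
        (simp_all only: indicator_simps mult_zero_right mult_zero_left mult_1_right not_False_eq_True fst_conv snd_conv)
    then show "(case xy of (x, y) \<Rightarrow> ennreal (\<phi> x * g y T x 0 * \<psi> y) * (\<integral>\<^sup>+ z\<in>PiE {1..n} E.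
          ennreal (\<Prod>i=1..n. p_bridge g y T ((z(0 := x)) i) (t i) ((z(0 := x)) (i - 1)) (t (i - 1)))
          \<partial>(Pi\<^sub>M {1..n} (\<lambda>_. lborel)))) * indicator (E 0 \<times> E1) xy
      = (case xy of (x, y) \<Rightarrow> U 0 x * indicator E0 x * (V T y * ?b y x * indicator E1 y))"
      unfolding xy prod.case .
  qed
  \<comment> \<open>Lebesgue measure on pairs is a product measure; the final end point becomes the
    inner variable.\<close>
  also have "\<dots> = (\<integral>\<^sup>+ x. (\<integral>\<^sup>+ y. U 0 x * indicator E0 x * (V T y * ?b y x * indicator E1 y) \<partial>lborel) \<partial>lborel)"
    unfolding lborel_prod[symmetric] by (subst lborel.nn_integral_fst[symmetric]) auto
  also have "\<dots> = (\<integral>\<^sup>+ x. U 0 x * indicator E0 x * backward V (ps @ [(T, E1)]) 0 x \<partial>lborel)"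
    by (simp add: nn_integral_cmult backward_terminal_integral ps_sets)
  also have "\<dots> = fdd ((0, E0) # ps @ [(T, E1)])"
    by (simp add: mult_ac)
  finally show "emeasure M {\<omega>\<in>space M. \<forall>(t, E)\<in>set ((0, E0) # ps @ [(T, E1)]). Z t \<omega> \<in> E}
    = fdd ((0, E0) # ps @ [(T, E1)])" .
qed

text \<open>Multiplying and dividing by \<open>V 0 x\<close> turns the initial weight
  \<open>U 0 x\<close> into the initial density, and the backward weight into the path integral of
  the forward transition densities.\<close>

lemma emeasure_forward:
  assumes t0: "t 0 = 0" and chain: "\<And>i. i < n \<Longrightarrow> t i < t (Suc i)" and tn: "t n < T"
    and E: "\<And>i. i \<le> n \<Longrightarrow> E i \<in> sets (borel_closure D)"
  shows "emeasure M {\<omega>\<in>space M. \<forall>i\<le>n. Z (t i) \<omega> \<in> E i} =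
    (\<integral>\<^sup>+ x\<in>E 0. ennreal (\<phi> x * v x 0) *
      (\<integral>\<^sup>+ z\<in>PiE {1..n} E.
        ennreal (\<Prod>i=1..n. m_fwd g' v ((z(0 := x)) (i - 1)) (t (i - 1)) ((z(0 := x)) i) (t i))
        \<partial>(Pi\<^sub>M {1..n} (\<lambda>_. lborel))) \<partial>lborel)"
proof -
  let ?ps = "map (\<lambda>i. (t i, E i)) [0..<Suc n]"
  have ps: "?ps = (0, E 0) # map (\<lambda>i. (t i, E i)) [1..<Suc n]"
    by (subst upt_conv_Cons) (simp_all add: t0 del: upt_Suc)
  have less: "t i < t j" if "i < j" "j \<le> n" for i j
    using chain_less[of 0 n t i j] chain that by auto
  have range: "0 \<le> t i \<and> t i \<le> T" if "i \<le> n" for i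
    using less[of 0 i] less[of i n] that tn t0 by (cases "i = 0"; cases "i = n"; force)
  have "{\<omega>\<in>space M. \<forall>i\<le>n. Z (t i) \<omega> \<in> E i} = {\<omega>\<in>space M. \<forall>(t, E)\<in>set ?ps. Z t \<omega> \<in> E}"
    by (auto simp del: upt_Suc)
  also have "emeasure M \<dots> = fdd ?ps"
  proof (rule emeasure_cylinder)
    show "sorted_wrt (<) (map fst ?ps)"
      using sorted_wrt_chain[of 0 n t] chain by (simp add: comp_def del: upt_Suc)
    show "\<forall>(t, E)\<in>set ?ps. 0 \<le> t \<and> t \<le> T \<and> E \<in> sets (borel_closure D)"
      using range E by (auto simp del: upt_Suc)
  qed simp
  also have "\<dots> = (\<integral>\<^sup>+ x\<in>E 0. ennreal (\<phi> x * v x 0) *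
      (\<integral>\<^sup>+ z\<in>PiE {1..n} E.
        ennreal (\<Prod>i=1..n. m_fwd g' v ((z(0 := x)) (i - 1)) (t (i - 1)) ((z(0 := x)) i) (t i))
        \<partial>(Pi\<^sub>M {1..n} (\<lambda>_. lborel))) \<partial>lborel)"
    unfolding ps fdd.simps
  proof (rule nn_integral_cong)
    fix x
    have "U 0 x * b = ennreal (\<phi> x * v x 0) * (b / V 0 x)" if "x \<in> E 0" for b
    proof -
      have x: "x \<in> closure D" using that E[of 0] by (auto simp: borel_closure_sets)
      have "ennreal (\<phi> x * v x 0) = U 0 x * V 0 x"
        using x T_pos u_pos[of x 0] v_pos[of x 0] by (simp add: U_def V_def u_0 ennreal_mult less_imp_le)
      then show ?thesis
        using V_pos[OF x, of 0] T_pos mult_divide_eq_ennreal[of "V 0 x" "U 0 x * b"]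
        by (simp add: ennreal_times_divide mult_ac)
    qed
    moreover have "(\<integral>\<^sup>+ z\<in>PiE {1..n} E.
        ennreal (\<Prod>i=1..n. m_fwd g' v ((z(0 := x)) (i - 1)) (t (i - 1)) ((z(0 := x)) i) (t i))
        \<partial>(Pi\<^sub>M {1..n} (\<lambda>_. lborel))) = backward V (map (\<lambda>i. (t i, E i)) [1..<Suc n]) 0 x / V 0 x" if "x \<in> E 0"
    proof (rule m_fwd_path_integral[of n t E x, unfolded t0])
      show "x \<in> closure D" using that E[of 0] by (auto simp: borel_closure_sets)
    qed (use chain tn E in auto)
    ultimately show "U 0 x * backward V (map (\<lambda>i. (t i, E i)) [1..<Suc n]) 0 x * indicator (E 0) x
      = ennreal (\<phi> x * v x 0) * (\<integral>\<^sup>+ z\<in>PiE {1..n} E.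
        ennreal (\<Prod>i=1..n. m_fwd g' v ((z(0 := x)) (i - 1)) (t (i - 1)) ((z(0 := x)) i) (t i))
        \<partial>(Pi\<^sub>M {1..n} (\<lambda>_. lborel))) * indicator (E 0) x"
      by (cases "x \<in> E 0") (simp_all only: indicator_simps mult_zero_right not_False_eq_True)
  qed
  finally show ?thesis .
qed

text \<open>The same normalisation from the other end, by \<open>U T y\<close>, after cutting the
  cylinder at T.\<close>

lemma emeasure_backward:
  assumes T: "t (Suc n) = T" and chain: "\<And>i. i \<in> {1..n} \<Longrightarrow> t i < t (Suc i)" and t1: "0 < t 1"
    and E: "\<And>i. i \<in> {1..n} \<Longrightarrow> E i \<in> sets (borel_closure D)" and E1: "E1 \<in> sets (borel_closure D)"
  shows "emeasure M {\<omega>\<in>space M. Z T \<omega> \<in> E1 \<and> (\<forall>i\<in>{1..n}. Z (t i) \<omega> \<in> E i)} =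
    (\<integral>\<^sup>+ y\<in>E1. ennreal (\<psi> y * u y T) *
      (\<integral>\<^sup>+ z\<in>PiE {1..n} E.
        ennreal (\<Prod>i=1..n. m_bwd g u ((z(Suc n := y)) (Suc i)) (t (Suc i)) ((z(Suc n := y)) i) (t i))
        \<partial>(Pi\<^sub>M {1..n} (\<lambda>_. lborel))) \<partial>lborel)"
proof -
  let ?ps = "map (\<lambda>i. (t i, E i)) [1..<Suc n]"
  have less: "t i < t j" if "1 \<le> i" "i < j" "j \<le> Suc n" for i j
    using chain_less[of 1 "Suc n" t i j] chain that by auto
  have range: "0 \<le> t i \<and> t i \<le> T" if "i \<in> {1..Suc n}" for i
    using less[of 1 i] less[of i "Suc n"] T t1 that by (cases "i = 1"; cases "i = Suc n"; force)
  have "{\<omega>\<in>space M. Z T \<omega> \<in> E1 \<and> (\<forall>i\<in>{1..n}. Z (t i) \<omega> \<in> E i)}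
      = {\<omega>\<in>space M. \<forall>(t, E)\<in>set (?ps @ (T, E1) # []). Z t \<omega> \<in> E}"
    by (auto simp del: upt_Suc)
  also have "emeasure M \<dots> = fdd (?ps @ (T, E1) # [])"
  proof (rule emeasure_cylinder)
    have "map fst (?ps @ (T, E1) # []) = map t [1..<Suc (Suc n)]"
      using T by (simp add: comp_def)
    then show "sorted_wrt (<) (map fst (?ps @ (T, E1) # []))"
      using sorted_wrt_chain[of 1 "Suc n" t] chain by (simp del: upt_Suc)
    show "\<forall>(t, E)\<in>set (?ps @ (T, E1) # []). 0 \<le> t \<and> t \<le> T \<and> E \<in> sets (borel_closure D)"
      using range E E1 T_pos by (auto simp del: upt_Suc)
  qed simp
  \<comment> \<open>At the cut T no future is left, and its weight is \<open>V T\<close>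
    alone.\<close>
  also have "\<dots> = (\<integral>\<^sup>+ y\<in>E1. (forward (rev ?ps) T y * V T y) \<partial>lborel)"
    using E E1 by (subst fdd_split) (auto simp: borel_closure_sets simp del: upt_Suc)
  also have "\<dots> = (\<integral>\<^sup>+ y\<in>E1. ennreal (\<psi> y * u y T) *
      (\<integral>\<^sup>+ z\<in>PiE {1..n} E.
        ennreal (\<Prod>i=1..n. m_bwd g u ((z(Suc n := y)) (Suc i)) (t (Suc i)) ((z(Suc n := y)) i) (t i))
        \<partial>(Pi\<^sub>M {1..n} (\<lambda>_. lborel))) \<partial>lborel)"
  proof (rule nn_integral_cong)
    fix y
    have "b * V T y = ennreal (\<psi> y * u y T) * (b / U T y)" if "y \<in> E1" for b
    proof -
      have y: "y \<in> closure D" using that E1 by (auto simp: borel_closure_sets)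
      have "ennreal (\<psi> y * u y T) = U T y * V T y"
        using y T_pos u_pos[of y T] v_pos[of y T] by (simp add: U_def V_def v_T ennreal_mult less_imp_le mult.commute)
      then show ?thesis
        using U_pos[OF y, of T] T_pos mult_divide_eq_ennreal[of "U T y" "V T y * b"]
        by (simp add: ennreal_times_divide mult_ac)
    qed
    moreover have "(\<integral>\<^sup>+ z\<in>PiE {1..n} E.
        ennreal (\<Prod>i=1..n. m_bwd g u ((z(Suc n := y)) (Suc i)) (t (Suc i)) ((z(Suc n := y)) i) (t i))
        \<partial>(Pi\<^sub>M {1..n} (\<lambda>_. lborel))) = forward (rev ?ps) T y / U T y" if "y \<in> E1"
    proof (rule m_bwd_path_integral[of n t E y, unfolded T])
      show "y \<in> closure D" using that E1 by (auto simp: borel_closure_sets)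
    qed (use chain t1 E in auto)
    ultimately show "forward (rev ?ps) T y * V T y * indicator E1 y
      = ennreal (\<psi> y * u y T) * (\<integral>\<^sup>+ z\<in>PiE {1..n} E.
        ennreal (\<Prod>i=1..n. m_bwd g u ((z(Suc n := y)) (Suc i)) (t (Suc i)) ((z(Suc n := y)) i) (t i))
        \<partial>(Pi\<^sub>M {1..n} (\<lambda>_. lborel))) * indicator E1 y"
      by (cases "y \<in> E1") (simp_all only: indicator_simps mult_zero_right not_False_eq_True)
  qed
  finally show ?thesis .
qed

lemma emeasure_one:
  assumes "t \<in> {0..T}" "E \<in> sets (borel_closure D)"
  shows "emeasure M {\<omega>\<in>space M. Z t \<omega> \<in> E} = (\<integral>\<^sup>+ x\<in>E. ennreal (u x t * v x t) \<partial>lborel)"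
  unfolding emeasure_marginal[OF assms] using assms u_pos v_pos
  by (intro nn_integral_cong)
    (auto simp: U_def V_def ennreal_mult less_imp_le borel_closure_sets subset_eq split: split_indicator)

text \<open>Reconciles the zero-extended kernel on the closed domain, used for conditional
  expectations, with the integral over D in the Markov properties.\<close>

lemma kernel_integral_closure:
  assumes q: "(\<lambda>(x, y). q x y) \<in> borel_measurable (restrict_space borel (closure D \<times> closure D))"
    and h: "bounded_borel D h" and x: "x \<in> closure D"
  shows "(LINT y:closure D|lborel. (if x \<in> closure D \<and> y \<in> closure D then q x y else 0) * h y)
    = (LINT y:D|lborel. q x y * (h y :: real))"
proof -
  have "(\<lambda>y. (x, y)) \<in> measurable (borel_closure D) (restrict_space borel (closure D \<times> closure D))"
    using x by (intro measurable_restrict_space2 measurable_restrict_space1) (auto simp: space_restrict_space)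
  from measurable_compose[OF this q] h
  have "(\<lambda>y. q x y * h y) \<in> borel_measurable (borel_closure D)"
    unfolding bounded_borel_def by (intro borel_measurable_times) auto
  note meas = this
  have "(LINT y:closure D|lborel. (if x \<in> closure D \<and> y \<in> closure D then q x y else 0) * h y)
      = (LINT y:closure D|lborel. q x y * h y)"
    unfolding set_lebesgue_integral_def using x
    by (intro Bochner_Integration.integral_cong) (auto split: split_indicator)
  with set_integral_closure_convex[OF D meas] show ?thesis by simp
qed

lemma forward_markov_process: "forward_markov D T M Z (m_fwd g' v) (\<lambda>x. \<phi> x * v x 0)"
  unfolding forward_markov_def
proof (intro conjI allI impI ballI)
  fix s t assume st: "0 \<le> s" "s < t" "t \<le> T"
  show "(\<lambda>(x, y). m_fwd g' v x s y t) \<in> borel_measurable (restrict_space borel (closure D \<times> closure D))"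
    using st by (rule m_fwd_borel)
  show "0 \<le> m_fwd g' v x s y t" if "x \<in> closure D" "y \<in> closure D" for x y
    using m_fwd_pos[OF that st] by simp
  show "(\<integral>\<^sup>+ y\<in>D. ennreal (m_fwd g' v x s y t) \<partial>lborel) = 1" if "x \<in> closure D" for x
    using m_fwd_total[OF that st] nn_integral_closure_convex[OF D] by metis
next
  show "m_fwd g' v x s y t = (LINT z:D|lborel. m_fwd g' v x s z r * m_fwd g' v z r y t)"
    if "0 \<le> s" "s < r" "r < t" "t \<le> T" "x \<in> closure D" "y \<in> closure D" for s r t x y
    using that by (intro m_fwd_composition)
next
  show "emeasure M {\<omega>\<in>space M. Z 0 \<omega> \<in> E} = (\<integral>\<^sup>+ x\<in>E. ennreal (\<phi> x * v x 0) \<partial>lborel)"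
    if "E \<in> sets (borel_closure D)" for E
    using emeasure_one[of 0 E] that T_pos by (simp add: u_0)
next
  fix s t h assume st: "0 \<le> s" "s < t" "t \<le> T" and h: "bounded_borel D h"
  \<comment> \<open>Conditioning on the times up to \<open>s\<close>: the numerator
    \<open>G t s y x * V t y\<close> comes from the cylinder identity, and \<open>V s\<close>
    normalises it.\<close>
  interpret transition_kernel M D Z "{0..s}" s t "\<lambda>x y. if x \<in> closure D \<and> y \<in> closure D then m_fwd g' v x s y t else 0"
  proof (rule transition_kernel_h_transform[where W = "V s" and \<kappa> = "\<lambda>x y. G t s y x * V t y"])
    show "prob_space M" by (rule prob_space_axioms)
    show "Z \<tau> \<in> measurable M (borel_closure D)" if "\<tau> \<in> insert t {0..s}" for \<tau>
      using that st by (intro Z_measurable) auto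
    show "\<exists>\<rho>\<in>borel_measurable borel. \<forall>C\<in>sets (borel_closure D). \<forall>B\<in>sets (borel_closure D).
        emeasure M {\<omega>\<in>space M. (\<forall>\<tau>\<in>J. Z \<tau> \<omega> \<in> E \<tau>) \<and> Z s \<omega> \<in> C \<and> Z t \<omega> \<in> B}
        = (\<integral>\<^sup>+ x\<in>C. (\<rho> x * (\<integral>\<^sup>+ y\<in>B. (G t s y x * V t y) \<partial>lborel)) \<partial>lborel)"
      if "finite J" "J \<subseteq> {0..s} - {s}" "\<And>\<tau>. \<tau> \<in> J \<Longrightarrow> E \<tau> \<in> sets (borel_closure D)" for J E
      using that st by (intro emeasure_past_present_next) auto
  qed (use st m_fwd_borel m_fwd_pos V_pos ennreal_m_fwd m_fwd_total in \<open>auto simp: less_imp_le\<close>)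
  show "AE \<omega> in M.
      real_cond_exp M (gen_algebra M D Z {0..s}) (\<lambda>\<omega>. h (Z t \<omega>)) \<omega>
        = real_cond_exp M (gen_algebra M D Z {s}) (\<lambda>\<omega>. h (Z t \<omega>)) \<omega> \<and>
      real_cond_exp M (gen_algebra M D Z {0..s}) (\<lambda>\<omega>. h (Z t \<omega>)) \<omega>
        = (LINT y:D|lborel. m_fwd g' v (Z s \<omega>) s y t * h y)"
    using cond_exp_kernel(1)[OF h] cond_exp_kernel(2)[OF h] AE_space
    by eventually_elim (use kernel_integral_closure[OF m_fwd_borel[OF st] h] Z_in[of s] st in auto)
qed

lemma backward_markov_process: "backward_markov D T M Z (m_bwd g u) (\<lambda>y. \<psi> y * u y T)"
  unfolding backward_markov_def
proof (intro conjI allI impI ballI)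
  fix s t assume st: "0 \<le> s" "s < t" "t \<le> T"
  show "(\<lambda>(x, y). m_bwd g u x t y s) \<in> borel_measurable (restrict_space borel (closure D \<times> closure D))"
    using st by (rule m_bwd_borel)
  show "0 \<le> m_bwd g u x t y s" if "x \<in> closure D" "y \<in> closure D" for x y
    using m_bwd_pos[OF that st] by simp
  show "(\<integral>\<^sup>+ y\<in>D. ennreal (m_bwd g u x t y s) \<partial>lborel) = 1" if "x \<in> closure D" for x
    using m_bwd_total[OF that st] nn_integral_closure_convex[OF D] by metis
next
  show "m_bwd g u x t y s = (LINT z:D|lborel. m_bwd g u x t z r * m_bwd g u z r y s)"
    if "0 \<le> s" "s < r" "r < t" "t \<le> T" "x \<in> closure D" "y \<in> closure D" for s r t x y
    using that by (intro m_bwd_composition)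
next
  show "emeasure M {\<omega>\<in>space M. Z T \<omega> \<in> E} = (\<integral>\<^sup>+ x\<in>E. ennreal (\<psi> x * u x T) \<partial>lborel)"
    if "E \<in> sets (borel_closure D)" for E
    using emeasure_one[of T E] that T_pos by (simp add: v_T mult.commute)
next
  fix s t h assume st: "0 \<le> s" "s < t" "t \<le> T" and h: "bounded_borel D h"
  \<comment> \<open>The two times change roles: the condition is on times from \<open>t\<close> on,
    \<open>t\<close> carries the information and the earlier \<open>s\<close> is predicted, with
    \<open>U t\<close> as normalisation.\<close>
  interpret transition_kernel M D Z "{t..T}" t s "\<lambda>x y. if x \<in> closure D \<and> y \<in> closure D then m_bwd g u x t y s else 0"
  proof (rule transition_kernel_h_transform[where W = "U t" and \<kappa> = "\<lambda>x y. G t s x y * U s y"])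
    show "prob_space M" by (rule prob_space_axioms)
    show "Z \<tau> \<in> measurable M (borel_closure D)" if "\<tau> \<in> insert s {t..T}" for \<tau>
      using that st by (intro Z_measurable) auto
    show "\<exists>\<rho>\<in>borel_measurable borel. \<forall>C\<in>sets (borel_closure D). \<forall>B\<in>sets (borel_closure D).
        emeasure M {\<omega>\<in>space M. (\<forall>\<tau>\<in>J. Z \<tau> \<omega> \<in> E \<tau>) \<and> Z t \<omega> \<in> C \<and> Z s \<omega> \<in> B}
        = (\<integral>\<^sup>+ x\<in>C. (\<rho> x * (\<integral>\<^sup>+ y\<in>B. (G t s x y * U s y) \<partial>lborel)) \<partial>lborel)"
      if "finite J" "J \<subseteq> {t..T} - {t}" "\<And>\<tau>. \<tau> \<in> J \<Longrightarrow> E \<tau> \<in> sets (borel_closure D)" for J E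
      using that st by (intro emeasure_future_present_previous) auto
  qed (use st m_bwd_borel m_bwd_pos U_pos ennreal_m_bwd m_bwd_total in \<open>auto simp: less_imp_le\<close>)
  show "AE \<omega> in M.
      real_cond_exp M (gen_algebra M D Z {t..T}) (\<lambda>\<omega>. h (Z s \<omega>)) \<omega>
        = real_cond_exp M (gen_algebra M D Z {t}) (\<lambda>\<omega>. h (Z s \<omega>)) \<omega> \<and>
      real_cond_exp M (gen_algebra M D Z {t..T}) (\<lambda>\<omega>. h (Z s \<omega>)) \<omega>
        = (LINT y:D|lborel. m_bwd g u (Z t \<omega>) t y s * h y)"
    using cond_exp_kernel(1)[OF h] cond_exp_kernel(2)[OF h] AE_space
    by eventually_elim (use kernel_integral_closure[OF m_bwd_borel[OF st] h] Z_in[of t] st in auto)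
qed

end

theorem theorem2:
  fixes T \<alpha> :: real
    and D :: "(real^'n) set"
    and k :: "real^'n \<Rightarrow> real \<Rightarrow> real^'n^'n"
    and l :: "real^'n \<Rightarrow> real \<Rightarrow> real^'n"
    and V :: "real^'n \<Rightarrow> real \<Rightarrow> real"
    and \<phi> \<psi> :: "real^'n \<Rightarrow> real"
    and g g' :: "real^'n \<Rightarrow> real \<Rightarrow> real^'n \<Rightarrow> real \<Rightarrow> real"
    and u v :: "real^'n \<Rightarrow> real \<Rightarrow> real"
    and \<mu> :: "real^'n \<Rightarrow> real^'n \<Rightarrow> real"
    and \<mu>\<^sub>0 \<mu>\<^sub>T :: "real^'n \<Rightarrow> real"
    and M :: "'w measure"
    and Z :: "real \<Rightarrow> 'w \<Rightarrow> real^'n"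
  assumes "0 < T"
    and "0 < \<alpha>" "\<alpha> < 1"
    and "bounded D" "open D" "convex D" "smooth_boundary \<alpha> D"
    and "hyp_K \<alpha> D T k"
    and "hyp_L \<alpha> D T l"
    and "hyp_V \<alpha> D T V"
    and "hyp_IF \<alpha> D T k \<phi> \<psi>"
    and "green_functions D T k l V g g'"
    and u_def: "u = forward_evolution D g 0 \<phi>"
    and v_def: "v = adjoint_evolution D g' T \<psi>"
    and "\<forall>x\<in>closure D. \<phi> x > 0" "\<forall>x\<in>closure D. \<psi> x > 0"
    and "\<forall>x\<in>closure D. \<forall>t\<in>{0..T}. u x t > 0" "\<forall>x\<in>closure D. \<forall>t\<in>{0..T}. v x t > 0"
    and "\<forall>x\<in>closure D. \<forall>y\<in>closure D. \<forall>s t. 0 \<le> s \<longrightarrow> s < t \<longrightarrow> t \<le> T \<longrightarrow>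
          g x t y s > 0 \<and> g' x s y t > 0"
    and "continuous_on {(x, t, y, s). x \<in> closure D \<and> y \<in> closure D \<and> 0 \<le> s \<and> s < t \<and> t \<le> T}
          (\<lambda>(x, t, y, s). g x t y s)"
    and "continuous_on {(x, s, y, t). x \<in> closure D \<and> y \<in> closure D \<and> 0 \<le> s \<and> s < t \<and> t \<le> T}
          (\<lambda>(x, s, y, t). g' x s y t)"
    and \<mu>_def: "\<mu> = (\<lambda>x y. \<phi> x * g y T x 0 * \<psi> y)"
    and "(LINT xy:D \<times> D|lborel. \<mu> (fst xy) (snd xy)) = 1"
    and "bernstein_process D T g \<mu> M Z"
    and \<mu>0_def: "\<mu>\<^sub>0 = (\<lambda>x. \<phi> x * v x 0)"
    and \<mu>T_def: "\<mu>\<^sub>T = (\<lambda>y. \<psi> y * u y T)"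
  shows
    "(\<forall>n t E. t 0 = 0 \<longrightarrow> (\<forall>i<n. t i < t (Suc i)) \<longrightarrow> t n < T \<longrightarrow>
        (\<forall>i\<le>n. E i \<in> sets (borel_closure D)) \<longrightarrow>
        emeasure M {\<omega>\<in>space M. \<forall>i\<le>n. Z (t i) \<omega> \<in> E i} =
        (\<integral>\<^sup>+ x\<in>E 0. ennreal (\<mu>\<^sub>0 x) *
          (\<integral>\<^sup>+ z\<in>PiE {1..n} E.
            ennreal (\<Prod>i=1..n. m_fwd g' v ((z(0 := x)) (i - 1)) (t (i - 1)) ((z(0 := x)) i) (t i))
            \<partial>(Pi\<^sub>M {1..n} (\<lambda>_. lborel))) \<partial>lborel))
     \<and> forward_markov D T M Z (m_fwd g' v) \<mu>\<^sub>0
     \<and> (\<forall>(n::nat) t E E\<^sub>T. t (Suc n) = T \<longrightarrow> (\<forall>i\<in>{1..n}. t i < t (Suc i)) \<longrightarrow> 0 < t 1 \<longrightarrow>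
        (\<forall>i\<in>{1..n}. E i \<in> sets (borel_closure D)) \<longrightarrow> E\<^sub>T \<in> sets (borel_closure D) \<longrightarrow>
        emeasure M {\<omega>\<in>space M. Z T \<omega> \<in> E\<^sub>T \<and> (\<forall>i\<in>{1..n}. Z (t i) \<omega> \<in> E i)} =
        (\<integral>\<^sup>+ y\<in>E\<^sub>T. ennreal (\<mu>\<^sub>T y) *
          (\<integral>\<^sup>+ z\<in>PiE {1..n} E.
            ennreal (\<Prod>i=1..n. m_bwd g u ((z(Suc n := y)) (Suc i)) (t (Suc i)) ((z(Suc n := y)) i) (t i))
            \<partial>(Pi\<^sub>M {1..n} (\<lambda>_. lborel))) \<partial>lborel))
     \<and> backward_markov D T M Z (m_bwd g u) \<mu>\<^sub>T
     \<and> (\<forall>t\<in>{0..T}. \<forall>E\<in>sets (borel_closure D).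
        emeasure M {\<omega>\<in>space M. Z t \<omega> \<in> E} = (\<integral>\<^sup>+ x\<in>E. ennreal (u x t * v x t) \<partial>lborel))"
proof -
  note pos_data = assms(17,18) and g_pos = assms(19) and g_cont = assms(20)
  have green: "green_functions D T k l V g g'" and IF: "hyp_IF \<alpha> D T k \<phi> \<psi>"
    and "open D" "convex D" "0 < T" by fact+
  \<comment> \<open>The data are differentiable up to the boundary, hence continuous, so the Green
    functions produce classical solutions from them. These are continuous on the whole closed
    cylinder, end times included.\<close>
  have cont: "continuous_on (closure D) \<phi>" "continuous_on (closure D) \<psi>"
    using IF unfolding hyp_IF_def holder2_def by (auto intro: differentiable_imp_continuous_on)
  have "forward_solution D T k l V 0 \<phi> u"
    using green cont \<open>0 < T\<close> unfolding green_functions_def u_def by blast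
  then have u_cont: "continuous_on (closure D \<times> {0..T}) (\<lambda>(x, t). u x t)"
    unfolding forward_solution_def by blast
  have "adjoint_solution D k l V T \<psi> v"
    using green cont \<open>0 < T\<close> unfolding green_functions_def v_def by blast
  then have v_cont: "continuous_on (closure D \<times> {0..T}) (\<lambda>(x, t). v x t)"
    unfolding adjoint_solution_def by blast
  have slice: "continuous_on (closure D) (\<lambda>x. w x t)"
    if "continuous_on (closure D \<times> {0..T}) (\<lambda>(x, t). w x t)" "0 \<le> t" "t \<le> T"
    for w :: "real^'n \<Rightarrow> real \<Rightarrow> real" and t
  proof -
    have "continuous_on (closure D) (\<lambda>x. case (x, t) of (x, t) \<Rightarrow> w x t)"
    proof (rule continuous_on_compose2[OF that(1)])
      show "continuous_on (closure D) (\<lambda>x. (x, t))"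
        by (intro continuous_intros)
      show "(\<lambda>x. (x, t)) ` closure D \<subseteq> closure D \<times> {0..T}"
        using that(2,3) by auto
    qed
    then show ?thesis by simp
  qed
  interpret bernstein_green D T g g' \<phi> \<psi> u v M Z
  proof
    show "0 < T" "open D" "convex D" by fact+
    show "g' x s y t = g y t x s"
      if "x \<in> closure D" "y \<in> closure D" "0 \<le> s" "s < t" "t \<le> T" for x y s t
      using green that unfolding green_functions_def by blast
    show "g x t y s = (LINT z:D|lborel. g x t z r * g z r y s)"
      if "x \<in> closure D" "y \<in> closure D" "0 \<le> s" "s < r" "r < t" "t \<le> T" for x y s r t
      using green that unfolding green_functions_def by blast
    show "0 < g x t y s"
      if "x \<in> closure D" "y \<in> closure D" "0 \<le> s" "s < t" "t \<le> T" for x y s t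
      using g_pos that by blast
    show "continuous_on (closure D \<times> closure D) (\<lambda>(x, y). g x t y s)"
      if "0 \<le> s" "s < t" "t \<le> T" for s t
    proof -
      have "continuous_on (closure D \<times> closure D)
        (\<lambda>p. case (fst p, t, snd p, s) of (x, t, y, s) \<Rightarrow> g x t y s)"
      proof (rule continuous_on_compose2[OF g_cont])
        show "continuous_on (closure D \<times> closure D) (\<lambda>p. (fst p, t, snd p, s))"
          by (intro continuous_intros)
        show "(\<lambda>p. (fst p, t, snd p, s)) ` (closure D \<times> closure D)
          \<subseteq> {(x, t, y, s). x \<in> closure D \<and> y \<in> closure D \<and> 0 \<le> s \<and> s < t \<and> t \<le> T}"
          using that by auto
      qed
      then show ?thesis by (simp add: split_beta)
    qed
    show "u = forward_evolution D g 0 \<phi>" "v = adjoint_evolution D g' T \<psi>" by fact+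
    show "0 < u x t" "0 < v x t" if "x \<in> closure D" "0 \<le> t" "t \<le> T" for x t
      using pos_data that by auto
    show "continuous_on (closure D) (\<lambda>x. u x t)" "continuous_on (closure D) (\<lambda>x. v x t)"
      if "0 \<le> t" "t \<le> T" for t
      using slice[OF u_cont that] slice[OF v_cont that] by auto
    show "bernstein_process D T g (\<lambda>x y. \<phi> x * g y T x 0 * \<psi> y) M Z"
      using \<open>bernstein_process D T g \<mu> M Z\<close> unfolding \<mu>_def .
  qed
  show ?thesis
    unfolding \<mu>0_def \<mu>T_def
    by (intro conjI allI impI ballI emeasure_forward emeasure_backward forward_markov_process
        backward_markov_process emeasure_one) auto
qed

end
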